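(* Let $S$ be a finite non-empty set with $|S|=n$, let $f\colon 2^S\to[0,\infty)$ be non-decreasing and submodular with $f(\emptyset)=0$ and $f(A)>0$ for all $A\neq\emptyset$, and let $g\colon 2^S\to[0,\infty)$ be non-decreasing and supermodular with $g(\emptyset)=0$ and $g(A)<g(S)$ for all $A\neq S$. Suppose that $f$ and $g$ are given by value oracles, that $f$ has total curvature $\kappa_f<1$, and that $g^\#$ has total curvature $\kappa_{g^\#}<1$. Then there is a search strategy that can be computed in strongly polynomial time and approximates an optimal search strategy for the submodular search problem with approximation ratio $\frac{2}{1+\delta}$, where \[ \delta=\min\left\{\theta,\ \frac{2\theta\max\{1-\kappa_f,\,1-\kappa_{g^\#}\}}{1+\theta}\right\},\qquad \theta=(1-\kappa_f)(1-\kappa_{g^\#}). \] If either $f$ or $g$ is modular then the approximation ratio is $\frac{2}{1+\theta}$.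
   Context: A search is a permutation $\pi$ of $S$. For $j\in S$, $S_j^\pi$ is the set consisting of $j$ and all elements preceding $j$ in $\pi$. The submodular search problem is to find a search minimizing $c(\pi)=\sum_{j\in S}\bigl(g(S_j^\pi)-g(S_j^\pi\setminus\{j\})\bigr)f(S_j^\pi)$. A search $\pi$ has approximation ratio $\alpha$ if $c(\pi)\le\alpha\min_\sigma c(\sigma)$. The dual of $g$ is $g^\#(A)=g(S)-g(S\setminus A)$. The total curvature of a set function $u$ on $S$ with $u(\emptyset)=0$ and $u(\{s\})>0$ for all $s\in S$ is $\kappa_u=1-\min_{s\in S}\frac{u(S)-u(S\setminus\{s\})}{u(\{s\})}$. Strongly polynomial time means that the number of oracle calls and elementary arithmetic operations is bounded by a polynomial in $n$. *)

theory Defs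
  imports
    "HOL-Combinatorics.Multiset_Permutations"
    "HOL-Computational_Algebra.Polynomial"
    Complex_Main
begin

section \<open>Set functions on a finite ground set\<close>

definition submodular_on :: "'a set \<Rightarrow> ('a set \<Rightarrow> real) \<Rightarrow> bool" where
  "submodular_on S u \<longleftrightarrow>
     (\<forall>A B. A \<subseteq> S \<longrightarrow> B \<subseteq> S \<longrightarrow> u (A \<union> B) + u (A \<inter> B) \<le> u A + u B)"

definition supermodular_on :: "'a set \<Rightarrow> ('a set \<Rightarrow> real) \<Rightarrow> bool" where
  "supermodular_on S u \<longleftrightarrow>
     (\<forall>A B. A \<subseteq> S \<longrightarrow> B \<subseteq> S \<longrightarrow> u A + u B \<le> u (A \<union> B) + u (A \<inter> B))"

definition modular_on :: "'a set \<Rightarrow> ('a set \<Rightarrow> real) \<Rightarrow> bool" where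
  "modular_on S u \<longleftrightarrow> submodular_on S u \<and> supermodular_on S u"

definition dual :: "'a set \<Rightarrow> ('a set \<Rightarrow> real) \<Rightarrow> 'a set \<Rightarrow> real" where
  "dual S g A = g S - g (S - A)"

text \<open>
  Only meaningful if \<open>S\<close> is finite and non-empty, \<open>u {} = 0\<close> and \<open>u {s} > 0\<close> for all
  \<open>s \<in> S\<close>.
\<close>
definition total_curvature :: "'a set \<Rightarrow> ('a set \<Rightarrow> real) \<Rightarrow> real" where
  "total_curvature S u = 1 - Min ((\<lambda>s. (u S - u (S - {s})) / u {s}) ` S)"

section \<open>The submodular search problem\<close>

text \<open>
  A search of \<open>S\<close> is an element of \<open>permutations_of_set S\<close>, i.e. a list that contains
  every element of \<open>S\<close> exactly once.
\<close>

definition searched_upto :: "'a list \<Rightarrow> 'a \<Rightarrow> 'a set" where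
  "searched_upto \<pi> j = insert j (set (takeWhile (\<lambda>i. i \<noteq> j) \<pi>))"

definition search_cost ::
    "'a set \<Rightarrow> ('a set \<Rightarrow> real) \<Rightarrow> ('a set \<Rightarrow> real) \<Rightarrow> 'a list \<Rightarrow> real" where
  "search_cost S f g \<pi> =
     (\<Sum>j\<in>S. (g (searched_upto \<pi> j) - g (searched_upto \<pi> j - {j})) * f (searched_upto \<pi> j))"

definition has_approx_ratio ::
    "'a set \<Rightarrow> ('a set \<Rightarrow> real) \<Rightarrow> ('a set \<Rightarrow> real) \<Rightarrow> 'a list \<Rightarrow> real \<Rightarrow> bool" where
  "has_approx_ratio S f g \<pi> \<alpha> \<longleftrightarrow>
     search_cost S f g \<pi> \<le> \<alpha> * Min (search_cost S f g ` permutations_of_set S)"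

section \<open>Oracle algorithms with unit-cost real arithmetic\<close>

text \<open>
  Strongly polynomial algorithms are programs of a small imperative language over two
  memories, one holding natural numbers and one holding real numbers. Each memory consists of
  named arrays of arbitrary dimension, so that \<open>x[i, j]\<close> has the index list \<open>[i, j]\<close> and a
  scalar variable has the index list \<open>[]\<close>.

  The language is restricted so that counting steps is a sensible measure of running time:
  \<^item> Natural numbers, which serve for indexing and control, can only be added and subtracted
    (truncated at 0), so that in polynomially many steps they only reach a polynomial number
    of bits.
  \<^item> Reals support the four arithmetic operations and comparisons only. There is no rounding,
    and the only literals are 0 and 1, so a program cannot hide information in a constant.
  \<^item> The set functions are accessible only through value queries.

  Division by zero yields 0 as usual in HOL; a program can test for it anyway.
\<close>

type_synonym name = string

datatype nexp =
    NConst nat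
  | NVar name "nexp list"
  | NAdd nexp nexp
  | NSub nexp nexp

datatype rexp =
    RZero
  | ROne
  | RVar name "nexp list"
  | RAdd rexp rexp
  | RSub rexp rexp
  | RMul rexp rexp
  | RDiv rexp rexp

datatype bexp =
    NLess nexp nexp
  | RLess rexp rexp
  | BNot bexp
  | BAnd bexp bexp

text \<open>
  \<open>QueryF x es A ds\<close> and \<open>QueryG x es A ds\<close> store the answer of the respective oracle in the
  real variable \<open>x[es]\<close>. The queried set is passed by its characteristic vector, the row
  \<open>A[ds, 0], \<dots>, A[ds, n - 1]\<close> of the array \<open>A\<close> of natural numbers.
\<close>
datatype com =
    Skip
  | NAssign name "nexp list" nexp
  | RAssign name "nexp list" rexp
  | QueryF name "nexp list" name "nexp list"
  | QueryG name "nexp list" name "nexp list"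
  | Seq com com
  | Cond bexp com com
  | While bexp com

type_synonym 'v memory = "name \<Rightarrow> nat list \<Rightarrow> 'v"
type_synonym state = "nat memory \<times> real memory"

definition store :: "'v memory \<Rightarrow> name \<Rightarrow> nat list \<Rightarrow> 'v \<Rightarrow> 'v memory" where
  "store m x is v = m(x := (m x)(is := v))"

fun nval :: "nat memory \<Rightarrow> nexp \<Rightarrow> nat" where
  "nval N (NConst k) = k"
| "nval N (NVar x es) = N x (map (nval N) es)"
| "nval N (NAdd a b) = nval N a + nval N b"
| "nval N (NSub a b) = nval N a - nval N b"

fun rval :: "state \<Rightarrow> rexp \<Rightarrow> real" where
  "rval s RZero = 0"
| "rval s ROne = 1"
| "rval s (RVar x es) = snd s x (map (nval (fst s)) es)"
| "rval s (RAdd a b) = rval s a + rval s b"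
| "rval s (RSub a b) = rval s a - rval s b"
| "rval s (RMul a b) = rval s a * rval s b"
| "rval s (RDiv a b) = rval s a / rval s b"

fun bval :: "state \<Rightarrow> bexp \<Rightarrow> bool" where
  "bval s (NLess a b) \<longleftrightarrow> nval (fst s) a < nval (fst s) b"
| "bval s (RLess a b) \<longleftrightarrow> rval s a < rval s b"
| "bval s (BNot b) \<longleftrightarrow> \<not> bval s b"
| "bval s (BAnd b c) \<longleftrightarrow> bval s b \<and> bval s c"

text \<open>
  Every memory access, arithmetic operation, comparison, logical connective, oracle call and
  executed instruction takes one step. In particular, the number of steps is an upper bound on
  the number of oracle calls plus the number of arithmetic operations.
\<close>

fun ncost :: "nexp \<Rightarrow> nat" where
  "ncost (NConst k) = 1"
| "ncost (NVar x es) = 1 + sum_list (map ncost es)"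
| "ncost (NAdd a b) = 1 + ncost a + ncost b"
| "ncost (NSub a b) = 1 + ncost a + ncost b"

fun rcost :: "rexp \<Rightarrow> nat" where
  "rcost RZero = 1"
| "rcost ROne = 1"
| "rcost (RVar x es) = 1 + sum_list (map ncost es)"
| "rcost (RAdd a b) = 1 + rcost a + rcost b"
| "rcost (RSub a b) = 1 + rcost a + rcost b"
| "rcost (RMul a b) = 1 + rcost a + rcost b"
| "rcost (RDiv a b) = 1 + rcost a + rcost b"

fun bcost :: "bexp \<Rightarrow> nat" where
  "bcost (NLess a b) = 1 + ncost a + ncost b"
| "bcost (RLess a b) = 1 + rcost a + rcost b"
| "bcost (BNot b) = 1 + bcost b"
| "bcost (BAnd b c) = 1 + bcost b + bcost c"

text \<open>The set encoded by the row \<open>A[ds, 0], \<dots>, A[ds, n - 1]\<close>.\<close>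
definition row_set :: "nat \<Rightarrow> nat memory \<Rightarrow> name \<Rightarrow> nat list \<Rightarrow> nat set" where
  "row_set n N A ds = {i. i < n \<and> N A (ds @ [i]) \<noteq> 0}"

text \<open>
  \<open>exec F G n c s t s'\<close>: on a ground set \<open>{0, \<dots>, n - 1}\<close> with value oracles \<open>F\<close> and \<open>G\<close>,
  program \<open>c\<close> started in state \<open>s\<close> terminates in state \<open>s'\<close> after \<open>t\<close> steps.
\<close>
inductive exec ::
    "(nat set \<Rightarrow> real) \<Rightarrow> (nat set \<Rightarrow> real) \<Rightarrow> nat \<Rightarrow> com \<Rightarrow> state \<Rightarrow> nat \<Rightarrow> state \<Rightarrow> bool"
  for F G :: "nat set \<Rightarrow> real" and n :: nat where
  exec_Skip: "exec F G n Skip s 1 s"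
| exec_NAssign:
    "exec F G n (NAssign x es e) (N, R) (1 + sum_list (map ncost es) + ncost e)
       (store N x (map (nval N) es) (nval N e), R)"
| exec_RAssign:
    "exec F G n (RAssign x es e) (N, R) (1 + sum_list (map ncost es) + rcost e)
       (N, store R x (map (nval N) es) (rval (N, R) e))"
| exec_QueryF:
    "exec F G n (QueryF x es A ds) (N, R)
       (1 + sum_list (map ncost es) + sum_list (map ncost ds))
       (N, store R x (map (nval N) es) (F (row_set n N A (map (nval N) ds))))"
| exec_QueryG:
    "exec F G n (QueryG x es A ds) (N, R)
       (1 + sum_list (map ncost es) + sum_list (map ncost ds))
       (N, store R x (map (nval N) es) (G (row_set n N A (map (nval N) ds))))"
| exec_Seq:
    "exec F G n c1 s1 t1 s2 \<Longrightarrow> exec F G n c2 s2 t2 s3 \<Longrightarrow>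
     exec F G n (Seq c1 c2) s1 (1 + t1 + t2) s3"
| exec_CondTrue:
    "bval s b \<Longrightarrow> exec F G n c1 s t s' \<Longrightarrow> exec F G n (Cond b c1 c2) s (1 + bcost b + t) s'"
| exec_CondFalse:
    "\<not> bval s b \<Longrightarrow> exec F G n c2 s t s' \<Longrightarrow> exec F G n (Cond b c1 c2) s (1 + bcost b + t) s'"
| exec_WhileFalse:
    "\<not> bval s b \<Longrightarrow> exec F G n (While b c) s (1 + bcost b) s"
| exec_WhileTrue:
    "bval s1 b \<Longrightarrow> exec F G n c s1 t1 s2 \<Longrightarrow> exec F G n (While b c) s2 t2 s3 \<Longrightarrow>
     exec F G n (While b c) s1 (1 + bcost b + t1 + t2) s3"

inductive_cases exec_SkipE: "exec F G n Skip s t s'"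
inductive_cases exec_NAssignE: "exec F G n (NAssign x es e) s t s'"
inductive_cases exec_RAssignE: "exec F G n (RAssign x es e) s t s'"
inductive_cases exec_QueryFE: "exec F G n (QueryF x es A ds) s t s'"
inductive_cases exec_QueryGE: "exec F G n (QueryG x es A ds) s t s'"
inductive_cases exec_SeqE: "exec F G n (Seq c1 c2) s t s'"
inductive_cases exec_CondE: "exec F G n (Cond b c1 c2) s t s'"
inductive_cases exec_WhileE: "exec F G n (While b c) s t s'"

text \<open>
  Programs are deterministic, so that a program computes at most one output and has at most one
  running time on each input.
\<close>
lemma exec_deterministic:
  assumes "exec F G n c s t s'" and "exec F G n c s u s''"
  shows "t = u \<and> s' = s''"
  using assms
proof (induction arbitrary: u s'' rule: exec.induct)
  case (exec_Skip s)
  then show ?case by (elim exec_SkipE) simp_all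
next
  case (exec_NAssign x es e N R)
  then show ?case by (elim exec_NAssignE) simp_all
next
  case (exec_RAssign x es e N R)
  then show ?case by (elim exec_RAssignE) simp_all
next
  case (exec_QueryF x es A ds N R)
  then show ?case by (elim exec_QueryFE) simp_all
next
  case (exec_QueryG x es A ds N R)
  then show ?case by (elim exec_QueryGE) simp_all
next
  case (exec_Seq c1 s1 t1 s2 c2 t2 s3)
  from exec_Seq.prems obtain u1 u2 r where
    u: "u = Suc (u1 + u2)" "exec F G n c1 s1 u1 r" "exec F G n c2 r u2 s''"
    by (blast elim: exec_SeqE)
  from exec_Seq.IH(1)[OF u(2)] have r: "t1 = u1" "s2 = r" by simp_all
  have "t2 = u2 \<and> s3 = s''" by (rule exec_Seq.IH(2)) (use u(3) r in simp)
  with r u(1) show ?case by simp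
next
  case (exec_CondTrue s b c1 t s' c2)
  from exec_CondTrue.prems exec_CondTrue.hyps(1) obtain u1 where
    u: "u = Suc (bcost b + u1)" "exec F G n c1 s u1 s''"
    by (blast elim: exec_CondE)
  from exec_CondTrue.IH[OF u(2)] u(1) show ?case by simp
next
  case (exec_CondFalse s b c2 t s' c1)
  from exec_CondFalse.prems exec_CondFalse.hyps(1) obtain u1 where
    u: "u = Suc (bcost b + u1)" "exec F G n c2 s u1 s''"
    by (blast elim: exec_CondE)
  from exec_CondFalse.IH[OF u(2)] u(1) show ?case by simp
next
  case (exec_WhileFalse s b c)
  from exec_WhileFalse.prems show ?case
    by (rule exec_WhileE) (use exec_WhileFalse.hyps in simp_all)
next
  case (exec_WhileTrue s1 b c t1 s2 t2 s3)
  from exec_WhileTrue.prems exec_WhileTrue.hyps(1) obtain u1 u2 r where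
    u: "u = Suc (bcost b + u1 + u2)" "exec F G n c s1 u1 r" "exec F G n (While b c) r u2 s''"
    by (blast elim: exec_WhileE)
  from exec_WhileTrue.IH(1)[OF u(2)] have r: "t1 = u1" "s2 = r" by simp_all
  have "t2 = u2 \<and> s3 = s''" by (rule exec_WhileTrue.IH(2)) (use u(3) r in simp)
  with r u(1) show ?case by simp
qed

text \<open>Initially all memory is 0, except for the natural number variable \<open>n\<close>.\<close>
definition init_state :: "nat \<Rightarrow> state" where
  "init_state n = (store (\<lambda>_ _. 0) ''n'' [] n, \<lambda>_ _. 0)"

text \<open>
  The program is given the ground set as a list \<open>xs\<close> of its elements in arbitrary order, and
  handles the element \<open>xs ! i\<close> through its index \<open>i\<close>. It outputs the list \<open>\<pi>\<close> whose indices it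
  leaves in the array \<open>out[0], \<dots>, out[n - 1]\<close> of natural numbers.
\<close>
definition computes_list ::
    "com \<Rightarrow> 'a list \<Rightarrow> ('a set \<Rightarrow> real) \<Rightarrow> ('a set \<Rightarrow> real) \<Rightarrow> nat \<Rightarrow> 'a list \<Rightarrow> bool" where
  "computes_list c xs f g t \<pi> \<longleftrightarrow>
     (\<exists>N R. exec (\<lambda>I. f ((!) xs ` I)) (\<lambda>I. g ((!) xs ` I)) (length xs) c
              (init_state (length xs)) t (N, R)
          \<and> (\<forall>i < length xs. N ''out'' [i] < length xs)
          \<and> \<pi> = map (\<lambda>i. xs ! N ''out'' [i]) [0..<length xs])"

end

theory Submission
  imports Defs "HOL-Analysis.Convex"
begin

text \<open>
  Write \<open>a = 1 - \<kappa>\<^sub>f\<close>, \<open>b = 1 - \<kappa>\<^sub>g\<close> for the two total curvatures and \<open>\<theta> = a b\<close>; the ratio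
  \<open>2 / (1 + \<theta>)\<close> is reached in all cases, which suffices since \<open>\<delta> \<le> \<theta>\<close>.

  If \<open>x\<close> and \<open>y\<close> are bases of \<open>f\<close> and \<open>g\<close>, then the cost of every search is at least its cost
  for the modular functions \<open>x\<close> and \<open>y\<close>, hence at least the value of Smith's rule. The
  algorithm cuts the ground set into consecutive blocks on which \<open>y\<close> is nearly \<open>\<kappa> x\<close>, with
  \<open>\<kappa>\<close> decreasing from block to block (an approximate Sidney decomposition). Inside a block the
  elements are sorted by \<open>f {e} / \<gamma>\<^sub>e\<close> where \<open>\<gamma>\<^sub>e = g S - g (S - {e})\<close>. Scale to \<open>f = g = 1\<close> on the
  block, and let \<open>H\<close> and \<open>H'\<close> be the sums of \<open>f {i} \<gamma>\<^sub>j\<close> over the pairs with \<open>j\<close> before \<open>i\<close> and with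
  \<open>i\<close> before \<open>j\<close>. The cost of the block is at most \<open>1 - \<theta> H\<close> and at most \<open>H' + \<Sum>f {i} \<gamma>\<^sub>i\<close>, and
  the sorting gives \<open>H' \<le> H\<close>. Adding \<open>\<theta>\<close> times the second bound to the first one bounds \<open>1 + \<theta>\<close>
  times the cost by \<open>1 + \<Sum>x\<^sub>i\<^sup>2\<close>, which is twice the lower bound.

  No exact submodular minimisation is needed. The bound for a block has a relative slack of order
  \<open>(1 - \<theta>) / n\<close>, and the base polytope of \<open>u = \<kappa> f - g\<close> has diameter of order \<open>1 - \<theta>\<close>, so a
  number of Frank--Wolfe steps towards its point of minimum norm that is polynomial in \<open>n\<close> alone
  either certifies the block or meets a set that is provably the exact minimiser of \<open>u\<close> among
  its subsets, or among its supersets, in the block. Such a cut keeps the densities monotone.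
\<close>

section \<open>Bases of submodular functions\<close>

text \<open>Two demands conflict. Smith's rule needs labels that decrease exactly along the order,
  so a cut must be exact; but the running time may depend on n alone, so an iterate cannot be driven
  to a prescribed absolute accuracy before cutting. The Frank--Wolfe gap resolves this. Sort the
  elements by the iterate z and let the defect of a prefix be its slack in the base inequality. A
  prefix whose neighbouring coordinate of z outweighs its defect is a certified cut. If there is no
  such prefix, the squared norm of z is at most M^3 times the gap, where M = n + 1. This bounds the
  norm by the diameter before any step is made, and it makes every further step effective. Step
  length M^-37 and step number M^81 thus depend on n only, and the program never refers to the
  curvatures. If \<theta> = 1, tolerance and diameter vanish together and nothing has to be
  approximated. Pairs of elements in different blocks lose a factor (1 - slack)^2 in the lower
  bound; it is paid from the excess of 2 / (1 + \<theta>) over 1, which is of order 1 -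
  \<theta>.\<close>

definition base :: "('a set \<Rightarrow> real) \<Rightarrow> 'a set \<Rightarrow> 'a set \<Rightarrow> ('a \<Rightarrow> real) \<Rightarrow> bool" where
  "base u A B x \<longleftrightarrow> (\<forall>D\<subseteq>B. sum x D \<le> u (A \<union> D) - u A) \<and> sum x B = u (A \<union> B) - u A"

text \<open>Bases of a supermodular function, with all inequalities reversed.\<close>

abbreviation cobase :: "('a set \<Rightarrow> real) \<Rightarrow> 'a set \<Rightarrow> 'a set \<Rightarrow> ('a \<Rightarrow> real) \<Rightarrow> bool" where
  "cobase u A B y \<equiv> base (\<lambda>X. - u X) A B (\<lambda>e. - y e)"

abbreviation pre :: "(nat \<Rightarrow> 'a) \<Rightarrow> nat \<Rightarrow> 'a set" where
  "pre \<pi> k \<equiv> \<pi> ` {..<k}"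

lemma supermodular_on_uminus: "supermodular_on V u \<Longrightarrow> submodular_on V (\<lambda>X. - u X)"
  unfolding supermodular_on_def submodular_on_def by (auto simp: algebra_simps)

lemma submodular_on_combination:
  assumes "submodular_on V f" "supermodular_on V g" "0 \<le> c"
  shows "submodular_on V (\<lambda>X. c * f X - g X)"
  unfolding submodular_on_def
proof (intro allI impI)
  fix A B assume AB: "A \<subseteq> V" "B \<subseteq> V"
  have "c * (f (A \<union> B) + f (A \<inter> B)) \<le> c * (f A + f B)"
    using assms AB by (intro mult_left_mono) (auto simp: submodular_on_def)
  moreover have "g A + g B \<le> g (A \<union> B) + g (A \<inter> B)"
    using assms(2) AB by (auto simp: supermodular_on_def)
  ultimately show "c * f (A \<union> B) - g (A \<union> B) + (c * f (A \<inter> B) - g (A \<inter> B))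
      \<le> c * f A - g A + (c * f B - g B)" by (simp add: algebra_simps)
qed

lemma diminishing_returns:
  assumes "submodular_on V u" "A \<subseteq> B" "B \<subseteq> V" "e \<in> V" "e \<notin> B"
  shows "u (insert e B) - u B \<le> u (insert e A) - u A"
proof -
  have "insert e A \<union> B = insert e B" "insert e A \<inter> B = A" using assms by auto
  moreover have "u (insert e A \<union> B) + u (insert e A \<inter> B) \<le> u (insert e A) + u B"
    using assms(1) unfolding submodular_on_def
    by (elim allE[of _ "insert e A"] allE[of _ B]) (use assms in auto)
  ultimately show ?thesis by simp
qed

lemma pre_split: "l \<le> r \<Longrightarrow> pre \<pi> r = pre \<pi> l \<union> \<pi> ` {l..<r}"
  by (auto simp flip: image_Un intro!: arg_cong[where f = "image \<pi>"])

lemma pre_Suc: "pre \<pi> (Suc k) = insert (\<pi> k) (pre \<pi> k)"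
  by (simp add: lessThan_Suc)

lemma seg_disjoint:
  assumes "inj_on \<pi> {..<n}" "r \<le> n"
  shows "pre \<pi> l \<inter> \<pi> ` {l..<r} = {}"
proof -
  have "\<pi> i \<noteq> \<pi> j" if "i < l" "l \<le> j" "j < r" for i j
    using assms that inj_onD[of \<pi> "{..<n}" i j] by auto
  then show ?thesis by auto
qed

text \<open>Edmonds' greedy vertex, for the contraction of \<open>u\<close> by
  \<open>pre \<pi> l\<close>. Only sets D containing the newest element are affected when r grows,
  and the marginal of that element over the whole prefix is at most its marginal over the part that
  lies in D.\<close>

lemma base_greedy:
  assumes sub: "submodular_on V u" and inj: "inj_on \<pi> {..<n}" and V: "\<pi> ` {..<n} \<subseteq> V"
    and lr: "l \<le> r" "r \<le> n"
    and x: "\<And>k. l \<le> k \<Longrightarrow> k < r \<Longrightarrow> x (\<pi> k) = u (pre \<pi> (Suc k)) - u (pre \<pi> k)"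
  shows "base u (pre \<pi> l) (\<pi> ` {l..<r}) x"
  using lr x
proof (induction r rule: dec_induct)
  case base
  then show ?case by (simp add: base_def)
next
  case (step r)
  have IH: "base u (pre \<pi> l) (\<pi> ` {l..<r}) x" using step by auto
  have xr: "x (\<pi> r) = u (insert (\<pi> r) (pre \<pi> r)) - u (pre \<pi> r)"
    using step.prems(2)[of r] step.hyps by (simp add: pre_Suc)
  have seg: "\<pi> ` {l..<Suc r} = insert (\<pi> r) (\<pi> ` {l..<r})"
    using step.hyps by (simp add: atLeastLessThanSuc)
  have notin: "\<pi> r \<notin> pre \<pi> r"
  proof
    assume "\<pi> r \<in> pre \<pi> r"
    then obtain i where "i < r" "\<pi> r = \<pi> i" by auto
    then show False using inj_onD[OF inj, of r i] step.prems(1) by simp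
  qed
  have pr: "pre \<pi> r = pre \<pi> l \<union> \<pi> ` {l..<r}" using step.hyps(1) by (rule pre_split)
  have fin: "finite (\<pi> ` {l..<r})" by simp
  show ?case unfolding base_def
  proof (intro conjI allI impI)
    fix D assume D: "D \<subseteq> \<pi> ` {l..<Suc r}"
    show "sum x D \<le> u (pre \<pi> l \<union> D) - u (pre \<pi> l)"
    proof (cases "\<pi> r \<in> D")
      case False
      then have "D \<subseteq> \<pi> ` {l..<r}" using D seg by auto
      then show ?thesis using IH unfolding base_def by blast
    next
      case True
      define D' where "D' = D - {\<pi> r}"
      have D': "D' \<subseteq> \<pi> ` {l..<r}" "D = insert (\<pi> r) D'" "\<pi> r \<notin> D'"
        using D seg True by (auto simp: D'_def)
      have fD: "finite D'" using D' fin finite_subset by blast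
      have "sum x D = x (\<pi> r) + sum x D'" using D' fD by simp
      also have "\<dots> \<le> x (\<pi> r) + (u (pre \<pi> l \<union> D') - u (pre \<pi> l))"
        using IH D'(1) unfolding base_def by auto
      also have "x (\<pi> r) \<le> u (insert (\<pi> r) (pre \<pi> l \<union> D')) - u (pre \<pi> l \<union> D')"
        unfolding xr
      proof (rule diminishing_returns[OF sub])
        show "pre \<pi> l \<union> D' \<subseteq> pre \<pi> r" using pr D'(1) by auto
        show "pre \<pi> r \<subseteq> V" "\<pi> r \<in> V" using V step.prems(1) by auto
      qed (rule notin)
      finally show ?thesis using D'(2) by simp
    qed
  next
    have "sum x (\<pi> ` {l..<Suc r}) = x (\<pi> r) + sum x (\<pi> ` {l..<r})"
      unfolding seg using fin notin pr by simp
    also have "sum x (\<pi> ` {l..<r}) = u (pre \<pi> r) - u (pre \<pi> l)"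
      using IH pr unfolding base_def by simp
    finally show "sum x (\<pi> ` {l..<Suc r}) = u (pre \<pi> l \<union> \<pi> ` {l..<Suc r}) - u (pre \<pi> l)"
      unfolding xr seg pr by simp
  qed
qed

lemma base_convex:
  assumes "base u A B x" "base u A B x'" "0 \<le> t" "t \<le> 1"
  shows "base u A B (\<lambda>e. x e + t * (x' e - x e))"
proof -
  have eq: "sum (\<lambda>e. x e + t * (x' e - x e)) D = (1 - t) * sum x D + t * sum x' D" for D
    by (simp add: sum.distrib sum_subtractf sum_distrib_left algebra_simps)
  have "(1 - t) * sum x D + t * sum x' D
      \<le> (1 - t) * (u (A \<union> D) - u A) + t * (u (A \<union> D) - u A)" if "D \<subseteq> B" for D
    using assms that by (intro add_mono mult_left_mono) (auto simp: base_def)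
  moreover have "(1 - t) * sum x B + t * sum x' B = u (A \<union> B) - u A"
  proof -
    have "sum x B = u (A \<union> B) - u A" "sum x' B = u (A \<union> B) - u A"
      using assms by (auto simp: base_def)
    then show ?thesis by (simp only:) (simp add: algebra_simps)
  qed
  ultimately show ?thesis unfolding base_def eq by (simp add: algebra_simps)
qed

text \<open>A base of the restriction and one of the contraction fit together: their two bounds add
  up by submodularity for \<open>A \<union> D\<close> and \<open>A \<union> B1\<close>.\<close>

lemma base_glue:
  assumes sub: "submodular_on V u" and V: "A \<union> B1 \<union> B2 \<subseteq> V"
    and dis: "A \<inter> B2 = {}" "B1 \<inter> B2 = {}" and fin: "finite B1" "finite B2"
    and b1: "base u A B1 x" and b2: "base u (A \<union> B1) B2 x'"
  shows "base u A (B1 \<union> B2) (\<lambda>e. if e \<in> B1 then x e else x' e)" (is "base u A _ ?z")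
proof -
  have sp: "sum ?z D = sum x (D \<inter> B1) + sum x' (D \<inter> B2)" if "D \<subseteq> B1 \<union> B2" for D
  proof -
    have "D = (D \<inter> B1) \<union> (D \<inter> B2)" using that by auto
    then have "sum ?z D = sum ?z ((D \<inter> B1) \<union> (D \<inter> B2))" by simp
    also have "\<dots> = sum ?z (D \<inter> B1) + sum ?z (D \<inter> B2)"
      using fin dis by (intro sum.union_disjoint) auto
    also have "sum ?z (D \<inter> B1) = sum x (D \<inter> B1)" by (intro sum.cong) auto
    also have "sum ?z (D \<inter> B2) = sum x' (D \<inter> B2)" using dis by (intro sum.cong) auto
    finally show ?thesis .
  qed
  show ?thesis unfolding base_def
  proof (intro conjI allI impI)
    fix D assume D: "D \<subseteq> B1 \<union> B2"
    have "sum ?z D \<le> (u (A \<union> (D \<inter> B1)) - u A) + (u (A \<union> B1 \<union> (D \<inter> B2)) - u (A \<union> B1))"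
      unfolding sp[OF D] using b1 b2 by (intro add_mono) (auto simp: base_def)
    also have "\<dots> \<le> u (A \<union> D) - u A"
    proof -
      have eq: "(A \<union> D) \<union> (A \<union> B1) = A \<union> B1 \<union> (D \<inter> B2)" "(A \<union> D) \<inter> (A \<union> B1) = A \<union> (D \<inter> B1)"
        using D dis by auto
      have "A \<union> D \<subseteq> V" "A \<union> B1 \<subseteq> V" using D V by auto
      then have "u ((A \<union> D) \<union> (A \<union> B1)) + u ((A \<union> D) \<inter> (A \<union> B1)) \<le> u (A \<union> D) + u (A \<union> B1)"
        using sub unfolding submodular_on_def by blast
      then show ?thesis unfolding eq by simp
    qed
    finally show "sum ?z D \<le> u (A \<union> D) - u A" .
  next
    have "sum ?z (B1 \<union> B2) = sum x B1 + sum x' B2"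
      using sp[of "B1 \<union> B2"] by (simp add: Int_absorb1)
    then show "sum ?z (B1 \<union> B2) = u (A \<union> (B1 \<union> B2)) - u A"
      using b1 b2 by (simp add: base_def Un_assoc)
  qed
qed

lemma base_combination:
  assumes "base f A B x" "cobase g A B y" "0 \<le> c"
  shows "base (\<lambda>X. c * f X - g X) A B (\<lambda>e. c * x e - y e)"
proof -
  have eq: "sum (\<lambda>e. c * x e - y e) D = c * sum x D + sum (\<lambda>e. - y e) D" for D
    by (simp add: sum_subtractf sum_distrib_left sum_negf)
  have "c * sum x D + sum (\<lambda>e. - y e) D \<le> c * (f (A \<union> D) - f A) + (- g (A \<union> D) - - g A)"
    if "D \<subseteq> B" for D
    using assms that by (intro add_mono mult_left_mono) (auto simp: base_def)
  moreover have "c * sum x B + sum (\<lambda>e. - y e) B = c * (f (A \<union> B) - f A) + (- g (A \<union> B) - - g A)"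
    using assms by (simp add: base_def)
  ultimately show ?thesis unfolding base_def eq by (simp add: algebra_simps)
qed

lemma base_upper: "base u A B x \<Longrightarrow> e \<in> B \<Longrightarrow> x e \<le> u (insert e A) - u A"
  unfolding base_def by (drule conjunct1, drule spec[of _ "{e}"]) auto

lemma base_lower:
  assumes "base u A B x" "e \<in> B" "finite B"
  shows "u (A \<union> B) - u (A \<union> (B - {e})) \<le> x e"
proof -
  have "sum x B = x e + sum x (B - {e})" using assms by (simp add: sum.remove)
  moreover have "sum x (B - {e}) \<le> u (A \<union> (B - {e})) - u A" using assms unfolding base_def by blast
  moreover have "sum x B = u (A \<union> B) - u A" using assms unfolding base_def by blast
  ultimately show ?thesis by linarith
qed

section \<open>Sorted vectors and their Frank--Wolfe gap\<close>

lemma abel_sum: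
  fixes z \<tau> :: "nat \<Rightarrow> real"
  assumes "l < r"
  shows "(\<Sum>i=l..<r. z i * (\<tau> i - \<tau> (Suc i)))
    = z l * \<tau> l - z (r - 1) * \<tau> r + (\<Sum>k=Suc l..<r. (z k - z (k - 1)) * \<tau> k)"
  using assms
proof (induction r)
  case (Suc r)
  then show ?case by (cases "l = r") (auto simp: algebra_simps)
qed simp

text \<open>With \<tau> the defects of z, the sum is the inner product of z with z minus the greedy
  vertex, that is, the Frank--Wolfe gap. Abel summation makes it a sum of products of an increment
  of z and a defect.\<close>

lemma gap_nonneg:
  fixes z \<tau> :: "nat \<Rightarrow> real"
  assumes "\<tau> l = 0" "\<tau> r = 0" and \<tau>: "\<And>k. l \<le> k \<Longrightarrow> k \<le> r \<Longrightarrow> 0 \<le> \<tau> k"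
    and z: "\<And>k. l \<le> k \<Longrightarrow> Suc k < r \<Longrightarrow> z k \<le> z (Suc k)" and "l < r"
  shows "0 \<le> (\<Sum>i=l..<r. z i * (\<tau> i - \<tau> (Suc i)))"
proof -
  have "0 \<le> (z k - z (k - 1)) * \<tau> k" if "k \<in> {Suc l..<r}" for k
    using z[of "k - 1"] that by (intro mult_nonneg_nonneg \<tau>) auto
  then have "0 \<le> (\<Sum>k=Suc l..<r. (z k - z (k - 1)) * \<tau> k)" by (rule sum_nonneg)
  then show ?thesis using abel_sum[of l r z \<tau>] assms by simp
qed

text \<open>All products in the Abel sum are nonnegative, so each is below the gap: z can jump only
  where the prefix is almost tight.\<close>

lemma gap_term:
  fixes z \<tau> :: "nat \<Rightarrow> real"
  assumes "\<tau> l = 0" "\<tau> r = 0" and \<tau>: "\<And>k. l \<le> k \<Longrightarrow> k \<le> r \<Longrightarrow> 0 \<le> \<tau> k"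
    and z: "\<And>k. l \<le> k \<Longrightarrow> Suc k < r \<Longrightarrow> z k \<le> z (Suc k)"
    and k: "l \<le> k" "Suc k < r"
  shows "(z (Suc k) - z k) * \<tau> (Suc k) \<le> (\<Sum>i=l..<r. z i * (\<tau> i - \<tau> (Suc i)))"
proof -
  have "(z (Suc k) - z (Suc k - 1)) * \<tau> (Suc k) \<le> (\<Sum>k=Suc l..<r. (z k - z (k - 1)) * \<tau> k)"
  proof (rule member_le_sum)
    fix j assume "j \<in> {Suc l..<r} - {Suc k}"
    then show "0 \<le> (z j - z (j - 1)) * \<tau> j"
      using z[of "j - 1"] by (intro mult_nonneg_nonneg \<tau>) auto
  qed (use k in auto)
  then show ?thesis using abel_sum[of l r z \<tau>] assms by simp
qed

text \<open>The bound is propagated from \<open>i\<close> to the end of the segment where \<open>\<tau>\<close> vanishes: as long as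
  \<open>\<bar>z\<bar>\<close> is large, \<open>\<tau>\<close> is large by the absence of cuts, so that \<open>z\<close> can grow only a little.\<close>

lemma no_cut_bound:
  fixes z \<tau> :: "nat \<Rightarrow> real" and N :: nat
  assumes \<tau>0: "\<tau> l = 0" "\<tau> r = 0" and \<tau>: "\<And>k. l \<le> k \<Longrightarrow> k \<le> r \<Longrightarrow> 0 \<le> \<tau> k"
    and z: "\<And>k. l \<le> k \<Longrightarrow> Suc k < r \<Longrightarrow> z k \<le> z (Suc k)"
    and left: "\<And>k. l \<le> k \<Longrightarrow> k < r \<Longrightarrow> - \<tau> (Suc k) \<le> z k"
    and right: "\<And>k. l \<le> k \<Longrightarrow> k < r \<Longrightarrow> z k \<le> \<tau> k"
    and i: "l \<le> i" "i < r" and N: "r - l \<le> N"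
  shows "(z i)\<^sup>2 \<le> (real N)\<^sup>2 * (\<Sum>i=l..<r. z i * (\<tau> i - \<tau> (Suc i)))" (is "_ \<le> _ * ?gap")
proof (rule ccontr)
  assume "\<not> ?thesis"
  then have big: "(real N)\<^sup>2 * ?gap < (z i)\<^sup>2" by simp
  have N0: "0 < real N" using i N by simp
  define m where "m = \<bar>z i\<bar>"
  \<comment> \<open>If the claim fails, an increment of z and the defect at the same place cannot
    both reach \<open>m / N\<close>.\<close>
  have gt: "?gap < (m / N) * (m / N)"
    using big N0 by (simp add: m_def power2_eq_square field_simps)
  have gap_term': "(z (Suc k) - z k) * \<tau> (Suc k) \<le> ?gap" if "l \<le> k" "Suc k < r" for k
    using gap_term[of \<tau> l r z k] \<tau>0 \<tau> z that by auto
  have z_i0: "z i \<noteq> 0"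
  proof
    assume "z i = 0"
    then have "?gap < 0" using gt by (simp add: m_def)
    moreover have "0 \<le> ?gap"
      by (rule gap_nonneg) (use \<tau>0 \<tau> z i in auto)
    ultimately show False by simp
  qed
  then have m0: "0 < m" by (simp add: m_def)
  have step: "z (Suc k) - z k < m / N" if "l \<le> k" "Suc k < r" "m / N \<le> \<tau> (Suc k)" for k
  proof (rule ccontr)
    assume "\<not> ?thesis"
    then have "(m / N) * (m / N) \<le> (z (Suc k) - z k) * \<tau> (Suc k)"
      using that m0 N0 z[of k] by (intro mult_mono) auto
    then show False using gap_term'[OF that(1,2)] gt by linarith
  qed
  \<comment> \<open>At most N - 1 positions lie between i and an end of the segment, so losing less
    than \<open>m / N\<close> at each of them leaves a modulus of at least
    \<open>m / N\<close>.\<close>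
  have frac: "m / N \<le> m - real j * (m / N)" if "j < N" for j
  proof -
    have "real (Suc j) * (m / N) \<le> real N * (m / N)"
      using that m0 N0 by (intro mult_right_mono) auto
    also have "\<dots> = m" using N0 by simp
    finally show ?thesis by (simp add: algebra_simps add_divide_distrib)
  qed
  \<comment> \<open>For negative z the walk leads to r by \<open>left\<close>, otherwise to l by
    \<open>right\<close>. At either end the defect would be at least \<open>m / N\<close>, but it is
    0.\<close>
  show False
  proof (cases "z i < 0")
    case True
    have claim: "z (i + j) \<le> - m + real j * (m / N)" if "i + j < r" for j
      using that
    proof (induction j)
      case 0
      then show ?case using True by (simp add: m_def)
    next
      case (Suc j)
      then have IH: "z (i + j) \<le> - m + real j * (m / N)" by simp
      have "j < N" using Suc.prems i N by linarith
      then have "m / N \<le> - z (i + j)" using frac[of j] IH by linarith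
      then have "m / N \<le> \<tau> (Suc (i + j))" using left[of "i + j"] Suc.prems i by simp
      then have "z (Suc (i + j)) - z (i + j) < m / N" using step[of "i + j"] Suc.prems i by simp
      then show ?case using IH by (simp add: algebra_simps add_divide_distrib)
    qed
    define j where "j = r - 1 - i"
    have ij: "i + j < r" "Suc (i + j) = r" using i by (auto simp: j_def)
    have "j < N" using ij i N by linarith
    then have "m / N \<le> - z (i + j)" using frac[of j] claim[OF ij(1)] by linarith
    moreover have "- \<tau> r \<le> z (i + j)" using left[of "i + j"] ij i by simp
    ultimately show False using \<tau>0 divide_pos_pos[OF m0 N0] by linarith
  next
    case False
    have claim: "m - real j * (m / N) \<le> z (i - j)" if "l + j \<le> i" for j
      using that
    proof (induction j)
      case 0
      then show ?case using False by (simp add: m_def)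
    next
      case (Suc j)
      then have IH: "m - real j * (m / N) \<le> z (i - j)" by simp
      have "j < N" using Suc.prems i N by linarith
      then have "m / N \<le> z (i - j)" using frac[of j] IH by linarith
      moreover have "l \<le> i - j" "i - j < r" using Suc.prems i by auto
      ultimately have "m / N \<le> \<tau> (i - j)" using right[of "i - j"] by linarith
      moreover have sj: "Suc (i - Suc j) = i - j" using Suc.prems by simp
      ultimately have "z (i - j) - z (i - Suc j) < m / N"
        using step[of "i - Suc j"] Suc.prems i by auto
      then show ?case using IH by (simp add: algebra_simps add_divide_distrib)
    qed
    define j where "j = i - l"
    have ij: "l + j \<le> i" "i - j = l" using i by (auto simp: j_def)
    have "j < N" using i N by (auto simp: j_def)
    then have "m / N \<le> z l" using frac[of j] claim[OF ij(1)] ij by simp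
    moreover have "z l \<le> \<tau> l" using right[of l] i by simp
    ultimately show False using \<tau>0 divide_pos_pos[OF m0 N0] by linarith
  qed
qed

section \<open>Blocks of constant density\<close>

text \<open>With the positions as indices, \<open>tri I s t\<close> is the part of the search cost for the modular
  functions \<open>s\<close> and \<open>t\<close> that is due to pairs of distinct elements.\<close>

definition tri :: "'i::linorder set \<Rightarrow> ('i \<Rightarrow> real) \<Rightarrow> ('i \<Rightarrow> real) \<Rightarrow> real" where
  "tri I s t = (\<Sum>i\<in>I. \<Sum>j\<in>I. if i < j then s i * t j else 0)"

lemma tri_total:
  assumes "finite I"
  shows "sum s I * sum t I = tri I s t + tri I t s + (\<Sum>i\<in>I. s i * t i)"
proof -
  have "sum s I * sum t I = (\<Sum>i\<in>I. \<Sum>j\<in>I. s i * t j)" by (rule sum_product)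
  also have "\<dots> = (\<Sum>i\<in>I. \<Sum>j\<in>I. (if i < j then s i * t j else 0)
      + (if j < i then s i * t j else 0) + (if i = j then s i * t j else 0))"
    by (intro sum.cong refl) auto
  also have "\<dots> = tri I s t + (\<Sum>i\<in>I. \<Sum>j\<in>I. if j < i then s i * t j else 0)
      + (\<Sum>i\<in>I. s i * t i)"
    using assms by (simp add: tri_def sum.distrib)
  also have "(\<Sum>i\<in>I. \<Sum>j\<in>I. if j < i then s i * t j else 0) = tri I t s"
    unfolding tri_def by (subst sum.swap) (intro sum.cong refl, simp add: mult.commute)
  finally show ?thesis .
qed

lemma tri_mono:
  assumes "\<And>i. i \<in> I \<Longrightarrow> 0 \<le> s i \<and> s i \<le> s' i" "\<And>i. i \<in> I \<Longrightarrow> 0 \<le> t i \<and> t i \<le> t' i"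
  shows "tri I s t \<le> tri I s' t'"
  unfolding tri_def
proof (intro sum_mono)
  fix i j assume "i \<in> I" "j \<in> I"
  then have "s i * t j \<le> s' i * t' j"
    using assms(1)[of i] assms(2)[of j] by (intro mult_mono) auto
  then show "(if i < j then s i * t j else 0) \<le> (if i < j then s' i * t' j else 0)" by simp
qed

lemma tri_scale: "tri I (\<lambda>i. c * s i) (\<lambda>i. d * t i) = c * d * tri I s t"
  unfolding tri_def sum_distrib_left by (intro sum.cong refl) auto

lemma tri_diff:
  "tri I (\<lambda>i. s i - s' i) (\<lambda>i. t i - t' i) = tri I s t - tri I s' t - tri I s t' + tri I s' t'"
proof -
  have "tri I (\<lambda>i. s i - s' i) (\<lambda>i. t i - t' i) = (\<Sum>i\<in>I. \<Sum>j\<in>I.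
      ((if i < j then s i * t j else 0) - (if i < j then s' i * t j else 0)
      - (if i < j then s i * t' j else 0)) + (if i < j then s' i * t' j else 0))"
    unfolding tri_def by (intro sum.cong refl) (auto simp: algebra_simps)
  then show ?thesis by (simp add: tri_def sum.distrib sum_subtractf)
qed

lemma tri_nonneg: "(\<And>i. i \<in> I \<Longrightarrow> 0 \<le> s i) \<Longrightarrow> (\<And>i. i \<in> I \<Longrightarrow> 0 \<le> t i) \<Longrightarrow> 0 \<le> tri I s t"
  unfolding tri_def by (auto intro!: sum_nonneg)

lemma tri_le:
  assumes "finite I" "\<And>i. i \<in> I \<Longrightarrow> 0 \<le> s i" "\<And>i. i \<in> I \<Longrightarrow> 0 \<le> t i"
  shows "tri I s t \<le> sum s I * sum t I"
proof -
  have "0 \<le> tri I t s" using assms tri_nonneg by metis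
  moreover have "0 \<le> (\<Sum>i\<in>I. s i * t i)" using assms by (intro sum_nonneg) auto
  ultimately show ?thesis using tri_total[OF assms(1), of s t] by linarith
qed

lemma sum_square_le:
  fixes s :: "'i \<Rightarrow> real"
  shows "(sum s I)\<^sup>2 \<le> card I * (\<Sum>i\<in>I. (s i)\<^sup>2)"
  using sum_squared_le_sum_of_squares[of s I] by (simp only: mult.commute)

text \<open>The slack in the block bound: the defects \<open>\<mu>\<close> are at most \<open>c x\<close>, so the Cauchy--Schwarz
  inequality bounds their sum linearly in \<open>c = 1 - \<theta>\<close>.\<close>

lemma small_defect:
  fixes \<mu> x y :: "'i \<Rightarrow> real" and M c K :: real
  assumes I: "finite I" and card: "real (card I) \<le> N"
    and \<mu>: "\<And>i. i \<in> I \<Longrightarrow> 0 \<le> \<mu> i \<and> \<mu> i \<le> c * x i" and x: "\<And>i. i \<in> I \<Longrightarrow> 0 \<le> x i \<and> x i \<le> K"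
    and c: "0 \<le> c" "c \<le> 1" and F: "0 \<le> F" "K \<le> 2 * F"
    and \<zeta>: "(\<Sum>i\<in>I. \<bar>x i - y i\<bar>) \<le> \<zeta>" "4096 * N * \<zeta> \<le> c * F"
    and \<sigma>: "(\<Sum>i\<in>I. y i * \<mu> i) \<le> 4 * F * \<zeta>"
  shows "20 * sum \<mu> I \<le> c * F"
proof -
  have N0: "0 \<le> N" using card by linarith
  have \<zeta>0: "0 \<le> \<zeta>" using \<zeta>(1) sum_nonneg[of I "\<lambda>i. \<bar>x i - y i\<bar>"] by linarith
  have "(\<Sum>i\<in>I. (\<mu> i)\<^sup>2) \<le> (\<Sum>i\<in>I. c * (y i * \<mu> i + 2 * F * \<bar>x i - y i\<bar>))"
  proof (rule sum_mono)
    fix i assume i: "i \<in> I"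
    have "\<mu> i \<le> K" using \<mu>[OF i] x[OF i] c mult_left_le_one_le[of "x i" c] by linarith
    \<comment> \<open>One factor \<mu> is replaced by c x, and then x by y, at the price of their
      distance; this produces the factor c in front of a sum that is itself of order c.\<close>
    have "(\<mu> i)\<^sup>2 \<le> c * x i * \<mu> i"
      unfolding power2_eq_square using \<mu>[OF i] by (intro mult_right_mono) auto
    also have "\<dots> = c * (y i * \<mu> i + (x i - y i) * \<mu> i)" by (simp add: algebra_simps)
    also have "\<dots> \<le> c * (y i * \<mu> i + 2 * F * \<bar>x i - y i\<bar>)"
    proof -
      have "(x i - y i) * \<mu> i \<le> \<bar>x i - y i\<bar> * (2 * F)"
        using \<mu>[OF i] \<open>\<mu> i \<le> K\<close> F by (intro mult_mono) auto
      then show ?thesis using c by (intro mult_left_mono) (auto simp: mult.commute)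
    qed
    finally show "(\<mu> i)\<^sup>2 \<le> c * (y i * \<mu> i + 2 * F * \<bar>x i - y i\<bar>)" .
  qed
  also have "\<dots> = c * ((\<Sum>i\<in>I. y i * \<mu> i) + 2 * F * (\<Sum>i\<in>I. \<bar>x i - y i\<bar>))"
    by (simp add: sum_distrib_left sum.distrib algebra_simps)
  also have "\<dots> \<le> c * (4 * F * \<zeta> + 2 * F * \<zeta>)"
    using c F \<zeta> \<sigma> by (intro mult_left_mono add_mono) auto
  finally have sq: "(\<Sum>i\<in>I. (\<mu> i)\<^sup>2) \<le> c * (6 * F * \<zeta>)" by simp
  have "(sum \<mu> I)\<^sup>2 \<le> real (card I) * (\<Sum>i\<in>I. (\<mu> i)\<^sup>2)" by (rule sum_square_le)
  also have "\<dots> \<le> N * (c * (6 * F * \<zeta>))"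
    using card sq N0 by (intro mult_mono) (auto intro: sum_nonneg)
  finally have "4096 * (sum \<mu> I)\<^sup>2 \<le> 6 * c * F * (4096 * N * \<zeta>)" by (simp add: algebra_simps)
  also have "\<dots> \<le> 6 * c * F * (c * F)" using \<zeta>(2) c F by (intro mult_left_mono) auto
  finally have "4096 * (sum \<mu> I)\<^sup>2 \<le> 6 * (c * F)\<^sup>2" by (simp add: power2_eq_square algebra_simps)
  \<comment> \<open>20^2 * 6 = 2400 is below 4096.\<close>
  then have "(20 * sum \<mu> I)\<^sup>2 \<le> (c * F)\<^sup>2"
  proof -
    have "(20 * sum \<mu> I)\<^sup>2 = 400 * (sum \<mu> I)\<^sup>2" by (simp add: power2_eq_square)
    then show ?thesis
      using \<open>4096 * (sum \<mu> I)\<^sup>2 \<le> 6 * (c * F)\<^sup>2\<close> zero_le_power2[of "c * F"] by linarith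
  qed
  then show ?thesis using c F by (auto intro: power2_le_imp_le[of "20 * sum \<mu> I"])
qed

text \<open>Passing from x and y to their minimum w costs an error of order
  \<open>F * \<zeta>\<close>, which has to be absorbed. Combining the two cost bounds leaves a
  surplus \<sigma>. If \<sigma> exceeds the error, nothing else is needed. Otherwise x and y are
  close to the lower bounds given by the curvature, the block behaves almost like a modular one, and
  its cost is about half of \<open>W\<^sup>2 + X\<close>, which beats the claim by a margin of order
  1 - \<theta>.\<close>

lemma flat_block_unit:
  fixes I :: "'i::linorder set" and x y f \<gamma> P Q :: "'i \<Rightarrow> real"
  assumes I: "finite I" and card: "real (card I) \<le> N" "1 \<le> N"
    and ab: "0 < a" "a \<le> 1" "0 < b" "b \<le> 1"
    and x: "\<And>i. i \<in> I \<Longrightarrow> 0 \<le> f i \<and> a * f i \<le> x i \<and> x i \<le> f i"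
    and y: "\<And>i. i \<in> I \<Longrightarrow> 0 \<le> \<gamma> i \<and> b * \<gamma> i \<le> y i \<and> y i \<le> \<gamma> i"
    and P: "\<And>i. i \<in> I \<Longrightarrow> a * f i \<le> P i \<and> P i \<le> f i" "sum P I = sum x I"
    and Q: "\<And>i. i \<in> I \<Longrightarrow> b * \<gamma> i \<le> Q i \<and> Q i \<le> \<gamma> i" "sum Q I = sum y I"
    and key: "\<And>i j. i \<in> I \<Longrightarrow> j \<in> I \<Longrightarrow> i < j \<Longrightarrow> f i * \<gamma> j \<le> f j * \<gamma> i"
    and flat: "4096 * N * (\<Sum>i\<in>I. \<bar>x i - y i\<bar>) \<le> (1 - a * b) * sum x I"
  defines "w \<equiv> \<lambda>i. min (x i) (y i)"
  shows "(1 + a * b) * (tri I P Q + (\<Sum>i\<in>I. P i * Q i)) \<le> (sum w I)\<^sup>2 + (\<Sum>i\<in>I. (w i)\<^sup>2)"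
proof -
  define F G W X \<zeta> \<theta> where FG: "F = sum x I" "G = sum y I" "W = sum w I" "X = (\<Sum>i\<in>I. (w i)\<^sup>2)"
    "\<zeta> = (\<Sum>i\<in>I. \<bar>x i - y i\<bar>)" "\<theta> = a * b"
  define c where "c = tri I P Q + (\<Sum>i\<in>I. P i * Q i)"
  define f' \<gamma>' \<mu> \<nu> where d: "f' = (\<lambda>i. a * f i)" "\<gamma>' = (\<lambda>i. b * \<gamma> i)"
    "\<mu> = (\<lambda>i. x i - f' i)" "\<nu> = (\<lambda>i. y i - \<gamma>' i)"
  have \<theta>: "0 < \<theta>" "\<theta> \<le> 1" "\<theta> \<le> a" "\<theta> \<le> b" using ab by (auto simp: FG mult_le_one)
  have f'0: "0 \<le> f' i" "0 \<le> \<gamma>' i" if "i \<in> I" for i using x[OF that] y[OF that] ab by (auto simp: d)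
  have x0: "0 \<le> x i" "0 \<le> y i" "0 \<le> w i" if "i \<in> I" for i
    using x[OF that] y[OF that] f'0[OF that] by (auto simp: d w_def)
  have PQ0: "0 \<le> P i" "0 \<le> Q i" if "i \<in> I" for i
    using P(1)[OF that] Q(1)[OF that] f'0[OF that] by (auto simp: d)
  have \<zeta>0: "0 \<le> \<zeta>" unfolding FG by (intro sum_nonneg) auto
  have F0: "0 \<le> F" "0 \<le> G" "0 \<le> W" "0 \<le> X" unfolding FG using x0 by (auto intro!: sum_nonneg)
  have N\<zeta>: "4096 * N * \<zeta> \<le> (1 - \<theta>) * F" using flat by (simp add: FG)
  have \<zeta>F: "4096 * \<zeta> \<le> (1 - \<theta>) * F"
    using N\<zeta> card(2) \<zeta>0 mult_right_mono[of 1 N \<zeta>] by linarith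
  have thF: "(1 - \<theta>) * F \<le> F" using \<theta> F0 by (simp add: algebra_simps)
  have GF: "G \<le> F + \<zeta>"
  proof -
    have "G \<le> (\<Sum>i\<in>I. x i + \<bar>x i - y i\<bar>)" unfolding FG by (intro sum_mono) auto
    then show ?thesis by (simp add: FG sum.distrib)
  qed
  have WF: "F - \<zeta> \<le> W"
  proof -
    have "(\<Sum>i\<in>I. x i - \<bar>x i - y i\<bar>) \<le> W" unfolding FG by (intro sum_mono) (auto simp: w_def)
    then show ?thesis by (simp add: FG sum_subtractf)
  qed
  have xF: "x i \<le> F" "y i \<le> G" if "i \<in> I" for i
    unfolding FG using that x0 I by (auto intro: member_le_sum)
  have xy: "(\<Sum>i\<in>I. x i * y i) \<le> X + F * \<zeta>"
  proof -
    have "(\<Sum>i\<in>I. x i * y i) \<le> (\<Sum>i\<in>I. (w i)\<^sup>2 + F * \<bar>x i - y i\<bar>)"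
    proof (rule sum_mono)
      fix i assume i: "i \<in> I"
      have "x i * y i = (w i)\<^sup>2 + w i * \<bar>x i - y i\<bar>"
        by (simp add: w_def min_def abs_if power2_eq_square algebra_simps)
      moreover have "w i * \<bar>x i - y i\<bar> \<le> F * \<bar>x i - y i\<bar>"
        using xF[OF i] by (intro mult_right_mono) (auto simp: w_def)
      ultimately show "x i * y i \<le> (w i)\<^sup>2 + F * \<bar>x i - y i\<bar>" by simp
    qed
    then show ?thesis by (simp add: FG sum.distrib sum_distrib_left)
  qed
  have FFW: "F\<^sup>2 - 2 * F * \<zeta> \<le> W\<^sup>2"
  proof -
    have "(F - \<zeta>)\<^sup>2 \<le> W\<^sup>2" using WF \<zeta>F \<zeta>0 thF by (intro power_mono) auto
    moreover have "(F - \<zeta>)\<^sup>2 = F\<^sup>2 - 2 * F * \<zeta> + \<zeta>\<^sup>2" by (simp add: power2_eq_square algebra_simps)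
    ultimately show ?thesis by (smt (verit) zero_le_power2)
  qed
  have FGF: "F * G \<le> F\<^sup>2 + F * \<zeta>"
    using mult_left_mono[OF GF F0(1)] by (simp add: power2_eq_square algebra_simps)
  have ctot: "c = F * G - tri I Q P"
    using tri_total[OF I, of P Q] P(2) Q(2) by (simp add: c_def FG)
  \<comment> \<open>What the order saves against the full product is \<open>tri I Q P\<close>; the
    curvature keeps it above \<open>tri I \<gamma>' f'\<close>.\<close>
  have B: "c \<le> F * G - tri I \<gamma>' f'"
    using tri_mono[of I \<gamma>' Q f' P] f'0 P(1) Q(1) unfolding ctot by (auto simp: d)
  \<comment> \<open>\<theta> times the crude bound on c is added to B. Sorting by \<open>key\<close>
    turns \<open>tri I f \<gamma>\<close> into \<open>tri I \<gamma> f\<close>, and the triangular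
    terms cancel.\<close>
  have A: "(1 + \<theta>) * c \<le> F * G + (\<Sum>i\<in>I. f' i * \<gamma>' i)"
  proof -
    have "tri I P Q \<le> tri I f \<gamma>" using PQ0 P(1) Q(1) by (intro tri_mono) auto
    also have "\<dots> \<le> tri I \<gamma> f" unfolding tri_def using key by (intro sum_mono) (auto simp: mult.commute)
    finally have 1: "tri I P Q \<le> tri I \<gamma> f" .
    have 2: "(\<Sum>i\<in>I. P i * Q i) \<le> (\<Sum>i\<in>I. f i * \<gamma> i)"
      using PQ0 P(1) Q(1) x by (intro sum_mono mult_mono) auto
    have "\<theta> * c \<le> \<theta> * (tri I \<gamma> f + (\<Sum>i\<in>I. f i * \<gamma> i))"
      unfolding c_def using 1 2 \<theta> by (intro mult_left_mono) auto
    also have "\<dots> = tri I \<gamma>' f' + (\<Sum>i\<in>I. f' i * \<gamma>' i)"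
      unfolding d tri_scale by (simp add: FG algebra_simps sum_distrib_left)
    finally show ?thesis using B by (simp add: algebra_simps)
  qed
  \<comment> \<open>The surplus of bound A, whose diagonal consists of lower bounds, over the
    diagonal of x and y that the claim allows.\<close>
  define \<sigma> where "\<sigma> = (\<Sum>i\<in>I. x i * y i) - (\<Sum>i\<in>I. f' i * \<gamma>' i)"
  have \<mu>\<nu>: "0 \<le> \<mu> i \<and> \<mu> i \<le> (1 - \<theta>) * x i" "0 \<le> \<nu> i \<and> \<nu> i \<le> (1 - \<theta>) * y i" if "i \<in> I" for i
  proof -
    have "\<theta> * x i \<le> a * x i" "a * x i \<le> a * f i" "\<theta> * y i \<le> b * y i" "b * y i \<le> b * \<gamma> i"
      using x[OF that] y[OF that] x0[OF that] \<theta> ab by (auto intro: mult_right_mono mult_left_mono)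
    then show "0 \<le> \<mu> i \<and> \<mu> i \<le> (1 - \<theta>) * x i" "0 \<le> \<nu> i \<and> \<nu> i \<le> (1 - \<theta>) * y i"
      using x[OF that] y[OF that] by (auto simp: d algebra_simps)
  qed
  have \<sigma>1: "(\<Sum>i\<in>I. y i * \<mu> i) \<le> \<sigma>" "(\<Sum>i\<in>I. x i * \<nu> i) \<le> \<sigma>"
  proof -
    have "(\<Sum>i\<in>I. y i * \<mu> i) \<le> (\<Sum>i\<in>I. x i * y i - f' i * \<gamma>' i)"
    proof (rule sum_mono)
      fix i assume i: "i \<in> I"
      have "f' i * \<gamma>' i \<le> f' i * y i" using f'0[OF i] y[OF i] by (intro mult_left_mono) (auto simp: d)
      then show "y i * \<mu> i \<le> x i * y i - f' i * \<gamma>' i" by (simp add: d algebra_simps)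
    qed
    then show "(\<Sum>i\<in>I. y i * \<mu> i) \<le> \<sigma>" by (simp add: \<sigma>_def sum_subtractf)
    have "(\<Sum>i\<in>I. x i * \<nu> i) \<le> (\<Sum>i\<in>I. x i * y i - f' i * \<gamma>' i)"
    proof (rule sum_mono)
      fix i assume i: "i \<in> I"
      have "f' i * \<gamma>' i \<le> x i * \<gamma>' i" using f'0[OF i] x[OF i] by (intro mult_right_mono) (auto simp: d)
      then show "x i * \<nu> i \<le> x i * y i - f' i * \<gamma>' i" by (simp add: d algebra_simps)
    qed
    then show "(\<Sum>i\<in>I. x i * \<nu> i) \<le> \<sigma>" by (simp add: \<sigma>_def sum_subtractf)
  qed
  have "(1 + \<theta>) * c \<le> W\<^sup>2 + X"
  proof (cases "4 * F * \<zeta> \<le> \<sigma>")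
    case True
    then show ?thesis using A FGF xy FFW unfolding \<sigma>_def by linarith
  next
    case False
    have m: "20 * sum \<mu> I \<le> (1 - \<theta>) * F"
    proof (rule small_defect[OF I card(1), where K = F and \<zeta> = \<zeta>])
      show "4096 * N * \<zeta> \<le> (1 - \<theta>) * F" by (fact N\<zeta>)
      show "(\<Sum>i\<in>I. y i * \<mu> i) \<le> 4 * F * \<zeta>" using \<sigma>1 False by linarith
    qed (use \<mu>\<nu> x0 xF \<theta> F0 in \<open>auto simp: FG\<close>)
    have n: "20 * sum \<nu> I \<le> (1 - \<theta>) * F"
    proof (rule small_defect[OF I card(1), where K = G and \<zeta> = \<zeta>])
      show "4096 * N * \<zeta> \<le> (1 - \<theta>) * F" by (fact N\<zeta>)
      show "(\<Sum>i\<in>I. x i * \<nu> i) \<le> 4 * F * \<zeta>" using \<sigma>1 False by linarith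
      show "(\<Sum>i\<in>I. \<bar>y i - x i\<bar>) \<le> \<zeta>" by (simp add: FG abs_minus_commute)
      show "G \<le> 2 * F" using GF \<zeta>F thF \<zeta>0 by linarith
    qed (use \<mu>\<nu> x0 xF \<theta> F0 in auto)
    define K where "K = (1 - \<theta>) * F\<^sup>2"
    have sn0: "0 \<le> sum \<mu> I" "0 \<le> sum \<nu> I" using \<mu>\<nu> by (auto intro: sum_nonneg)
    have "tri I y x - F * sum \<nu> I - G * sum \<mu> I \<le> tri I \<gamma>' f'"
    proof -
      have "\<gamma>' = (\<lambda>i. y i - \<nu> i)" "f' = (\<lambda>i. x i - \<mu> i)" by (auto simp: d)
      then have "tri I \<gamma>' f' = tri I y x - tri I \<nu> x - tri I y \<mu> + tri I \<nu> \<mu>"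
        by (simp only: tri_diff)
      moreover have "0 \<le> tri I \<nu> \<mu>" using \<mu>\<nu> by (intro tri_nonneg) auto
      moreover have "tri I \<nu> x \<le> sum \<nu> I * sum x I" using \<mu>\<nu> x0 by (intro tri_le I) auto
      moreover have "tri I y \<mu> \<le> sum y I * sum \<mu> I" using \<mu>\<nu> x0 by (intro tri_le I) auto
      ultimately show ?thesis by (simp add: FG algebra_simps)
    qed
    moreover have "(W\<^sup>2 - X) / 2 \<le> tri I y x"
    proof -
      have "(W\<^sup>2 - X) / 2 = tri I w w"
        using tri_total[OF I, of w w] by (simp add: FG power2_eq_square)
      also have "\<dots> \<le> tri I y x" using x0 by (intro tri_mono) (auto simp: w_def)
      finally show ?thesis .
    qed
    moreover have "F * sum \<nu> I \<le> K / 20"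
      using mult_left_mono[OF n F0(1)] by (simp add: K_def power2_eq_square algebra_simps)
    moreover have "G * sum \<mu> I \<le> K * (4097 / 81920)"
    proof -
      have "G * (20 * sum \<mu> I) \<le> (F * (4097 / 4096)) * ((1 - \<theta>) * F)"
      proof (rule mult_mono[OF _ m])
        show "G \<le> F * (4097 / 4096)" using GF \<zeta>F thF by (simp add: field_simps)
      qed (use F0 sn0 in auto)
      then show ?thesis by (simp add: K_def power2_eq_square algebra_simps)
    qed
    moreover have "F * \<zeta> \<le> K / 4096"
      using mult_left_mono[OF \<zeta>F F0(1)] by (simp add: K_def power2_eq_square algebra_simps)
    \<comment> \<open>The first two fractions come from the defects \<nu> and \<mu>. The third
      collects three copies of \<open>F * \<zeta>\<close>, one from \<open>FGF\<close> and two from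
      \<open>FFW\<close>.\<close>
    ultimately have "c \<le> (W\<^sup>2 + X) / 2 + K * (1 / 20 + 4097 / 81920 + 3 / 4096)"
      using B FGF FFW by (simp add: field_simps)
    moreover have "K * (1 / 20 + 4097 / 81920 + 3 / 4096) \<le> K * (1 / 8)"
      using \<theta> by (intro mult_left_mono) (auto simp: K_def)
    ultimately have "c \<le> (W\<^sup>2 + X) / 2 + K * (1 / 8)" by (rule order_trans[OF _ add_left_mono])
    then have "2 * c \<le> (W\<^sup>2 + X) + K * (1 / 4)" by (simp add: field_simps)
    then have cc: "2 * c \<le> (W\<^sup>2 + X) + ((1 - \<theta>) * F\<^sup>2) * (1 / 4)"
      by (simp add: K_def)
    \<comment> \<open>The margin between the factors 2 and 1 + \<theta> is
      \<open>(1 - \<theta>) * (W\<^sup>2 + X)\<close>. This makes it at least K / 2, enough for the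
      excess K / 4 in \<open>2 * c\<close> after multiplication by 1 + \<theta>.\<close>
    have "F\<^sup>2 / 2 \<le> W\<^sup>2"
    proof -
      have "F * \<zeta> \<le> F * (F / 4096)" using \<zeta>F thF F0 by (intro mult_left_mono) auto
      then have "F * \<zeta> \<le> F\<^sup>2 / 4096" by (simp add: power2_eq_square)
      moreover have "F\<^sup>2 - 2 * (F * \<zeta>) \<le> W\<^sup>2" using FFW by (simp add: mult.assoc)
      ultimately show ?thesis using zero_le_power2[of F] by linarith
    qed
    then have "(1 - \<theta>) * (F\<^sup>2 / 2) \<le> (1 - \<theta>) * (W\<^sup>2 + X)"
      using \<theta> F0 by (intro mult_left_mono) auto
    then have "K / 2 \<le> (1 - \<theta>) * (W\<^sup>2 + X)" by (simp add: K_def)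
    moreover have "(1 + \<theta>) * (2 * c) \<le> (1 + \<theta>) * ((W\<^sup>2 + X) + K * (1 / 4))"
      using cc \<theta> by (intro mult_left_mono) (auto simp: K_def)
    moreover have "(1 + \<theta>) * (K * (1 / 4)) \<le> 2 * (K * (1 / 4))"
      using \<theta> by (intro mult_right_mono) (auto simp: K_def)
    ultimately have "(1 + \<theta>) * (2 * c) \<le> (1 + \<theta>) * (W\<^sup>2 + X) + (1 - \<theta>) * (W\<^sup>2 + X)"
      by (simp only: distrib_left)
    also have "\<dots> = 2 * (W\<^sup>2 + X)" by (simp add: algebra_simps)
    finally show ?thesis by (simp add: algebra_simps)
  qed
  then show ?thesis by (simp add: c_def FG)
qed

section \<open>Weighted prefix sums and Smith's rule\<close>

lemma sum_prefix_weighted: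
  fixes s t :: "nat \<Rightarrow> real"
  shows "tri {l..<r} s t + (\<Sum>i=l..<r. s i * t i) = (\<Sum>j=l..<r. t j * (\<Sum>i=l..<Suc j. s i))"
proof -
  have "tri {l..<r} s t = (\<Sum>j=l..<r. \<Sum>i=l..<r. if i < j then s i * t j else 0)"
    unfolding tri_def by (rule sum.swap)
  then have "tri {l..<r} s t + (\<Sum>i=l..<r. s i * t i)
      = (\<Sum>j=l..<r. (\<Sum>i=l..<r. if i < j then s i * t j else 0) + s j * t j)"
    by (simp add: sum.distrib)
  also have "\<dots> = (\<Sum>j=l..<r. t j * (\<Sum>i=l..<Suc j. s i))"
  proof (rule sum.cong[OF refl])
    fix j assume j: "j \<in> {l..<r}"
    have "(\<Sum>i=l..<r. if i < j then s i * t j else 0) = (\<Sum>i=l..<j. s i * t j)"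
      using j by (intro sum.mono_neutral_cong_right) auto
    then show "(\<Sum>i=l..<r. if i < j then s i * t j else 0) + s j * t j
        = t j * (\<Sum>i=l..<Suc j. s i)"
      using j by (simp add: sum_distrib_left algebra_simps)
  qed
  finally show ?thesis .
qed

text \<open>The diagonal belongs to the search cost, since an element is charged with the value of f
  after its own inspection.\<close>

definition trid :: "'i::linorder set \<Rightarrow> ('i \<Rightarrow> real) \<Rightarrow> ('i \<Rightarrow> real) \<Rightarrow> real" where
  "trid I s t = tri I s t + (\<Sum>i\<in>I. s i * t i)"

lemma trid_split:
  assumes "p \<le> m" "m \<le> (q::nat)"
  shows "trid {p..<q} s t = trid {p..<m} s t + trid {m..<q} s t + sum s {p..<m} * sum t {m..<q}"
proof -
  have "trid {p..<q} s t = (\<Sum>j=p..<m. t j * (\<Sum>i=p..<Suc j. s i)) + (\<Sum>j=m..<q. t j * (\<Sum>i=p..<Suc j. s i))"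
    unfolding trid_def sum_prefix_weighted using assms by (simp add: sum.atLeastLessThan_concat)
  also have "(\<Sum>j=m..<q. t j * (\<Sum>i=p..<Suc j. s i))
      = (\<Sum>j=m..<q. t j * (\<Sum>i=m..<Suc j. s i) + sum s {p..<m} * t j)"
  proof (rule sum.cong[OF refl])
    fix j assume "j \<in> {m..<q}"
    then have "(\<Sum>i=p..<Suc j. s i) = sum s {p..<m} + (\<Sum>i=m..<Suc j. s i)"
      using assms by (intro sum.atLeastLessThan_concat[symmetric]) auto
    then show "t j * (\<Sum>i=p..<Suc j. s i) = t j * (\<Sum>i=m..<Suc j. s i) + sum s {p..<m} * t j"
      by (simp add: algebra_simps)
  qed
  finally show ?thesis
    unfolding trid_def sum_prefix_weighted by (simp add: sum.distrib sum_distrib_left)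
qed

lemma trid_cong:
  "(\<And>i. i \<in> I \<Longrightarrow> s i = s' i) \<Longrightarrow> (\<And>i. i \<in> I \<Longrightarrow> t i = t' i) \<Longrightarrow> trid I s t = trid I s' t'"
  unfolding trid_def tri_def by (intro arg_cong2[where f = "(+)"] sum.cong refl) auto

text \<open>No exchange argument is needed. Twice the sum, taken over ordered pairs of elements, has
  weights that do not depend on the order; only the label of the later element of each pair does.
  Decreasing labels make it the smaller of the two for all pairs at once.\<close>

lemma smith_rule:
  fixes w lab :: "nat \<Rightarrow> real"
  assumes \<pi>: "bij_betw \<pi> {..<n} {..<n}" and \<sigma>: "bij_betw \<sigma> {..<n} {..<n}"
    and w: "\<And>e. e < n \<Longrightarrow> 0 \<le> w e"
    and lab: "\<And>i j. i \<le> j \<Longrightarrow> j < n \<Longrightarrow> lab (\<pi> j) \<le> lab (\<pi> i)"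
  shows "trid {..<n} (\<lambda>i. w (\<pi> i)) (\<lambda>i. lab (\<pi> i) * w (\<pi> i))
    \<le> trid {..<n} (\<lambda>i. w (\<sigma> i)) (\<lambda>i. lab (\<sigma> i) * w (\<sigma> i))"
proof -
  \<comment> \<open>Ordered pairs count each off-diagonal product twice, so the diagonal is doubled
    to match.\<close>
  define L where "L = (\<lambda>d e. (if d = e then 2 else 1) * (w d * w e))"
  define K where "K = (\<lambda>\<rho> d e. lab (if inv_into {..<n} \<rho> d \<le> inv_into {..<n} \<rho> e then e else d :: nat))"
  have tot: "2 * trid {..<n} (\<lambda>i. w (\<rho> i)) (\<lambda>i. lab (\<rho> i) * w (\<rho> i)) = (\<Sum>d<n. \<Sum>e<n. L d e * K \<rho> d e)"
    if \<rho>: "bij_betw \<rho> {..<n} {..<n}" for \<rho> :: "nat \<Rightarrow> nat"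
  proof -
    let ?T = "\<lambda>i j. w (\<rho> i) * (lab (\<rho> j) * w (\<rho> j))"
    have inj: "inj_on \<rho> {..<n}" using \<rho> by (auto simp: bij_betw_def)
    have "(\<Sum>d<n. \<Sum>e<n. L d e * K \<rho> d e) = (\<Sum>i<n. \<Sum>j<n. L (\<rho> i) (\<rho> j) * K \<rho> (\<rho> i) (\<rho> j))"
      by (rule trans[OF sum.reindex_bij_betw[OF \<rho>, symmetric]], rule sum.cong[OF refl],
          rule sum.reindex_bij_betw[OF \<rho>, symmetric])
    also have "\<dots> = (\<Sum>i<n. \<Sum>j<n. (if i < j then ?T i j else 0) + (if j < i then ?T j i else 0)
        + (if i = j then 2 * ?T i i else 0))"
    proof (intro sum.cong refl)
      fix i j assume "i \<in> {..<n}" "j \<in> {..<n}"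
      then have "inv_into {..<n} \<rho> (\<rho> i) = i" "inv_into {..<n} \<rho> (\<rho> j) = j" "\<rho> i = \<rho> j \<longleftrightarrow> i = j"
        using inj by (auto simp: inj_on_eq_iff)
      then show "L (\<rho> i) (\<rho> j) * K \<rho> (\<rho> i) (\<rho> j) = (if i < j then ?T i j else 0)
          + (if j < i then ?T j i else 0) + (if i = j then 2 * ?T i i else 0)"
        by (auto simp: L_def K_def algebra_simps)
    qed
    also have "\<dots> = (\<Sum>i<n. \<Sum>j<n. if i < j then ?T i j else 0)
        + (\<Sum>i<n. \<Sum>j<n. if j < i then ?T j i else 0) + 2 * (\<Sum>i<n. ?T i i)"
      by (simp add: sum.distrib sum_distrib_left)
    also have "(\<Sum>i<n. \<Sum>j<n. if j < i then ?T j i else 0) = (\<Sum>i<n. \<Sum>j<n. if i < j then ?T i j else 0)"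
      by (rule sum.swap)
    finally show ?thesis by (simp add: trid_def tri_def)
  qed
  have "(\<Sum>d<n. \<Sum>e<n. L d e * K \<pi> d e) \<le> (\<Sum>d<n. \<Sum>e<n. L d e * K \<sigma> d e)"
  proof (intro sum_mono mult_left_mono)
    fix d e assume "d \<in> {..<n}" "e \<in> {..<n}"
    then have de: "d < n" "e < n" by auto
    show "0 \<le> L d e" using w de by (auto simp: L_def)
    have inv: "inv_into {..<n} \<pi> c < n" "\<pi> (inv_into {..<n} \<pi> c) = c" if "c < n" for c
      using bij_betw_inv_into_right[OF \<pi>] bij_betwE[OF bij_betw_inv_into[OF \<pi>]] that by auto
    show "K \<pi> d e \<le> K \<sigma> d e"
      using lab[of "inv_into {..<n} \<pi> d" "inv_into {..<n} \<pi> e"]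
        lab[of "inv_into {..<n} \<pi> e" "inv_into {..<n} \<pi> d"] inv[OF de(1)] inv[OF de(2)]
      by (auto simp: K_def)
  qed
  then show ?thesis using tot[OF \<pi>] tot[OF \<sigma>] by linarith
qed

section \<open>Search instances and certificates\<close>

text \<open>The conditions on G are those on its dual, whose value at a singleton is the last
  marginal of G and whose last marginal is \<open>G {e}\<close>. Elements are the indices that the
  program works with, and a and b are lower bounds for one minus the curvatures.\<close>

locale search_instance =
  fixes n :: nat and F G :: "nat set \<Rightarrow> real" and a b :: real
  assumes n: "0 < n"
    and F_empty: "F {} = 0" and G_empty: "G {} = 0"
    and subF: "submodular_on {..<n} F" and supG: "supermodular_on {..<n} G"
    and ab: "0 < a" "a \<le> 1" "0 < b" "b \<le> 1"
    and F_pos: "\<And>e. e < n \<Longrightarrow> 0 < F {e}"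
    and F_curv: "\<And>e. e < n \<Longrightarrow> a * F {e} \<le> F {..<n} - F ({..<n} - {e})"
    and G_pos: "\<And>e. e < n \<Longrightarrow> 0 < G {..<n} - G ({..<n} - {e})"
    and G_curv: "\<And>e. e < n \<Longrightarrow> b * (G {..<n} - G ({..<n} - {e})) \<le> G {e}"
begin

definition gain :: "nat \<Rightarrow> real" where "gain e = G {..<n} - G ({..<n} - {e})"

lemma subG: "submodular_on {..<n} (\<lambda>X. - G X)"
  using supG by (rule supermodular_on_uminus)

lemma F_marginal:
  assumes "A \<subseteq> {..<n}" "e < n" "e \<notin> A"
  shows "a * F {e} \<le> F (insert e A) - F A" "F (insert e A) - F A \<le> F {e}"
proof -
  have *: "insert e ({..<n} - {e}) = {..<n}" using assms by auto
  show "F (insert e A) - F A \<le> F {e}"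
    using diminishing_returns[OF subF, of "{}" A e] assms F_empty by auto
  have "F {..<n} - F ({..<n} - {e}) \<le> F (insert e A) - F A"
    using diminishing_returns[OF subF, of A "{..<n} - {e}" e] assms * by auto
  then show "a * F {e} \<le> F (insert e A) - F A" using F_curv[OF assms(2)] by linarith
qed

lemma G_marginal:
  assumes "A \<subseteq> {..<n}" "e < n" "e \<notin> A"
  shows "b * gain e \<le> G (insert e A) - G A" "G (insert e A) - G A \<le> gain e"
proof -
  have *: "insert e ({..<n} - {e}) = {..<n}" using assms by auto
  have "G {e} \<le> G (insert e A) - G A"
    using diminishing_returns[OF subG, of "{}" A e] assms G_empty by auto
  then show "b * gain e \<le> G (insert e A) - G A" using G_curv[OF assms(2)] by (simp add: gain_def)
  have "A \<subseteq> {..<n} - {e}" using assms by blast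
  then show "G (insert e A) - G A \<le> gain e"
    using diminishing_returns[OF subG, of A "{..<n} - {e}" e] assms * by (auto simp: gain_def)
qed

text \<open>A coordinate of a base lies between the marginals of e at the end and at the beginning
  of the segment, which the curvature controls.\<close>

lemma base_F_bounds:
  assumes "base F A B x" "A \<union> B \<subseteq> {..<n}" "A \<inter> B = {}" "e \<in> B"
  shows "a * F {e} \<le> x e" "x e \<le> F {e}" "0 < x e"
proof -
  have e: "e < n" "e \<notin> A" "finite B" "insert e (A \<union> (B - {e})) = A \<union> B"
    "A \<union> (B - {e}) \<subseteq> {..<n}"
    using assms finite_subset[of B "{..<n}"] by auto
  show "x e \<le> F {e}"
    using base_upper[OF assms(1,4)] F_marginal(2)[of A e] assms e by auto
  show *: "a * F {e} \<le> x e"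
    using base_lower[OF assms(1,4) e(3)] F_marginal(1)[of "A \<union> (B - {e})" e] assms e by auto
  show "0 < x e" using * F_pos[OF e(1)] ab mult_pos_pos[of a "F {e}"] by linarith
qed

lemma base_G_bounds:
  assumes "cobase G A B y" "A \<union> B \<subseteq> {..<n}" "A \<inter> B = {}" "e \<in> B"
  shows "b * gain e \<le> y e" "y e \<le> gain e" "0 < y e"
proof -
  have e: "e < n" "e \<notin> A" "finite B" "insert e (A \<union> (B - {e})) = A \<union> B"
    "A \<union> (B - {e}) \<subseteq> {..<n}"
    using assms finite_subset[of B "{..<n}"] by auto
  show *: "b * gain e \<le> y e"
    using base_upper[OF assms(1,4)] G_marginal(1)[of A e] assms e by auto
  show "y e \<le> gain e"
    using base_lower[OF assms(1,4) e(3)] G_marginal(2)[of "A \<union> (B - {e})" e] assms e by auto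
  have "0 < gain e" using G_pos[OF e(1)] by (simp add: gain_def)
  then show "0 < y e" using * ab mult_pos_pos[of b "gain e"] by linarith
qed

section \<open>Orderings, their increments and a lower bound for their cost\<close>

definition ordering :: "(nat \<Rightarrow> nat) \<Rightarrow> bool" where
  "ordering \<pi> \<longleftrightarrow> bij_betw \<pi> {..<n} {..<n}"

lemma orderingD:
  assumes "ordering \<pi>"
  shows "inj_on \<pi> {..<n}" "\<pi> ` {..<n} = {..<n}" "k < n \<Longrightarrow> \<pi> k < n"
  using assms by (auto simp: ordering_def bij_betw_def)

lemma pre_subset: "ordering \<pi> \<Longrightarrow> k \<le> n \<Longrightarrow> pre \<pi> k \<subseteq> {..<n}"
  using orderingD(3) by auto

lemma pre_fresh: "ordering \<pi> \<Longrightarrow> k < n \<Longrightarrow> \<pi> k \<notin> pre \<pi> k"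
  using orderingD(1)[of \<pi>] by (auto dest: inj_onD)

lemma seg_facts:
  assumes "ordering \<pi>" "p \<le> q" "q \<le> n"
  shows "pre \<pi> p \<union> \<pi> ` {p..<q} = pre \<pi> q" "pre \<pi> p \<inter> \<pi> ` {p..<q} = {}"
    "pre \<pi> p \<union> \<pi> ` {p..<q} \<subseteq> {..<n}" "inj_on \<pi> {p..<q}"
proof -
  show 1: "pre \<pi> p \<union> \<pi> ` {p..<q} = pre \<pi> q" using pre_split assms(2) by metis
  show "pre \<pi> p \<inter> \<pi> ` {p..<q} = {}" using seg_disjoint orderingD(1) assms by metis
  show "pre \<pi> p \<union> \<pi> ` {p..<q} \<subseteq> {..<n}" unfolding 1 using pre_subset assms by blast
  show "inj_on \<pi> {p..<q}" using orderingD(1)[OF assms(1)] assms(3) by (auto intro: inj_on_subset)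
qed

lemma seg_sum:
  assumes "ordering \<pi>" "p \<le> q" "q \<le> n"
  shows "sum h (\<pi> ` {p..<q}) = (\<Sum>i=p..<q. h (\<pi> i))"
  using sum.reindex[OF seg_facts(4)[OF assms], of h] by (simp add: o_def)

definition incF :: "(nat \<Rightarrow> nat) \<Rightarrow> nat \<Rightarrow> real" where
  "incF \<pi> k = F (pre \<pi> (Suc k)) - F (pre \<pi> k)"

definition incG :: "(nat \<Rightarrow> nat) \<Rightarrow> nat \<Rightarrow> real" where
  "incG \<pi> k = G (pre \<pi> (Suc k)) - G (pre \<pi> k)"

lemma incF_bounds:
  assumes "ordering \<pi>" "k < n"
  shows "a * F {\<pi> k} \<le> incF \<pi> k" "incF \<pi> k \<le> F {\<pi> k}" "0 < incF \<pi> k"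
proof -
  show *: "a * F {\<pi> k} \<le> incF \<pi> k" "incF \<pi> k \<le> F {\<pi> k}"
    using F_marginal[OF pre_subset[OF assms(1)] orderingD(3)[OF assms] pre_fresh[OF assms]] assms
    by (auto simp: incF_def pre_Suc)
  show "0 < incF \<pi> k" using * F_pos[OF orderingD(3)[OF assms]] ab mult_pos_pos[of a "F {\<pi> k}"] by linarith
qed

lemma incG_bounds:
  assumes "ordering \<pi>" "k < n"
  shows "b * gain (\<pi> k) \<le> incG \<pi> k" "incG \<pi> k \<le> gain (\<pi> k)" "0 < incG \<pi> k"
proof -
  show *: "b * gain (\<pi> k) \<le> incG \<pi> k" "incG \<pi> k \<le> gain (\<pi> k)"
    using G_marginal[OF pre_subset[OF assms(1)] orderingD(3)[OF assms] pre_fresh[OF assms]] assms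
    by (auto simp: incG_def pre_Suc)
  have "0 < gain (\<pi> k)" using G_pos[OF orderingD(3)[OF assms]] by (simp add: gain_def)
  then show "0 < incG \<pi> k" using * ab mult_pos_pos[of b "gain (\<pi> k)"] by linarith
qed

lemma inc_telescope:
  assumes "p \<le> q"
  shows "(\<Sum>k=p..<q. incF \<pi> k) = F (pre \<pi> q) - F (pre \<pi> p)"
    "(\<Sum>k=p..<q. incG \<pi> k) = G (pre \<pi> q) - G (pre \<pi> p)"
  unfolding incF_def incG_def
  using sum_Suc_diff'[OF assms, of "\<lambda>k. F (pre \<pi> k)"] sum_Suc_diff'[OF assms, of "\<lambda>k. G (pre \<pi> k)"]
  by auto

lemma mass_pos:
  assumes "ordering \<pi>" "p < q" "q \<le> n"
  shows "0 < F (pre \<pi> q) - F (pre \<pi> p)" "0 < G (pre \<pi> q) - G (pre \<pi> p)"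
proof -
  have "0 < (\<Sum>k=p..<q. incF \<pi> k)" "0 < (\<Sum>k=p..<q. incG \<pi> k)"
    using assms incF_bounds(3)[OF assms(1)] incG_bounds(3)[OF assms(1)] by (auto intro!: sum_pos)
  then show "0 < F (pre \<pi> q) - F (pre \<pi> p)" "0 < G (pre \<pi> q) - G (pre \<pi> p)"
    using inc_telescope[of p q \<pi>] assms by auto
qed

definition cost :: "(nat \<Rightarrow> nat) \<Rightarrow> real" where
  "cost \<pi> = (\<Sum>k<n. incG \<pi> k * F (pre \<pi> (Suc k)))"

lemma cost_eq: "cost \<pi> = trid {0..<n} (incF \<pi>) (incG \<pi>)"
  unfolding cost_def trid_def sum_prefix_weighted
  by (intro sum.cong) (auto simp: inc_telescope F_empty simp del: sum.op_ivl_Suc)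

text \<open>Prefix sums of x are at most the values of F. Tail sums of y are at most those of the
  increments of G, because prefix sums of y are at least the values of G and the totals agree. The
  double sum is monotone in tail sums of one factor and in prefix sums of the other, so v and w are
  replaced one after the other.\<close>

lemma cost_lower_bound:
  assumes \<sigma>: "ordering \<sigma>" and x: "base F {} {..<n} x" and y: "cobase G {} {..<n} y"
    and w: "\<And>e. e < n \<Longrightarrow> 0 \<le> w e \<and> w e \<le> x e" and v: "\<And>e. e < n \<Longrightarrow> 0 \<le> v e \<and> v e \<le> y e"
  shows "trid {..<n} (\<lambda>i. w (\<sigma> i)) (\<lambda>i. v (\<sigma> i)) \<le> cost \<sigma>"
proof -
  let ?p = "incF \<sigma>" and ?q = "incG \<sigma>"
  have sx: "(\<Sum>i=0..<k. x (\<sigma> i)) \<le> F (pre \<sigma> k)" if "k \<le> n" for k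
  proof -
    have "sum x (pre \<sigma> k) \<le> F ({} \<union> pre \<sigma> k) - F {}"
      using x pre_subset[OF \<sigma> that] unfolding base_def by blast
    then show ?thesis using seg_sum[OF \<sigma>, of 0 k x] that F_empty by (simp add: lessThan_atLeast0)
  qed
  have sy: "(\<Sum>i=k..<n. v (\<sigma> i)) \<le> (\<Sum>i=k..<n. y (\<sigma> i))" for k
    using v orderingD(3)[OF \<sigma>] by (intro sum_mono) auto
  have sq: "(\<Sum>i=k..<n. y (\<sigma> i)) \<le> (\<Sum>i=k..<n. ?q i)" if "k \<le> n" for k
  proof -
    have "sum (\<lambda>e. - y e) (pre \<sigma> k) \<le> - G ({} \<union> pre \<sigma> k) - - G {}"
      using y pre_subset[OF \<sigma> that] unfolding base_def by blast
    then have 1: "G (pre \<sigma> k) \<le> (\<Sum>i=0..<k. y (\<sigma> i))"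
      using seg_sum[OF \<sigma>, of 0 k y] that G_empty by (simp add: lessThan_atLeast0 sum_negf)
    have "sum (\<lambda>e. - y e) {..<n} = - G ({} \<union> {..<n}) - - G {}"
      using y unfolding base_def by blast
    then have 2: "(\<Sum>i=0..<n. y (\<sigma> i)) = G (pre \<sigma> n)"
      using seg_sum[OF \<sigma>, of 0 n y] orderingD(2)[OF \<sigma>] G_empty by (simp add: lessThan_atLeast0 sum_negf)
    have "(\<Sum>i=0..<n. y (\<sigma> i)) = (\<Sum>i=0..<k. y (\<sigma> i)) + (\<Sum>i=k..<n. y (\<sigma> i))"
      using that by (simp add: sum.atLeastLessThan_concat)
    then show ?thesis using 1 2 inc_telescope(2)[OF that, of \<sigma>] by linarith
  qed
  \<comment> \<open>Read by rows, the double sum exposes tail sums of t; by columns it exposes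
    prefix sums of s.\<close>
  have swap: "trid {..<n} s t = (\<Sum>i<n. s i * (\<Sum>j=i..<n. t j))" for s t :: "nat \<Rightarrow> real"
  proof -
    have "trid {..<n} s t = (\<Sum>i<n. (\<Sum>j<n. if i < j then s i * t j else 0) + s i * t i)"
      by (simp add: trid_def tri_def sum.distrib)
    also have "\<dots> = (\<Sum>i<n. s i * (\<Sum>j=i..<n. t j))"
    proof (rule sum.cong[OF refl])
      fix i assume i: "i \<in> {..<n}"
      have "(\<Sum>j<n. if i < j then s i * t j else 0) = (\<Sum>j=Suc i..<n. s i * t j)"
        using i by (intro sum.mono_neutral_cong_right) auto
      moreover have "{i..<n} = insert i {Suc i..<n}" using i by auto
      ultimately show "(\<Sum>j<n. if i < j then s i * t j else 0) + s i * t i = s i * (\<Sum>j=i..<n. t j)"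
        by (simp add: sum_distrib_left algebra_simps)
    qed
    finally show ?thesis .
  qed
  have sw: "(\<Sum>i=0..<k. w (\<sigma> i)) \<le> (\<Sum>i=0..<k. x (\<sigma> i))" if "k \<le> n" for k
    using w orderingD(3)[OF \<sigma>] that by (intro sum_mono) auto
  have "trid {..<n} (\<lambda>i. w (\<sigma> i)) (\<lambda>i. v (\<sigma> i)) \<le> (\<Sum>i<n. w (\<sigma> i) * (\<Sum>j=i..<n. ?q j))"
    unfolding swap
  proof (rule sum_mono, rule mult_left_mono)
    fix i assume "i \<in> {..<n}"
    then have i: "i \<le> n" "i < n" by auto
    show "(\<Sum>j=i..<n. v (\<sigma> j)) \<le> (\<Sum>j=i..<n. ?q j)" using sy sq[OF i(1)] by (rule order_trans)
    show "0 \<le> w (\<sigma> i)" using w orderingD(3)[OF \<sigma> i(2)] by blast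
  qed
  also have "\<dots> = trid {..<n} (\<lambda>i. w (\<sigma> i)) ?q" unfolding swap ..
  also have "\<dots> = (\<Sum>j=0..<n. ?q j * (\<Sum>i=0..<Suc j. w (\<sigma> i)))"
    by (simp only: trid_def lessThan_atLeast0 sum_prefix_weighted)
  also have "\<dots> \<le> (\<Sum>j=0..<n. ?q j * F (pre \<sigma> (Suc j)))"
  proof (rule sum_mono, rule mult_left_mono)
    fix j assume "j \<in> {0..<n}"
    then have j: "Suc j \<le> n" "j < n" by auto
    show "(\<Sum>i=0..<Suc j. w (\<sigma> i)) \<le> F (pre \<sigma> (Suc j))" using sw[OF j(1)] sx[OF j(1)] by (rule order_trans)
    show "0 \<le> ?q j" using incG_bounds(3)[OF \<sigma> j(2)] by simp
  qed
  finally show ?thesis by (simp add: cost_def lessThan_atLeast0)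
qed

section \<open>Certificates for segments and their composition\<close>

definition ratio :: real where "ratio = 2 / (1 + a * b)"

definition slack :: real where "slack = (1 - a * b) / 4096"

lemma theta: "0 < a * b" "a * b \<le> 1"
  using ab by (auto simp: mult_le_one)

text \<open>The third claim pays for pairs in different blocks. It holds since 1 + \<theta> = 2 -
  4096 slack, which is at most 2 - 4 slack and hence at most 2 (1 - slack)^2.\<close>

lemma slack_bounds: "0 \<le> slack" "slack \<le> 1 / 4096" "1 \<le> ratio * (1 - slack)\<^sup>2" "0 < ratio"
proof -
  show 1: "0 \<le> slack" "slack \<le> 1 / 4096" "0 < ratio"
    using theta by (auto simp: slack_def ratio_def add_pos_pos)
  have "1 + a * b = 2 - 4096 * slack" by (simp add: slack_def field_simps)
  moreover have "2 - 4 * slack \<le> 2 * (1 - slack)\<^sup>2" by (simp add: power2_eq_square algebra_simps)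
  ultimately have "1 + a * b \<le> 2 * (1 - slack)\<^sup>2" using 1(1) by linarith
  then show "1 \<le> ratio * (1 - slack)\<^sup>2"
    using theta by (simp add: ratio_def field_simps)
qed

text \<open>Every end piece of the segment from A to B has density at least \<kappa>: its increment
  of G is at least \<kappa> times that of F. Dually, \<open>upper_density\<close> says that every
  initial piece has density at most \<kappa>. Both are minimality conditions for
  \<open>\<kappa> * F - G\<close>.\<close>

definition lower_density :: "nat set \<Rightarrow> nat set \<Rightarrow> real \<Rightarrow> bool" where
  "lower_density A B \<kappa> \<longleftrightarrow> (\<forall>D. A \<subseteq> D \<and> D \<subseteq> B \<longrightarrow> \<kappa> * F B - G B \<le> \<kappa> * F D - G D)"

definition upper_density :: "nat set \<Rightarrow> nat set \<Rightarrow> real \<Rightarrow> bool" where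
  "upper_density A B \<kappa> \<longleftrightarrow> (\<forall>D. A \<subseteq> D \<and> D \<subseteq> B \<longrightarrow> \<kappa> * F A - G A \<le> \<kappa> * F D - G D)"

lemma density_mono:
  "lower_density A B \<kappa> \<Longrightarrow> A \<subseteq> A' \<Longrightarrow> lower_density A' B \<kappa>"
  "upper_density A B \<kappa> \<Longrightarrow> B' \<subseteq> B \<Longrightarrow> upper_density A B' \<kappa>"
  unfolding lower_density_def upper_density_def by (meson order_trans)+

text \<open>\<open>w \<le> x\<close> and \<open>lab * w \<le> y\<close> are clipped to exact proportionality within each block, so that
  Smith's rule orders them along \<open>\<pi>\<close>.\<close>

definition cert :: "(nat \<Rightarrow> nat) \<Rightarrow> nat \<Rightarrow> nat \<Rightarrow> (nat \<Rightarrow> real) \<Rightarrow> (nat \<Rightarrow> real) \<Rightarrow> (nat \<Rightarrow> real)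
    \<Rightarrow> (nat \<Rightarrow> real) \<Rightarrow> bool" where
  "cert \<pi> p q x y w lab \<longleftrightarrow>
     base F (pre \<pi> p) (\<pi> ` {p..<q}) x \<and> cobase G (pre \<pi> p) (\<pi> ` {p..<q}) y
   \<and> (\<forall>e\<in>\<pi> ` {p..<q}. 0 \<le> w e \<and> w e \<le> x e \<and> 0 \<le> lab e \<and> lab e * w e \<le> y e)
   \<and> (\<forall>i j. p \<le> i \<and> i \<le> j \<and> j < q \<longrightarrow> lab (\<pi> j) \<le> lab (\<pi> i))
   \<and> trid {p..<q} (incF \<pi>) (incG \<pi>)
       \<le> ratio * trid {p..<q} (\<lambda>i. w (\<pi> i)) (\<lambda>i. lab (\<pi> i) * w (\<pi> i))
   \<and> (1 - slack) * (\<Sum>i=p..<q. incF \<pi> i) \<le> (\<Sum>i=p..<q. w (\<pi> i))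
   \<and> (1 - slack) * (\<Sum>i=p..<q. incG \<pi> i) \<le> (\<Sum>i=p..<q. lab (\<pi> i) * w (\<pi> i))"

text \<open>\<kappa> will be the density of an enclosing segment, so on the block itself \<kappa> F
  and G may have different masses, and the error is measured against both. The factor n is consumed
  by the Cauchy--Schwarz inequality in \<open>small_defect\<close>.\<close>

definition flat :: "nat set \<Rightarrow> nat set \<Rightarrow> real \<Rightarrow> bool" where
  "flat A B \<kappa> \<longleftrightarrow> (\<exists>x y. base F A B x \<and> cobase G A B y
     \<and> 4096 * real n * (\<Sum>e\<in>B. \<bar>\<kappa> * x e - y e\<bar>) \<le> (1 - a * b) * (\<kappa> * (F (A \<union> B) - F A))
     \<and> 4096 * real n * (\<Sum>e\<in>B. \<bar>\<kappa> * x e - y e\<bar>) \<le> (1 - a * b) * (G (A \<union> B) - G A))"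

definition key_sorted :: "(nat \<Rightarrow> nat) \<Rightarrow> nat \<Rightarrow> nat \<Rightarrow> bool" where
  "key_sorted \<pi> p q \<longleftrightarrow> (\<forall>i j. p \<le> i \<and> i < j \<and> j < q \<longrightarrow> F {\<pi> i} / gain (\<pi> i) \<le> F {\<pi> j} / gain (\<pi> j))"

text \<open>Dividing everything that stems from G by \<kappa> reduces the claim to
  \<open>flat_block_unit\<close>. The witness w is the minimum of x and y / \<kappa>, and clipping
  loses at most \<zeta> of the mass.\<close>

lemma cert_flat:
  assumes \<pi>: "ordering \<pi>" "p \<le> q" "q \<le> n" and \<kappa>: "0 < \<kappa>"
    and flat: "flat (pre \<pi> p) (\<pi> ` {p..<q}) \<kappa>" and key: "key_sorted \<pi> p q"
  shows "\<exists>x y w. cert \<pi> p q x y w (\<lambda>_. \<kappa>)"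
proof -
  let ?A = "pre \<pi> p" and ?B = "\<pi> ` {p..<q}" and ?I = "{p..<q}"
  note seg = seg_facts[OF \<pi>]
  obtain x y where x: "base F ?A ?B x" and y: "cobase G ?A ?B y"
    and fl: "4096 * real n * (\<Sum>e\<in>?B. \<bar>\<kappa> * x e - y e\<bar>) \<le> (1 - a * b) * (\<kappa> * (F (pre \<pi> q) - F ?A))"
      "4096 * real n * (\<Sum>e\<in>?B. \<bar>\<kappa> * x e - y e\<bar>) \<le> (1 - a * b) * (G (pre \<pi> q) - G ?A)"
    using flat unfolding flat_def seg(1) by blast
  have n1: "1 \<le> real n" using n by simp
  define w where "w = (\<lambda>e. min (x e) (y e / \<kappa>))"
  define \<zeta> where "\<zeta> = (\<Sum>i\<in>?I. \<bar>x (\<pi> i) - y (\<pi> i) / \<kappa>\<bar>)"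
  have \<zeta>_eq: "(\<Sum>e\<in>?B. \<bar>\<kappa> * x e - y e\<bar>) = \<kappa> * \<zeta>"
    unfolding \<zeta>_def seg_sum[OF \<pi>] sum_distrib_left
  proof (rule sum.cong[OF refl])
    fix i
    have "\<kappa> * x (\<pi> i) - y (\<pi> i) = \<kappa> * (x (\<pi> i) - y (\<pi> i) / \<kappa>)" using \<kappa> by (simp add: field_simps)
    then show "\<bar>\<kappa> * x (\<pi> i) - y (\<pi> i)\<bar> = \<kappa> * \<bar>x (\<pi> i) - y (\<pi> i) / \<kappa>\<bar>"
      using \<kappa> by (simp add: abs_mult)
  qed
  have sx: "(\<Sum>i\<in>?I. x (\<pi> i)) = (\<Sum>i\<in>?I. incF \<pi> i)"
    using x seg(1) unfolding base_def seg_sum[OF \<pi>] inc_telescope[OF \<pi>(2)] by simp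
  have sy: "(\<Sum>i\<in>?I. y (\<pi> i)) = (\<Sum>i\<in>?I. incG \<pi> i)"
  proof -
    have "sum (\<lambda>e. - y e) ?B = - G (?A \<union> ?B) - - G ?A" using y unfolding base_def by blast
    then show ?thesis using seg(1) unfolding seg_sum[OF \<pi>] inc_telescope[OF \<pi>(2)] by (simp add: sum_negf)
  qed
  have xb: "a * F {\<pi> i} \<le> x (\<pi> i)" "x (\<pi> i) \<le> F {\<pi> i}" "0 < x (\<pi> i)" if "i \<in> ?I" for i
    using base_F_bounds[OF x seg(3,2)] that by blast+
  have yb: "b * gain (\<pi> i) \<le> y (\<pi> i)" "y (\<pi> i) \<le> gain (\<pi> i)" "0 < y (\<pi> i)" if "i \<in> ?I" for i
    using base_G_bounds[OF y seg(3,2)] that by blast+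
  have iB: "a * F {\<pi> i} \<le> incF \<pi> i" "incF \<pi> i \<le> F {\<pi> i}" "b * gain (\<pi> i) \<le> incG \<pi> i"
    "incG \<pi> i \<le> gain (\<pi> i)" if "i \<in> ?I" for i
    using incF_bounds[OF \<pi>(1), of i] incG_bounds[OF \<pi>(1), of i] that \<pi>(3) by auto
  have pos: "0 < F {\<pi> i}" "0 < gain (\<pi> i)" if "i \<in> ?I" for i
    using xb[OF that] yb[OF that] by auto
  have "(1 + a * b) * (tri ?I (incF \<pi>) (\<lambda>i. incG \<pi> i / \<kappa>) + (\<Sum>i\<in>?I. incF \<pi> i * (incG \<pi> i / \<kappa>)))
      \<le> (\<Sum>i\<in>?I. min (x (\<pi> i)) (y (\<pi> i) / \<kappa>))\<^sup>2 + (\<Sum>i\<in>?I. (min (x (\<pi> i)) (y (\<pi> i) / \<kappa>))\<^sup>2)"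
  proof (rule flat_block_unit[where f = "\<lambda>i. F {\<pi> i}" and \<gamma> = "\<lambda>i. gain (\<pi> i) / \<kappa>" and N = "real n"])
    show "real (card ?I) \<le> real n" using \<pi> by simp
    show "sum (incF \<pi>) ?I = (\<Sum>i\<in>?I. x (\<pi> i))" using sx by simp
    show "(\<Sum>i\<in>?I. incG \<pi> i / \<kappa>) = (\<Sum>i\<in>?I. y (\<pi> i) / \<kappa>)"
      using sy by (simp flip: sum_divide_distrib)
    show "4096 * real n * (\<Sum>i\<in>?I. \<bar>x (\<pi> i) - y (\<pi> i) / \<kappa>\<bar>) \<le> (1 - a * b) * (\<Sum>i\<in>?I. x (\<pi> i))"
    proof -
      have "\<kappa> * (4096 * real n * \<zeta>) \<le> \<kappa> * ((1 - a * b) * (\<Sum>i\<in>?I. incF \<pi> i))"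
        using fl(1) unfolding \<zeta>_eq inc_telescope[OF \<pi>(2)] by (simp add: algebra_simps)
      then show ?thesis using \<kappa> sx by (simp add: \<zeta>_def)
    qed
    fix i assume i: "i \<in> ?I"
    show "0 \<le> F {\<pi> i} \<and> a * F {\<pi> i} \<le> x (\<pi> i) \<and> x (\<pi> i) \<le> F {\<pi> i}" using xb[OF i] pos[OF i] by simp
    show "0 \<le> gain (\<pi> i) / \<kappa> \<and> b * (gain (\<pi> i) / \<kappa>) \<le> y (\<pi> i) / \<kappa> \<and> y (\<pi> i) / \<kappa> \<le> gain (\<pi> i) / \<kappa>"
      using yb[OF i] pos[OF i] \<kappa> by (simp add: divide_right_mono)
    show "a * F {\<pi> i} \<le> incF \<pi> i \<and> incF \<pi> i \<le> F {\<pi> i}" using iB[OF i] by simp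
    show "b * (gain (\<pi> i) / \<kappa>) \<le> incG \<pi> i / \<kappa> \<and> incG \<pi> i / \<kappa> \<le> gain (\<pi> i) / \<kappa>"
      using iB[OF i] \<kappa> by (simp add: divide_right_mono)
    fix j assume j: "j \<in> ?I" and "i < j"
    then have "F {\<pi> i} / gain (\<pi> i) \<le> F {\<pi> j} / gain (\<pi> j)" using key i unfolding key_sorted_def by auto
    then show "F {\<pi> i} * (gain (\<pi> j) / \<kappa>) \<le> F {\<pi> j} * (gain (\<pi> i) / \<kappa>)"
      using pos[OF i] pos[OF j] \<kappa> by (simp add: field_simps)
  qed (use n1 ab in auto)
  then have blk: "(1 + a * b) * trid ?I (incF \<pi>) (\<lambda>i. incG \<pi> i / \<kappa>)
      \<le> (\<Sum>i\<in>?I. w (\<pi> i))\<^sup>2 + (\<Sum>i\<in>?I. (w (\<pi> i))\<^sup>2)" by (simp add: trid_def w_def)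
  have t1: "trid ?I (incF \<pi>) (incG \<pi>) = \<kappa> * trid ?I (incF \<pi>) (\<lambda>i. incG \<pi> i / \<kappa>)"
    using \<kappa> tri_scale[of ?I 1 "incF \<pi>" "1 / \<kappa>" "incG \<pi>"]
    by (simp add: trid_def algebra_simps sum_distrib_left)
  \<comment> \<open>With a constant label the lower bound does not depend on the order inside the
    block.\<close>
  have t2: "2 * trid ?I (\<lambda>i. w (\<pi> i)) (\<lambda>i. \<kappa> * w (\<pi> i))
      = \<kappa> * ((\<Sum>i\<in>?I. w (\<pi> i))\<^sup>2 + (\<Sum>i\<in>?I. (w (\<pi> i))\<^sup>2))"
  proof -
    have "2 * trid ?I (\<lambda>i. w (\<pi> i)) (\<lambda>i. \<kappa> * w (\<pi> i))
        = \<kappa> * (2 * tri ?I (\<lambda>i. w (\<pi> i)) (\<lambda>i. w (\<pi> i)) + 2 * (\<Sum>i\<in>?I. (w (\<pi> i))\<^sup>2))"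
      using tri_scale[of ?I 1 "\<lambda>i. w (\<pi> i)" \<kappa> "\<lambda>i. w (\<pi> i)"]
      by (simp add: trid_def algebra_simps sum_distrib_left power2_eq_square)
    then show ?thesis
      using tri_total[of ?I "\<lambda>i. w (\<pi> i)" "\<lambda>i. w (\<pi> i)"] by (simp add: power2_eq_square)
  qed
  have "cert \<pi> p q x y w (\<lambda>_. \<kappa>)" unfolding cert_def
  proof (intro conjI ballI allI impI)
    fix e assume "e \<in> ?B"
    then obtain i where i: "i \<in> ?I" "e = \<pi> i" by auto
    show "0 \<le> w e" "w e \<le> x e" "0 \<le> \<kappa>" "\<kappa> * w e \<le> y e"
      using xb[OF i(1)] yb[OF i(1)] \<kappa> i(2) mult_left_mono[of "w e" "y e / \<kappa>" \<kappa>] by (auto simp: w_def)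
  next
    have "(1 + a * b) * trid ?I (incF \<pi>) (incG \<pi>) = \<kappa> * ((1 + a * b) * trid ?I (incF \<pi>) (\<lambda>i. incG \<pi> i / \<kappa>))"
      unfolding t1 by simp
    also have "\<dots> \<le> \<kappa> * ((\<Sum>i\<in>?I. w (\<pi> i))\<^sup>2 + (\<Sum>i\<in>?I. (w (\<pi> i))\<^sup>2))"
      using blk \<kappa> by (intro mult_left_mono) auto
    also have "\<dots> = 2 * trid ?I (\<lambda>i. w (\<pi> i)) (\<lambda>i. \<kappa> * w (\<pi> i))" using t2 by simp
    finally show "trid ?I (incF \<pi>) (incG \<pi>) \<le> ratio * trid ?I (\<lambda>i. w (\<pi> i)) (\<lambda>i. \<kappa> * w (\<pi> i))"
      using theta by (simp add: ratio_def field_simps)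
  next
    have "4096 * (\<kappa> * \<zeta>) \<le> 4096 * real n * (\<kappa> * \<zeta>)"
      using n1 \<kappa> by (intro mult_right_mono) (auto simp: \<zeta>_def sum_nonneg)
    then have sl: "\<kappa> * \<zeta> \<le> slack * (\<kappa> * (\<Sum>i\<in>?I. incF \<pi> i))" "\<kappa> * \<zeta> \<le> slack * (\<Sum>i\<in>?I. incG \<pi> i)"
      using fl unfolding \<zeta>_eq inc_telescope[OF \<pi>(2)] slack_def by auto
    have "\<zeta> \<le> slack * (\<Sum>i\<in>?I. incF \<pi> i)" using sl(1) \<kappa> by (simp add: mult.left_commute)
    moreover have "(\<Sum>i\<in>?I. x (\<pi> i) - \<bar>x (\<pi> i) - y (\<pi> i) / \<kappa>\<bar>) \<le> (\<Sum>i\<in>?I. w (\<pi> i))"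
      by (intro sum_mono) (auto simp: w_def)
    ultimately show "(1 - slack) * (\<Sum>i\<in>?I. incF \<pi> i) \<le> (\<Sum>i\<in>?I. w (\<pi> i))"
      using sx by (simp add: sum_subtractf \<zeta>_def algebra_simps)
    have "(\<Sum>i\<in>?I. y (\<pi> i) - \<kappa> * \<bar>x (\<pi> i) - y (\<pi> i) / \<kappa>\<bar>) \<le> (\<Sum>i\<in>?I. \<kappa> * w (\<pi> i))"
    proof (rule sum_mono)
      fix i
      have "y (\<pi> i) - \<kappa> * \<bar>x (\<pi> i) - y (\<pi> i) / \<kappa>\<bar> = \<kappa> * (y (\<pi> i) / \<kappa> - \<bar>x (\<pi> i) - y (\<pi> i) / \<kappa>\<bar>)"
        using \<kappa> by (simp add: right_diff_distrib)
      also have "\<dots> \<le> \<kappa> * w (\<pi> i)" using \<kappa> by (intro mult_left_mono) (auto simp: w_def)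
      finally show "y (\<pi> i) - \<kappa> * \<bar>x (\<pi> i) - y (\<pi> i) / \<kappa>\<bar> \<le> \<kappa> * w (\<pi> i)" .
    qed
    then show "(1 - slack) * (\<Sum>i\<in>?I. incG \<pi> i) \<le> (\<Sum>i\<in>?I. \<kappa> * w (\<pi> i))"
      using sy sl(2) by (simp add: sum_subtractf \<zeta>_def algebra_simps sum_distrib_left)
  qed (use x y in auto)
  then show ?thesis by blast
qed

text \<open>Inside each part the ratio holds already. Pairs with one element in each part contribute
  the full product of the masses to the cost and at least (1 - slack)^2 of it to the lower bound,
  which \<open>ratio\<close> makes up for.\<close>

lemma cert_join:
  assumes \<pi>: "ordering \<pi>" "p \<le> m" "m \<le> q" "q \<le> n"
    and c1: "cert \<pi> p m x1 y1 w1 lab1" and c2: "cert \<pi> m q x2 y2 w2 lab2"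
    and lab: "\<And>i j. p \<le> i \<Longrightarrow> i < m \<Longrightarrow> m \<le> j \<Longrightarrow> j < q \<Longrightarrow> lab2 (\<pi> j) \<le> lab1 (\<pi> i)"
  defines "S \<equiv> \<pi> ` {p..<m}"
  shows "cert \<pi> p q (\<lambda>e. if e \<in> S then x1 e else x2 e) (\<lambda>e. if e \<in> S then y1 e else y2 e)
    (\<lambda>e. if e \<in> S then w1 e else w2 e) (\<lambda>e. if e \<in> S then lab1 e else lab2 e)"
    (is "cert \<pi> p q ?x ?y ?w ?lab")
proof -
  let ?B1 = "\<pi> ` {p..<m}" and ?B2 = "\<pi> ` {m..<q}" and ?B = "\<pi> ` {p..<q}"
  have le: "m \<le> n" "p \<le> q" using \<pi> by auto
  note s1 = seg_facts[OF \<pi>(1,2) le(1)] and s2 = seg_facts[OF \<pi>(1,3,4)]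
  have B: "?B = ?B1 \<union> ?B2" using \<pi> by (simp flip: image_Un add: ivl_disj_un)
  have in1: "\<pi> i \<in> S" if "i \<in> {p..<m}" for i using that by (auto simp: S_def)
  have in2: "\<pi> i \<notin> S" if "i \<in> {m..<q}" for i
  proof
    assume "\<pi> i \<in> S"
    then obtain j where "j \<in> {p..<m}" "\<pi> i = \<pi> j" by (auto simp: S_def)
    then show False using orderingD(1)[OF \<pi>(1)] that \<pi> by (auto dest: inj_onD[of _ _ i j])
  qed
  have dis: "pre \<pi> p \<inter> ?B2 = {}" "?B1 \<inter> ?B2 = {}" using s2(2) unfolding s1(1)[symmetric] by auto
  have sub: "pre \<pi> p \<union> ?B1 \<union> ?B2 \<subseteq> {..<n}" using s1(1) s2(3) by simp
  have wsum: "(\<Sum>i=p..<q. h1 i) = (\<Sum>i=p..<m. h1 i) + (\<Sum>i=m..<q. h1 i)" for h1 :: "nat \<Rightarrow> real"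
    using \<pi> by (simp add: sum.atLeastLessThan_concat)
  have w: "(\<Sum>i=p..<m. ?w (\<pi> i)) = (\<Sum>i=p..<m. w1 (\<pi> i))" "(\<Sum>i=m..<q. ?w (\<pi> i)) = (\<Sum>i=m..<q. w2 (\<pi> i))"
    "(\<Sum>i=p..<m. ?lab (\<pi> i) * ?w (\<pi> i)) = (\<Sum>i=p..<m. lab1 (\<pi> i) * w1 (\<pi> i))"
    "(\<Sum>i=m..<q. ?lab (\<pi> i) * ?w (\<pi> i)) = (\<Sum>i=m..<q. lab2 (\<pi> i) * w2 (\<pi> i))"
    using in1 in2 by (auto intro!: sum.cong)
  have g1: "(1 - slack) * (\<Sum>i=p..<m. incF \<pi> i) \<le> (\<Sum>i=p..<m. w1 (\<pi> i))"
    "(1 - slack) * (\<Sum>i=p..<m. incG \<pi> i) \<le> (\<Sum>i=p..<m. lab1 (\<pi> i) * w1 (\<pi> i))"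
    "trid {p..<m} (incF \<pi>) (incG \<pi>)
       \<le> ratio * trid {p..<m} (\<lambda>i. w1 (\<pi> i)) (\<lambda>i. lab1 (\<pi> i) * w1 (\<pi> i))"
    using c1 unfolding cert_def by blast+
  have g2: "(1 - slack) * (\<Sum>i=m..<q. incF \<pi> i) \<le> (\<Sum>i=m..<q. w2 (\<pi> i))"
    "(1 - slack) * (\<Sum>i=m..<q. incG \<pi> i) \<le> (\<Sum>i=m..<q. lab2 (\<pi> i) * w2 (\<pi> i))"
    "trid {m..<q} (incF \<pi>) (incG \<pi>)
       \<le> ratio * trid {m..<q} (\<lambda>i. w2 (\<pi> i)) (\<lambda>i. lab2 (\<pi> i) * w2 (\<pi> i))"
    using c2 unfolding cert_def by blast+
  show ?thesis unfolding cert_def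
  proof (intro conjI ballI allI impI)
    have b2: "base F (pre \<pi> p \<union> ?B1) ?B2 x2" "cobase G (pre \<pi> p \<union> ?B1) ?B2 y2"
      and b1: "base F (pre \<pi> p) ?B1 x1" "cobase G (pre \<pi> p) ?B1 y1"
      using c1 c2 unfolding cert_def s1(1) by blast+
    show "base F (pre \<pi> p) ?B ?x"
      unfolding B S_def by (rule base_glue[OF subF sub dis _ _ b1(1) b2(1)]) auto
    have "cobase G (pre \<pi> p) ?B (\<lambda>e. - (if e \<in> ?B1 then - y1 e else - y2 e))"
      unfolding B minus_minus using base_glue[OF subG sub dis _ _ b1(2) b2(2)] by auto
    then show "cobase G (pre \<pi> p) ?B ?y" unfolding S_def by (simp add: if_distrib cong: if_cong)
  next
    fix e assume "e \<in> ?B"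
    then have "e \<in> ?B1 \<and> e \<in> S \<or> e \<in> ?B2 \<and> e \<notin> S" unfolding B S_def using dis by blast
    then show "0 \<le> ?w e" "?w e \<le> ?x e" "0 \<le> ?lab e" "?lab e * ?w e \<le> ?y e"
      using c1 c2 unfolding cert_def by auto
  next
    fix i j assume "p \<le> i \<and> i \<le> j \<and> j < q"
    then consider "j < m" "p \<le> i" "i \<le> j" | "i < m" "m \<le> j" "p \<le> i" "j < q" | "m \<le> i" "i \<le> j" "j < q"
      by linarith
    then show "?lab (\<pi> j) \<le> ?lab (\<pi> i)"
    proof cases
      case 1
      then show ?thesis using c1 in1[of i] in1[of j] unfolding cert_def by auto
    next
      case 2
      then show ?thesis using lab[of i j] in1[of i] in2[of j] by auto
    next
      case 3
      then show ?thesis using c2 in2[of i] in2[of j] unfolding cert_def by auto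
    qed
  next
    show "(1 - slack) * (\<Sum>i=p..<q. incF \<pi> i) \<le> (\<Sum>i=p..<q. ?w (\<pi> i))"
      using g1(1) g2(1) unfolding wsum w by (simp add: algebra_simps)
    show "(1 - slack) * (\<Sum>i=p..<q. incG \<pi> i) \<le> (\<Sum>i=p..<q. ?lab (\<pi> i) * ?w (\<pi> i))"
      using g1(2) g2(2) unfolding wsum w by (simp add: algebra_simps)
    have i0: "0 \<le> (\<Sum>i=p..<m. incF \<pi> i)" "0 \<le> (\<Sum>i=m..<q. incG \<pi> i)"
      using incF_bounds(3)[OF \<pi>(1)] incG_bounds(3)[OF \<pi>(1)] \<pi> le by (auto intro!: sum_nonneg simp: less_imp_le)
    let ?f = "\<Sum>i=p..<m. incF \<pi> i" and ?g = "\<Sum>i=m..<q. incG \<pi> i"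
    have "?f * ?g \<le> (ratio * (1 - slack)\<^sup>2) * (?f * ?g)"
      using slack_bounds(3) i0 mult_right_mono[of 1 "ratio * (1 - slack)\<^sup>2" "?f * ?g"] by simp
    also have "\<dots> = ratio * (((1 - slack) * ?f) * ((1 - slack) * ?g))"
      by (simp add: power2_eq_square algebra_simps)
    also have "\<dots> \<le> ratio * ((\<Sum>i=p..<m. w1 (\<pi> i)) * (\<Sum>i=m..<q. lab2 (\<pi> i) * w2 (\<pi> i)))"
      using slack_bounds g1(1) g2(2) i0 by (intro mult_left_mono mult_mono) (auto intro: order_trans[rotated])
    finally have cross: "?f * ?g \<le> ratio * ((\<Sum>i=p..<m. w1 (\<pi> i)) * (\<Sum>i=m..<q. lab2 (\<pi> i) * w2 (\<pi> i)))" .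
    have "trid {p..<m} (\<lambda>i. ?w (\<pi> i)) (\<lambda>i. ?lab (\<pi> i) * ?w (\<pi> i))
        = trid {p..<m} (\<lambda>i. w1 (\<pi> i)) (\<lambda>i. lab1 (\<pi> i) * w1 (\<pi> i))"
      "trid {m..<q} (\<lambda>i. ?w (\<pi> i)) (\<lambda>i. ?lab (\<pi> i) * ?w (\<pi> i))
        = trid {m..<q} (\<lambda>i. w2 (\<pi> i)) (\<lambda>i. lab2 (\<pi> i) * w2 (\<pi> i))"
      using in1 in2 by (auto intro!: trid_cong)
    then show "trid {p..<q} (incF \<pi>) (incG \<pi>)
        \<le> ratio * trid {p..<q} (\<lambda>i. ?w (\<pi> i)) (\<lambda>i. ?lab (\<pi> i) * ?w (\<pi> i))"
      unfolding trid_split[OF \<pi>(2,3)] w using g1(3) g2(3) cross by (simp add: algebra_simps)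
  qed
qed

text \<open>The certificate compares the cost of \<pi> with a modular cost for which Smith's rule
  makes \<pi> optimal; at \<sigma> this modular cost is below the true one.\<close>

lemma cert_ratio:
  assumes \<pi>: "ordering \<pi>" and c: "cert \<pi> 0 n x y w lab" and \<sigma>: "ordering \<sigma>"
  shows "cost \<pi> \<le> ratio * cost \<sigma>"
proof -
  have im: "\<pi> ` {0..<n} = {..<n}" using orderingD(2)[OF \<pi>] by (simp add: lessThan_atLeast0)
  have x: "base F {} {..<n} x" and y: "cobase G {} {..<n} y"
    and w: "\<And>e. e < n \<Longrightarrow> 0 \<le> w e \<and> w e \<le> x e \<and> 0 \<le> lab e \<and> lab e * w e \<le> y e"
    and lab: "\<And>i j. i \<le> j \<Longrightarrow> j < n \<Longrightarrow> lab (\<pi> j) \<le> lab (\<pi> i)"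
    and c': "trid {..<n} (incF \<pi>) (incG \<pi>)
       \<le> ratio * trid {..<n} (\<lambda>i. w (\<pi> i)) (\<lambda>i. lab (\<pi> i) * w (\<pi> i))"
    using c unfolding cert_def im by (auto simp: lessThan_atLeast0)
  have "cost \<pi> \<le> ratio * trid {..<n} (\<lambda>i. w (\<pi> i)) (\<lambda>i. lab (\<pi> i) * w (\<pi> i))"
    using c' unfolding cost_eq by (simp add: lessThan_atLeast0)
  also have "\<dots> \<le> ratio * trid {..<n} (\<lambda>i. w (\<sigma> i)) (\<lambda>i. lab (\<sigma> i) * w (\<sigma> i))"
    using \<pi> \<sigma> w lab slack_bounds(4) by (intro mult_left_mono smith_rule) (auto simp: ordering_def)
  also have "\<dots> \<le> ratio * cost \<sigma>"
    using w slack_bounds(4) by (intro mult_left_mono cost_lower_bound[OF \<sigma> x y]) auto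
  finally show ?thesis .
qed

text \<open>A certificate alone does not tell how its labels compare with those of neighbouring
  segments. The two clauses do, for all thresholds \<kappa> at once, since the densities of all
  enclosing segments have to be respected.\<close>

definition solved :: "(nat \<Rightarrow> nat) \<Rightarrow> nat \<Rightarrow> nat \<Rightarrow> bool" where
  "solved \<pi> p q \<longleftrightarrow> (\<exists>x y w lab. cert \<pi> p q x y w lab
     \<and> (\<forall>\<kappa>. lower_density (pre \<pi> p) (pre \<pi> q) \<kappa> \<longrightarrow> (\<forall>e\<in>\<pi> ` {p..<q}. \<kappa> \<le> lab e))
     \<and> (\<forall>\<kappa>. upper_density (pre \<pi> p) (pre \<pi> q) \<kappa> \<longrightarrow> (\<forall>e\<in>\<pi> ` {p..<q}. lab e \<le> \<kappa>)))"

lemma cert_empty: "cert \<pi> p p x y w lab"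
  by (auto simp: cert_def base_def trid_def tri_def)

lemma solved_empty: "solved \<pi> p p"
  unfolding solved_def using cert_empty[of \<pi> p] by auto

text \<open>The density conditions put the labels of the left part above \<kappa> and those of the
  right part below it, so the three certificates join. A threshold from outside is compared with
  \<kappa> through the density of the whole segment, and it passes to the outer part that lies on
  its far side.\<close>

lemma solved_node:
  assumes \<pi>: "ordering \<pi>" "p \<le> l" "l \<le> r" "r \<le> q" "q \<le> n" "p < q"
    and left: "solved \<pi> p l" "lower_density (pre \<pi> p) (pre \<pi> l) \<kappa>"
    and right: "solved \<pi> r q" "upper_density (pre \<pi> r) (pre \<pi> q) \<kappa>"
    and mid: "l < r \<Longrightarrow> flat (pre \<pi> l) (\<pi> ` {l..<r}) \<kappa> \<and> key_sorted \<pi> l r"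
    and \<kappa>: "\<kappa> * (F (pre \<pi> q) - F (pre \<pi> p)) = G (pre \<pi> q) - G (pre \<pi> p)"
  shows "solved \<pi> p q"
proof -
  note mp = mass_pos[OF \<pi>(1,6,5)]
  have \<kappa>0: "0 < \<kappa>" using \<kappa> mp by (metis zero_less_mult_pos2)
  from left(1)[unfolded solved_def] obtain x1 y1 w1 lab1 where c1: "cert \<pi> p l x1 y1 w1 lab1"
    and "\<forall>\<kappa>. lower_density (pre \<pi> p) (pre \<pi> l) \<kappa> \<longrightarrow> (\<forall>e\<in>\<pi> ` {p..<l}. \<kappa> \<le> lab1 e)"
      "\<forall>\<kappa>. upper_density (pre \<pi> p) (pre \<pi> l) \<kappa> \<longrightarrow> (\<forall>e\<in>\<pi> ` {p..<l}. lab1 e \<le> \<kappa>)"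
    by (elim exE conjE) (rule that)
  then have lo1: "\<And>\<kappa> e. lower_density (pre \<pi> p) (pre \<pi> l) \<kappa> \<Longrightarrow> e \<in> \<pi> ` {p..<l} \<Longrightarrow> \<kappa> \<le> lab1 e"
    and up1: "\<And>\<kappa> e. upper_density (pre \<pi> p) (pre \<pi> l) \<kappa> \<Longrightarrow> e \<in> \<pi> ` {p..<l} \<Longrightarrow> lab1 e \<le> \<kappa>"
    by auto
  from right(1)[unfolded solved_def] obtain x3 y3 w3 lab3 where c3: "cert \<pi> r q x3 y3 w3 lab3"
    and "\<forall>\<kappa>. lower_density (pre \<pi> r) (pre \<pi> q) \<kappa> \<longrightarrow> (\<forall>e\<in>\<pi> ` {r..<q}. \<kappa> \<le> lab3 e)"
      "\<forall>\<kappa>. upper_density (pre \<pi> r) (pre \<pi> q) \<kappa> \<longrightarrow> (\<forall>e\<in>\<pi> ` {r..<q}. lab3 e \<le> \<kappa>)"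
    by (elim exE conjE) (rule that)
  then have lo3: "\<And>\<kappa> e. lower_density (pre \<pi> r) (pre \<pi> q) \<kappa> \<Longrightarrow> e \<in> \<pi> ` {r..<q} \<Longrightarrow> \<kappa> \<le> lab3 e"
    and up3: "\<And>\<kappa> e. upper_density (pre \<pi> r) (pre \<pi> q) \<kappa> \<Longrightarrow> e \<in> \<pi> ` {r..<q} \<Longrightarrow> lab3 e \<le> \<kappa>"
    by auto
  obtain x2 y2 w2 where c2: "cert \<pi> l r x2 y2 w2 (\<lambda>_. \<kappa>)"
  proof (cases "l = r")
    case True
    then show ?thesis using that cert_empty by blast
  next
    case False
    then show ?thesis using that cert_flat[OF \<pi>(1,3) _ \<kappa>0] mid \<pi> by auto
  qed
  have rn: "r \<le> n" "p \<le> r" using \<pi> by auto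
  have lab12: "\<kappa> \<le> lab1 (\<pi> i)" if "p \<le> i" "i < l" "l \<le> j" "j < r" for i j
    using lo1[OF left(2)] that by simp
  obtain x y w where c12: "cert \<pi> p r x y w (\<lambda>e. if e \<in> \<pi> ` {p..<l} then lab1 e else \<kappa>)"
    by (rule that, rule cert_join[OF \<pi>(1,2,3) rn(1) c1 c2], rule lab12)
  let ?lab = "\<lambda>e. if e \<in> \<pi> ` {p..<r} then if e \<in> \<pi> ` {p..<l} then lab1 e else \<kappa> else lab3 e"
  have lab123: "lab3 (\<pi> j) \<le> (if \<pi> i \<in> \<pi> ` {p..<l} then lab1 (\<pi> i) else \<kappa>)"
    if "p \<le> i" "i < r" "r \<le> j" "j < q" for i j
  proof -
    have "lab3 (\<pi> j) \<le> \<kappa>" using up3[OF right(2)] that by simp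
    then show ?thesis using lo1[OF left(2), of "\<pi> i"] by auto
  qed
  obtain x' y' w' where c: "cert \<pi> p q x' y' w' ?lab"
    by (rule that, rule cert_join[OF \<pi>(1) rn(2) \<pi>(4,5) c12 c3], rule lab123)
  have mono: "pre \<pi> p \<subseteq> pre \<pi> l" "pre \<pi> l \<subseteq> pre \<pi> r" "pre \<pi> r \<subseteq> pre \<pi> q" using \<pi> by auto
  have seg: "e \<in> \<pi> ` {p..<r} \<or> e \<in> \<pi> ` {r..<q}" if "e \<in> \<pi> ` {p..<q}" for e
    using that by (auto simp: image_iff) (metis atLeastLessThan_iff linorder_not_le)
  have "\<kappa>' \<le> ?lab e" if lo: "lower_density (pre \<pi> p) (pre \<pi> q) \<kappa>'" and e: "e \<in> \<pi> ` {p..<q}" for \<kappa>' e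
  proof -
    have "\<kappa>' * F (pre \<pi> q) - G (pre \<pi> q) \<le> \<kappa>' * F (pre \<pi> p) - G (pre \<pi> p)"
      using lo mono unfolding lower_density_def by (meson order_refl order_trans)
    then have "\<kappa>' * (F (pre \<pi> q) - F (pre \<pi> p)) \<le> \<kappa> * (F (pre \<pi> q) - F (pre \<pi> p))"
      using \<kappa> by (simp add: algebra_simps)
    then have "\<kappa>' \<le> \<kappa>" using mp(1) by simp
    moreover have "lower_density (pre \<pi> r) (pre \<pi> q) \<kappa>'"
      using density_mono(1)[OF lo] mono by (meson order_trans)
    ultimately show ?thesis using seg[OF e] lo1[OF left(2)] lo3[of \<kappa>'] by (auto intro: order_trans)
  qed
  moreover have "?lab e \<le> \<kappa>'" if up: "upper_density (pre \<pi> p) (pre \<pi> q) \<kappa>'" and e: "e \<in> \<pi> ` {p..<q}" for \<kappa>' e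
  proof -
    have "\<kappa>' * F (pre \<pi> p) - G (pre \<pi> p) \<le> \<kappa>' * F (pre \<pi> q) - G (pre \<pi> q)"
      using up mono unfolding upper_density_def by (meson order_refl order_trans)
    then have "\<kappa> * (F (pre \<pi> q) - F (pre \<pi> p)) \<le> \<kappa>' * (F (pre \<pi> q) - F (pre \<pi> p))"
      using \<kappa> by (simp add: algebra_simps)
    then have "\<kappa> \<le> \<kappa>'" using mp(1) by simp
    moreover have "upper_density (pre \<pi> p) (pre \<pi> l) \<kappa>'"
      using density_mono(2)[OF up] mono by (meson order_trans)
    ultimately show ?thesis using seg[OF e] up3[OF right(2)] up1[of \<kappa>'] by (auto intro: order_trans)
  qed
  ultimately show ?thesis unfolding solved_def using c by (intro exI conjI) auto
qed

lemma solved_ratio: "ordering \<pi> \<Longrightarrow> solved \<pi> 0 n \<Longrightarrow> ordering \<sigma> \<Longrightarrow> cost \<pi> \<le> ratio * cost \<sigma>"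
  unfolding solved_def by (elim exE conjE) (rule cert_ratio)

section \<open>Frank--Wolfe iterations and exact cuts\<close>

text \<open>Being at least 2, M absorbs numerical constants as well as factors n into its
  powers.\<close>

abbreviation M :: real where "M \<equiv> real n + 1"

definition pot :: "real \<Rightarrow> nat set \<Rightarrow> real" where "pot \<kappa> X = \<kappa> * F X - G X"

text \<open>The program stores only z. The bases x and y behind it stay in the invariant because
  \<open>flat\<close> needs both of them, not just a base of \<open>pot \<kappa>\<close>.\<close>

definition iterate :: "nat set \<Rightarrow> nat set \<Rightarrow> real \<Rightarrow> (nat \<Rightarrow> real) \<Rightarrow> bool" where
  "iterate A B \<kappa> z \<longleftrightarrow>
     (\<exists>x y. base F A B x \<and> cobase G A B y \<and> (\<forall>e\<in>B. z e = \<kappa> * x e - y e))"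

definition vertex :: "(nat \<Rightarrow> nat) \<Rightarrow> real \<Rightarrow> nat \<Rightarrow> real" where
  "vertex \<pi> \<kappa> k = \<kappa> * incF \<pi> k - incG \<pi> k"

definition spread :: "nat set \<Rightarrow> nat set \<Rightarrow> real \<Rightarrow> real" where
  "spread A B \<kappa> = 2 * (1 - a * b) * (\<kappa> * (F (A \<union> B) - F A) + (G (A \<union> B) - G A))"

lemma base_cong: "(\<And>e. e \<in> B \<Longrightarrow> x e = x' e) \<Longrightarrow> base u A B x = base u A B x'"
  unfolding base_def by (smt (verit, best) subsetD sum.cong)

lemma greedy_bases:
  assumes "ordering \<pi>" "l \<le> r" "r \<le> n"
  obtains x y where "base F (pre \<pi> l) (\<pi> ` {l..<r}) x" "cobase G (pre \<pi> l) (\<pi> ` {l..<r}) y"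
    "\<And>k. l \<le> k \<Longrightarrow> k < r \<Longrightarrow> x (\<pi> k) = incF \<pi> k" "\<And>k. l \<le> k \<Longrightarrow> k < r \<Longrightarrow> y (\<pi> k) = incG \<pi> k"
proof
  let ?x = "\<lambda>e. incF \<pi> (inv_into {..<n} \<pi> e)" and ?y = "\<lambda>e. incG \<pi> (inv_into {..<n} \<pi> e)"
  have inv: "inv_into {..<n} \<pi> (\<pi> k) = k" if "k < r" for k
    using orderingD(1)[OF assms(1)] that assms(3) by (intro inv_into_f_f) auto
  show *: "?x (\<pi> k) = incF \<pi> k" "?y (\<pi> k) = incG \<pi> k" if "l \<le> k" "k < r" for k
    using inv[OF that(2)] by auto
  show "base F (pre \<pi> l) (\<pi> ` {l..<r}) ?x"
    by (rule base_greedy[OF subF orderingD(1)[OF assms(1)] _ assms(2,3)])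
       (use * orderingD(2)[OF assms(1)] in \<open>auto simp: incF_def\<close>)
  show "cobase G (pre \<pi> l) (\<pi> ` {l..<r}) ?y"
    by (rule base_greedy[OF subG orderingD(1)[OF assms(1)] _ assms(2,3)])
       (use * orderingD(2)[OF assms(1)] in \<open>auto simp: incG_def\<close>)
qed

lemma iterate_init:
  assumes "ordering \<pi>" "l \<le> r" "r \<le> n" "\<And>k. l \<le> k \<Longrightarrow> k < r \<Longrightarrow> z (\<pi> k) = vertex \<pi> \<kappa> k"
  shows "iterate (pre \<pi> l) (\<pi> ` {l..<r}) \<kappa> z"
proof -
  obtain x y where "base F (pre \<pi> l) (\<pi> ` {l..<r}) x" "cobase G (pre \<pi> l) (\<pi> ` {l..<r}) y"
    "\<And>k. l \<le> k \<Longrightarrow> k < r \<Longrightarrow> x (\<pi> k) = incF \<pi> k" "\<And>k. l \<le> k \<Longrightarrow> k < r \<Longrightarrow> y (\<pi> k) = incG \<pi> k"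
    using greedy_bases[OF assms(1-3)] by metis
  then show ?thesis unfolding iterate_def using assms(4) by (intro exI[of _ x] exI[of _ y]) (auto simp: vertex_def)
qed

lemma iterate_step:
  assumes \<pi>: "ordering \<pi>" "l \<le> r" "r \<le> n" and it: "iterate (pre \<pi> l) (\<pi> ` {l..<r}) \<kappa> z"
    and t: "0 \<le> t" "t \<le> 1"
    and z': "\<And>k. l \<le> k \<Longrightarrow> k < r \<Longrightarrow> z' (\<pi> k) = z (\<pi> k) + t * (vertex \<pi> \<kappa> k - z (\<pi> k))"
  shows "iterate (pre \<pi> l) (\<pi> ` {l..<r}) \<kappa> z'"
proof -
  let ?A = "pre \<pi> l" and ?B = "\<pi> ` {l..<r}"
  obtain x y where x: "base F ?A ?B x" and y: "cobase G ?A ?B y" and z: "\<And>e. e \<in> ?B \<Longrightarrow> z e = \<kappa> * x e - y e"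
    using it unfolding iterate_def by blast
  obtain p q where p: "base F ?A ?B p" and q: "cobase G ?A ?B q"
    and pq: "\<And>k. l \<le> k \<Longrightarrow> k < r \<Longrightarrow> p (\<pi> k) = incF \<pi> k" "\<And>k. l \<le> k \<Longrightarrow> k < r \<Longrightarrow> q (\<pi> k) = incG \<pi> k"
    using greedy_bases[OF \<pi>] by metis
  have "cobase G ?A ?B (\<lambda>e. y e + t * (q e - y e))"
    using base_convex[OF y q t] by (simp add: algebra_simps)
  moreover have "z' e = \<kappa> * (x e + t * (p e - x e)) - (y e + t * (q e - y e))" if "e \<in> ?B" for e
  proof -
    obtain k where k: "e = \<pi> k" "l \<le> k" "k < r" using \<open>e \<in> ?B\<close> by auto
    have "z' e = z e + t * (\<kappa> * p e - q e - z e)"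
      using z'[OF k(2,3)] pq[OF k(2,3)] k(1) by (simp add: vertex_def)
    then show ?thesis unfolding z[OF \<open>e \<in> ?B\<close>] by (simp add: algebra_simps)
  qed
  ultimately show ?thesis unfolding iterate_def using base_convex[OF x p t] by (intro exI conjI ballI)
qed

text \<open>Two coordinates between a F{e} and F{e} differ by at most 1 - \<theta> times their sum,
  since \<theta> is at most a; similarly for G with b. Summation bounds the l1 distance of an
  iterate from a greedy vertex.\<close>

lemma spread_bound:
  assumes \<pi>: "ordering \<pi>" "l \<le> r" "r \<le> n" and it: "iterate (pre \<pi> l) (\<pi> ` {l..<r}) \<kappa> z" and \<kappa>: "0 \<le> \<kappa>"
  shows "(\<Sum>k=l..<r. (vertex \<pi> \<kappa> k - z (\<pi> k))\<^sup>2) \<le> (spread (pre \<pi> l) (\<pi> ` {l..<r}) \<kappa>)\<^sup>2"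
    "0 \<le> spread (pre \<pi> l) (\<pi> ` {l..<r}) \<kappa>"
proof -
  let ?A = "pre \<pi> l" and ?B = "\<pi> ` {l..<r}"
  note seg = seg_facts[OF \<pi>]
  obtain x y where x: "base F ?A ?B x" and y: "cobase G ?A ?B y" and z: "\<And>e. e \<in> ?B \<Longrightarrow> z e = \<kappa> * x e - y e"
    using it unfolding iterate_def by blast
  have sx: "(\<Sum>k=l..<r. x (\<pi> k)) = F (pre \<pi> r) - F ?A"
    using x seg(1) unfolding base_def seg_sum[OF \<pi>] by simp
  have sy: "(\<Sum>k=l..<r. y (\<pi> k)) = G (pre \<pi> r) - G ?A"
  proof -
    have "sum (\<lambda>e. - y e) ?B = - G (?A \<union> ?B) - - G ?A" using y unfolding base_def by blast
    then show ?thesis using seg(1) unfolding seg_sum[OF \<pi>] by (simp add: sum_negf)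
  qed
  define d where "d = (\<lambda>k. \<bar>vertex \<pi> \<kappa> k - z (\<pi> k)\<bar>)"
  have dk: "d k \<le> (1 - a * b) * (\<kappa> * (incF \<pi> k + x (\<pi> k)) + (incG \<pi> k + y (\<pi> k)))"
    if k: "k \<in> {l..<r}" for k
  proof -
    have kn: "k < n" "\<pi> k \<in> ?B" using k \<pi> by auto
    note X = base_F_bounds[OF x seg(3,2) kn(2)] incF_bounds[OF \<pi>(1) kn(1)]
    note Y = base_G_bounds[OF y seg(3,2) kn(2)] incG_bounds[OF \<pi>(1) kn(1)]
    have "a * b \<le> a" "a * b \<le> b" using ab by (auto simp: mult_le_cancel_left1 mult_le_cancel_right1)
    then have ab': "a * b * incF \<pi> k \<le> a * F {\<pi> k}" "a * b * x (\<pi> k) \<le> a * F {\<pi> k}"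
      "a * b * incG \<pi> k \<le> b * gain (\<pi> k)" "a * b * y (\<pi> k) \<le> b * gain (\<pi> k)"
    proof -
      have h: "a * b * u \<le> a * v" "a * b * u \<le> b * v" if "0 < u" "u \<le> v" for u v
        using mult_right_mono[OF \<open>a * b \<le> a\<close>, of u] mult_right_mono[OF \<open>a * b \<le> b\<close>, of u]
          mult_left_mono[OF that(2), of a] mult_left_mono[OF that(2), of b] that(1) ab by linarith+
      show "a * b * incF \<pi> k \<le> a * F {\<pi> k}" "a * b * x (\<pi> k) \<le> a * F {\<pi> k}"
        "a * b * incG \<pi> k \<le> b * gain (\<pi> k)" "a * b * y (\<pi> k) \<le> b * gain (\<pi> k)"
        using h X Y by blast+
    qed
    have "\<bar>incF \<pi> k - x (\<pi> k)\<bar> \<le> (1 - a * b) * (incF \<pi> k + x (\<pi> k))"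
      using X ab' theta by (auto simp: algebra_simps abs_le_iff)
    then have 1: "\<kappa> * \<bar>incF \<pi> k - x (\<pi> k)\<bar> \<le> \<kappa> * ((1 - a * b) * (incF \<pi> k + x (\<pi> k)))"
      using \<kappa> by (rule mult_left_mono)
    have 2: "\<bar>incG \<pi> k - y (\<pi> k)\<bar> \<le> (1 - a * b) * (incG \<pi> k + y (\<pi> k))"
      using Y ab' theta by (auto simp: algebra_simps abs_le_iff)
    have "vertex \<pi> \<kappa> k - z (\<pi> k) = \<kappa> * (incF \<pi> k - x (\<pi> k)) - (incG \<pi> k - y (\<pi> k))"
      using z[OF kn(2)] by (simp add: vertex_def algebra_simps)
    then have "d k \<le> \<bar>\<kappa> * (incF \<pi> k - x (\<pi> k))\<bar> + \<bar>incG \<pi> k - y (\<pi> k)\<bar>" unfolding d_def by linarith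
    also have "\<dots> \<le> (1 - a * b) * (\<kappa> * (incF \<pi> k + x (\<pi> k)) + (incG \<pi> k + y (\<pi> k)))"
    proof -
      have "\<bar>\<kappa> * (incF \<pi> k - x (\<pi> k))\<bar> = \<kappa> * \<bar>incF \<pi> k - x (\<pi> k)\<bar>" using \<kappa> by (simp add: abs_mult)
      moreover have "(1 - a * b) * (\<kappa> * (incF \<pi> k + x (\<pi> k)) + (incG \<pi> k + y (\<pi> k)))
        = \<kappa> * ((1 - a * b) * (incF \<pi> k + x (\<pi> k))) + (1 - a * b) * (incG \<pi> k + y (\<pi> k))"
        by (simp add: algebra_simps)
      ultimately show ?thesis using 1 2 by linarith
    qed
    finally show ?thesis .
  qed
  have "(\<Sum>k=l..<r. d k) \<le> (\<Sum>k=l..<r. (1 - a * b) * (\<kappa> * (incF \<pi> k + x (\<pi> k)) + (incG \<pi> k + y (\<pi> k))))"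
    using dk by (rule sum_mono)
  also have "\<dots> = (1 - a * b) * (\<kappa> * ((\<Sum>k=l..<r. incF \<pi> k) + (\<Sum>k=l..<r. x (\<pi> k)))
      + ((\<Sum>k=l..<r. incG \<pi> k) + (\<Sum>k=l..<r. y (\<pi> k))))"
    by (simp add: sum_distrib_left sum.distrib distrib_left)
  also have "\<dots> = spread ?A ?B \<kappa>"
    unfolding sx sy inc_telescope[OF \<pi>(2)] spread_def seg(1) by (simp add: algebra_simps)
  finally have sd: "(\<Sum>k=l..<r. d k) \<le> spread ?A ?B \<kappa>" .
  have d0: "0 \<le> d k" for k by (simp add: d_def)
  then show "0 \<le> spread ?A ?B \<kappa>" using sd sum_nonneg[of "{l..<r}" d] by force
  \<comment> \<open>The Euclidean norm is at most the l1 norm.\<close>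
  have "(\<Sum>k=l..<r. (vertex \<pi> \<kappa> k - z (\<pi> k))\<^sup>2) = (\<Sum>k=l..<r. d k * d k)"
    by (simp add: d_def power2_eq_square)
  also have "\<dots> \<le> (\<Sum>k=l..<r. d k * (\<Sum>k=l..<r. d k))"
    using d0 by (intro sum_mono mult_left_mono member_le_sum) auto
  also have "\<dots> = (\<Sum>k=l..<r. d k)\<^sup>2" by (simp add: sum_distrib_right power2_eq_square)
  also have "\<dots> \<le> (spread ?A ?B \<kappa>)\<^sup>2" using sd d0 by (intro power_mono sum_nonneg) auto
  finally show "(\<Sum>k=l..<r. (vertex \<pi> \<kappa> k - z (\<pi> k))\<^sup>2) \<le> (spread ?A ?B \<kappa>)\<^sup>2" .
qed

lemma M2: "2 \<le> M" using n by simp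

lemma M_power: "2 ^ k \<le> M ^ k" using M2 by (intro power_mono) auto

lemma power_cancel: "m \<noteq> 0 \<Longrightarrow> m ^ i * c / m ^ (i + j) = c / (m::real) ^ j"
  by (simp add: power_add)

lemma power_cancel_Suc: "m \<noteq> 0 \<Longrightarrow> j = Suc i \<Longrightarrow> c * m * (d / m ^ j) = c * d / (m::real) ^ i"
  by simp

text \<open>34 = 2 * 17: each coordinate is at most spread / M^17. Summation and the factor n of
  \<open>flat\<close> use up M^2, and the remaining M^15 is at least 2^15 = 8 * 4096, which leaves
  1/8 of the spread.\<close>

lemma flat_of_small:
  assumes \<pi>: "ordering \<pi>" "l \<le> r" "r \<le> n" and it: "iterate (pre \<pi> l) (\<pi> ` {l..<r}) \<kappa> z" and \<kappa>: "0 \<le> \<kappa>"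
    and small: "(\<Sum>k=l..<r. (z (\<pi> k))\<^sup>2) \<le> (spread (pre \<pi> l) (\<pi> ` {l..<r}) \<kappa>)\<^sup>2 / M ^ 34"
  shows "flat (pre \<pi> l) (\<pi> ` {l..<r}) \<kappa>"
proof -
  let ?A = "pre \<pi> l" and ?B = "\<pi> ` {l..<r}"
  note seg = seg_facts[OF \<pi>]
  obtain x y where x: "base F ?A ?B x" and y: "cobase G ?A ?B y" and z: "\<And>e. e \<in> ?B \<Longrightarrow> z e = \<kappa> * x e - y e"
    using it unfolding iterate_def by blast
  define f g s \<Delta> \<zeta> where fg: "f = \<kappa> * (F (?A \<union> ?B) - F ?A)" "g = G (?A \<union> ?B) - G ?A" "s = f + g"
    "\<Delta> = spread ?A ?B \<kappa>" "\<zeta> = (\<Sum>k=l..<r. \<bar>z (\<pi> k)\<bar>)"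
  have \<Delta>: "\<Delta> = 2 * (1 - a * b) * s" "0 \<le> \<Delta>"
    using spread_bound(2)[OF \<pi> it \<kappa>] by (auto simp: fg spread_def)
  have fg0: "0 \<le> f" "0 \<le> g"
  proof -
    have "0 \<le> F (?A \<union> ?B) - F ?A \<and> 0 \<le> g"
    proof (cases "l = r")
      case False
      then show ?thesis using mass_pos[OF \<pi>(1) _ \<pi>(3), of l] \<pi>(2) unfolding fg seg(1) by simp
    qed (simp add: fg)
    then show "0 \<le> f" "0 \<le> g" using \<kappa> by (auto simp: fg)
  qed
  have zk: "\<bar>z (\<pi> k)\<bar> \<le> \<Delta> / M ^ 17" if "k \<in> {l..<r}" for k
  proof (rule power2_le_imp_le)
    have "(z (\<pi> k))\<^sup>2 \<le> (\<Sum>k=l..<r. (z (\<pi> k))\<^sup>2)" using that by (intro member_le_sum) auto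
    also have "\<dots> \<le> \<Delta>\<^sup>2 / M ^ 34" using small by (simp add: fg)
    also have "\<dots> = (\<Delta> / M ^ 17)\<^sup>2" by (simp add: power_divide flip: power_mult)
    finally show "\<bar>z (\<pi> k)\<bar>\<^sup>2 \<le> (\<Delta> / M ^ 17)\<^sup>2" by simp
  qed (use \<Delta> in auto)
  have "\<zeta> \<le> (\<Sum>k=l..<r. \<Delta> / M ^ 17)" unfolding fg using zk by (intro sum_mono) (auto simp: fg)
  also have "\<dots> = real (r - l) * (\<Delta> / M ^ 17)" by simp
  also have "\<dots> \<le> M * (\<Delta> / M ^ 17)" using \<pi> \<Delta>(2) by (intro mult_right_mono) auto
  also have "\<dots> = \<Delta> / M ^ 16"
    using M2 power_add[of M 1 16] by simp
  finally have \<zeta>: "\<zeta> \<le> \<Delta> / M ^ 16" .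
  have \<zeta>s: "\<zeta> \<le> s / 2"
  proof -
    have "(1 - a * b) * s \<le> 1 * s" using theta fg0 by (intro mult_right_mono) (auto simp: fg)
    then have "\<Delta> \<le> 2 * s" using \<Delta>(1) by linarith
    moreover have "\<Delta> / M ^ 16 \<le> \<Delta> / 2 ^ 16" using M_power[of 16] \<Delta>(2) by (intro divide_left_mono) auto
    moreover have "\<Delta> / 2 ^ 16 \<le> \<Delta> / 4" using \<Delta>(2) by simp
    ultimately show ?thesis using \<zeta> by linarith
  qed
  have "4096 * real n * \<zeta> \<le> 4096 * M * (\<Delta> / M ^ 16)"
    using \<zeta> M2 by (intro mult_mono) (auto simp: fg intro: sum_nonneg)
  also have "4096 * M * (\<Delta> / M ^ 16) = 4096 * \<Delta> / M ^ 15" using M2 by (intro power_cancel_Suc) auto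
  also have "\<dots> \<le> 4096 * \<Delta> / 2 ^ 15" using M_power[of 15] \<Delta>(2) by (intro divide_left_mono) auto
  also have "\<dots> = (1 - a * b) * (s / 4)" unfolding \<Delta>(1) by simp
  finally have main: "4096 * real n * \<zeta> \<le> (1 - a * b) * (s / 4)" .
  \<comment> \<open>Masses with sum s that differ by at most s / 2 are both at least s / 4.\<close>
  have "\<bar>f - g\<bar> \<le> \<zeta>"
  proof -
    have "sum x ?B = F (?A \<union> ?B) - F ?A" "sum (\<lambda>e. - y e) ?B = - G (?A \<union> ?B) - - G ?A"
      using x y unfolding base_def by blast+
    then have "f - g = (\<Sum>e\<in>?B. \<kappa> * x e - y e)"
      by (simp add: fg sum_subtractf sum_negf sum_distrib_left[symmetric])
    also have "\<dots> = (\<Sum>k=l..<r. z (\<pi> k))" using z by (simp add: seg_sum[OF \<pi>])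
    also have "\<bar>\<dots>\<bar> \<le> \<zeta>" unfolding fg by (rule sum_abs)
    finally show ?thesis .
  qed
  then have "s / 4 \<le> f" "s / 4 \<le> g" using \<zeta>s by (auto simp: fg)
  moreover have "(1 - a * b) * u \<le> (1 - a * b) * v" if "u \<le> v" for u v
    using theta that by (intro mult_left_mono) auto
  ultimately have "(1 - a * b) * (s / 4) \<le> (1 - a * b) * f" "(1 - a * b) * (s / 4) \<le> (1 - a * b) * g"
    by blast+
  moreover have "(\<Sum>e\<in>?B. \<bar>\<kappa> * x e - y e\<bar>) = \<zeta>" using z by (simp add: seg_sum[OF \<pi>] fg)
  ultimately show ?thesis unfolding flat_def using x y main fg by (intro exI[of _ x] exI[of _ y]) auto
qed

text \<open>The slack of z in the base inequality of the k-th prefix. From one prefix to the next it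
  changes by the greedy vertex minus z, which makes it the \<tau> of
  \<open>no_cut_bound\<close>.\<close>

definition defect :: "(nat \<Rightarrow> nat) \<Rightarrow> nat \<Rightarrow> real \<Rightarrow> (nat \<Rightarrow> real) \<Rightarrow> nat \<Rightarrow> real" where
  "defect \<pi> l \<kappa> z k = pot \<kappa> (pre \<pi> k) - pot \<kappa> (pre \<pi> l) - (\<Sum>i=l..<k. z (\<pi> i))"

text \<open>The criterion of \<open>cut_left\<close> fails at \<open>Suc k\<close> and that of
  \<open>cut_right\<close> at k.\<close>

definition no_cut :: "(nat \<Rightarrow> nat) \<Rightarrow> nat \<Rightarrow> nat \<Rightarrow> real \<Rightarrow> (nat \<Rightarrow> real) \<Rightarrow> bool" where
  "no_cut \<pi> l r \<kappa> z \<longleftrightarrow>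
     (\<forall>k. l \<le> k \<and> k < r \<longrightarrow> - defect \<pi> l \<kappa> z (Suc k) \<le> z (\<pi> k) \<and> z (\<pi> k) \<le> defect \<pi> l \<kappa> z k)"

definition sorted_seg :: "(nat \<Rightarrow> nat) \<Rightarrow> nat \<Rightarrow> nat \<Rightarrow> (nat \<Rightarrow> real) \<Rightarrow> bool" where
  "sorted_seg \<pi> l r z \<longleftrightarrow> (\<forall>i j. l \<le> i \<and> i \<le> j \<and> j < r \<longrightarrow> z (\<pi> i) \<le> z (\<pi> j))"

lemma iterate_base:
  assumes "iterate A B \<kappa> z" "0 \<le> \<kappa>"
  shows "base (pot \<kappa>) A B z"
proof -
  obtain x y where x: "base F A B x" and y: "cobase G A B y" and z: "\<And>e. e \<in> B \<Longrightarrow> z e = \<kappa> * x e - y e"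
    using assms(1) unfolding iterate_def by blast
  have "base (\<lambda>X. \<kappa> * F X - G X) A B (\<lambda>e. \<kappa> * x e - y e)"
    by (rule base_combination[OF x y assms(2)])
  moreover have "pot \<kappa> = (\<lambda>X. \<kappa> * F X - G X)" by (simp add: pot_def fun_eq_iff)
  ultimately show ?thesis using base_cong[of B z "\<lambda>e. \<kappa> * x e - y e"] z by simp
qed

lemma defect_facts:
  assumes \<pi>: "ordering \<pi>" "l \<le> r" "r \<le> n" and it: "iterate (pre \<pi> l) (\<pi> ` {l..<r}) \<kappa> z" and \<kappa>: "0 \<le> \<kappa>"
  shows "defect \<pi> l \<kappa> z l = 0" "defect \<pi> l \<kappa> z r = 0" "l \<le> k \<Longrightarrow> k \<le> r \<Longrightarrow> 0 \<le> defect \<pi> l \<kappa> z k"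
    "l \<le> k \<Longrightarrow> defect \<pi> l \<kappa> z (Suc k) - defect \<pi> l \<kappa> z k = vertex \<pi> \<kappa> k - z (\<pi> k)"
proof -
  note b = iterate_base[OF it \<kappa>]
  show "defect \<pi> l \<kappa> z l = 0" by (simp add: defect_def)
  show "defect \<pi> l \<kappa> z r = 0"
    using b seg_facts(1)[OF \<pi>] unfolding base_def seg_sum[OF \<pi>] by (simp add: defect_def)
  show "0 \<le> defect \<pi> l \<kappa> z k" if "l \<le> k" "k \<le> r"
  proof -
    have kn: "k \<le> n" using that \<pi> by simp
    have "sum z (\<pi> ` {l..<k}) \<le> pot \<kappa> (pre \<pi> l \<union> \<pi> ` {l..<k}) - pot \<kappa> (pre \<pi> l)"
    proof -
      have "\<pi> ` {l..<k} \<subseteq> \<pi> ` {l..<r}" using that by auto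
      then show ?thesis using b unfolding base_def by blast
    qed
    then show ?thesis unfolding seg_sum[OF \<pi>(1) that(1) kn] seg_facts(1)[OF \<pi>(1) that(1) kn]
      by (simp add: defect_def)
  qed
  show "defect \<pi> l \<kappa> z (Suc k) - defect \<pi> l \<kappa> z k = vertex \<pi> \<kappa> k - z (\<pi> k)" if "l \<le> k"
    using that by (simp add: defect_def pot_def vertex_def incF_def incG_def algebra_simps)
qed

text \<open>Two factors M come from \<open>no_cut_bound\<close> and one from the number of
  coordinates.\<close>

lemma no_cut_gap:
  assumes \<pi>: "ordering \<pi>" "l \<le> r" "r \<le> n" and it: "iterate (pre \<pi> l) (\<pi> ` {l..<r}) \<kappa> z" and \<kappa>: "0 \<le> \<kappa>"
    and so: "sorted_seg \<pi> l r z" and nc: "no_cut \<pi> l r \<kappa> z"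
  shows "(\<Sum>k=l..<r. (z (\<pi> k))\<^sup>2) \<le> M ^ 3 * (\<Sum>k=l..<r. z (\<pi> k) * (z (\<pi> k) - vertex \<pi> \<kappa> k))"
proof (cases "l = r")
  case False
  note d = defect_facts[OF \<pi> it \<kappa>]
  let ?\<tau> = "defect \<pi> l \<kappa> z" and ?z = "\<lambda>k. z (\<pi> k)"
  let ?gap = "\<Sum>k=l..<r. ?z k * (?\<tau> k - ?\<tau> (Suc k))"
  have gap: "?gap = (\<Sum>k=l..<r. z (\<pi> k) * (z (\<pi> k) - vertex \<pi> \<kappa> k))"
  proof (rule sum.cong[OF refl])
    fix k assume "k \<in> {l..<r}"
    then have "?\<tau> k - ?\<tau> (Suc k) = z (\<pi> k) - vertex \<pi> \<kappa> k" using d(4)[of k] by simp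
    then show "?z k * (?\<tau> k - ?\<tau> (Suc k)) = z (\<pi> k) * (z (\<pi> k) - vertex \<pi> \<kappa> k)" by simp
  qed
  have step: "?z k \<le> ?z (Suc k)" if "l \<le> k" "Suc k < r" for k
    using so that unfolding sorted_seg_def by auto
  have sq: "(?z i)\<^sup>2 \<le> (real n)\<^sup>2 * ?gap" if "i \<in> {l..<r}" for i
    by (rule no_cut_bound[where \<tau> = ?\<tau> and z = ?z, OF d(1,2) d(3) step]) (use nc that \<pi> in \<open>auto simp: no_cut_def\<close>)
  have g0: "0 \<le> ?gap" by (rule gap_nonneg[where \<tau> = ?\<tau> and z = ?z, OF d(1,2) d(3) step]) (use False \<pi> in auto)
  have "(\<Sum>k=l..<r. (?z k)\<^sup>2) \<le> (\<Sum>k=l..<r. (real n)\<^sup>2 * ?gap)" using sq by (rule sum_mono)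
  also have "\<dots> = real (r - l) * ((real n)\<^sup>2 * ?gap)" by simp
  also have "\<dots> \<le> M * (M\<^sup>2 * ?gap)"
    using \<pi> g0 by (intro mult_mono power_mono) auto
  also have "\<dots> = M ^ 3 * ?gap" by (simp add: power3_eq_cube power2_eq_square)
  finally show ?thesis unfolding gap .
qed simp

text \<open>The first claim follows from E^2 \<le> m^6 gap^2 \<le> m^6 E S. For the second, a step
  of length m^-37 changes the squared norm by -2 m^-37 gap + m^-74 S. The linear term gains at least
  2 E / m^40, and E / m^40 exceeds \<Delta>^2 / m^74 as long as E exceeds \<Delta>^2 / m^34; one
  copy cancels the quadratic term and the other is the progress. Hence 37 = 34 + 3.\<close>

lemma frank_wolfe_step:
  fixes E gap S \<Delta> m :: real
  assumes m: "1 \<le> m" and E: "0 \<le> E" "E \<le> m ^ 3 * gap" and S: "S \<le> \<Delta>\<^sup>2" "gap\<^sup>2 \<le> E * S"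
  shows "E \<le> m ^ 6 * \<Delta>\<^sup>2"
    "\<Delta>\<^sup>2 / m ^ 34 < E \<Longrightarrow> E - 2 * (1 / m ^ 37) * gap + (1 / m ^ 37)\<^sup>2 * S \<le> E - \<Delta>\<^sup>2 / m ^ 74"
proof -
  have "E * E \<le> (m ^ 3 * gap) * (m ^ 3 * gap)" using E by (intro mult_mono) auto
  also have "\<dots> = m ^ 6 * gap\<^sup>2" by (simp add: power2_eq_square flip: power_add)
  also have "\<dots> \<le> m ^ 6 * (E * \<Delta>\<^sup>2)"
    using S E m by (intro mult_left_mono order_trans[OF S(2)]) auto
  finally have "E * E \<le> E * (m ^ 6 * \<Delta>\<^sup>2)" by (simp add: algebra_simps)
  then show "E \<le> m ^ 6 * \<Delta>\<^sup>2" using E(1) by (cases "E = 0") auto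
  assume big: "\<Delta>\<^sup>2 / m ^ 34 < E"
  have "E / m ^ 40 \<le> (1 / m ^ 37) * gap"
  proof -
    have "E / m ^ 40 \<le> (m ^ 3 * gap) / m ^ 40" using E m by (intro divide_right_mono) auto
    also have "\<dots> = (1 / m ^ 37) * gap" using m power_cancel[of m 3 gap 37] by simp
    finally show ?thesis .
  qed
  moreover have "(1 / m ^ 37)\<^sup>2 * S \<le> \<Delta>\<^sup>2 / m ^ 74"
    using S(1) m by (simp add: power_one_over divide_right_mono flip: power_mult)
  moreover have "\<Delta>\<^sup>2 / m ^ 74 \<le> E / m ^ 40"
  proof -
    have "(\<Delta>\<^sup>2 / m ^ 34) / m ^ 40 \<le> E / m ^ 40" using big m by (intro divide_right_mono) auto
    then show ?thesis by (simp flip: power_add)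
  qed
  ultimately show "E - 2 * (1 / m ^ 37) * gap + (1 / m ^ 37)\<^sup>2 * S \<le> E - \<Delta>\<^sup>2 / m ^ 74" by simp
qed

text \<open>Without cuts the squared norm is at most \<open>M\<^sup>6\<close> times the squared spread, and every step
  that starts from a block not yet known to be flat decreases it by the subtracted amount.\<close>

definition progress :: "(nat \<Rightarrow> nat) \<Rightarrow> nat \<Rightarrow> nat \<Rightarrow> real \<Rightarrow> (nat \<Rightarrow> real) \<Rightarrow> real \<Rightarrow> bool" where
  "progress \<pi> l r \<kappa> z t \<longleftrightarrow> flat (pre \<pi> l) (\<pi> ` {l..<r}) \<kappa> \<or>
     (\<Sum>e\<in>\<pi> ` {l..<r}. (z e)\<^sup>2) \<le> M ^ 6 * (spread (pre \<pi> l) (\<pi> ` {l..<r}) \<kappa>)\<^sup>2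
       - (t - 1) * ((spread (pre \<pi> l) (\<pi> ` {l..<r}) \<kappa>)\<^sup>2 / M ^ 74)"

context
  fixes \<pi> l r \<kappa> z
  assumes \<pi>: "ordering \<pi>" "l \<le> r" "r \<le> n" and it: "iterate (pre \<pi> l) (\<pi> ` {l..<r}) \<kappa> z"
    and \<kappa>: "0 \<le> \<kappa>" and so: "sorted_seg \<pi> l r z" and nc: "no_cut \<pi> l r \<kappa> z"
begin

lemma progress_facts:
  defines "E \<equiv> \<Sum>k=l..<r. (z (\<pi> k))\<^sup>2" and "gap \<equiv> \<Sum>k=l..<r. z (\<pi> k) * (z (\<pi> k) - vertex \<pi> \<kappa> k)"
    and "S \<equiv> \<Sum>k=l..<r. (vertex \<pi> \<kappa> k - z (\<pi> k))\<^sup>2"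
  shows "1 \<le> M" "0 \<le> E" "E \<le> M ^ 3 * gap" "S \<le> (spread (pre \<pi> l) (\<pi> ` {l..<r}) \<kappa>)\<^sup>2" "gap\<^sup>2 \<le> E * S"
proof -
  show "1 \<le> M" by simp
  show "0 \<le> E" unfolding E_def by (intro sum_nonneg) auto
  show "E \<le> M ^ 3 * gap" unfolding E_def gap_def by (rule no_cut_gap[OF \<pi> it \<kappa> so nc])
  show "S \<le> (spread (pre \<pi> l) (\<pi> ` {l..<r}) \<kappa>)\<^sup>2" unfolding S_def by (rule spread_bound(1)[OF \<pi> it \<kappa>])
  show "gap\<^sup>2 \<le> E * S"
    unfolding gap_def E_def S_def
    using Cauchy_Schwarz_ineq_sum[of "\<lambda>k. z (\<pi> k)" "\<lambda>k. z (\<pi> k) - vertex \<pi> \<kappa> k" "{l..<r}"]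
    by (simp add: power2_commute)
qed

text \<open>Any iterate without cuts is bounded by the spread, so every restart begins with the same
  budget.\<close>

lemma progress_init: "progress \<pi> l r \<kappa> z 1"
  using frank_wolfe_step(1)[OF progress_facts] by (simp add: progress_def seg_sum[OF \<pi>])

lemma progress_step:
  assumes p: "progress \<pi> l r \<kappa> z t"
    and z': "\<And>k. l \<le> k \<Longrightarrow> k < r \<Longrightarrow> z' (\<pi> k) = z (\<pi> k) + 1 / M ^ 37 * (vertex \<pi> \<kappa> k - z (\<pi> k))"
  shows "progress \<pi> l r \<kappa> z' (t + 1)"
proof (cases "flat (pre \<pi> l) (\<pi> ` {l..<r}) \<kappa>")
  case False
  let ?\<Delta> = "spread (pre \<pi> l) (\<pi> ` {l..<r}) \<kappa>" and ?E = "\<Sum>k=l..<r. (z (\<pi> k))\<^sup>2"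
  have big: "?\<Delta>\<^sup>2 / M ^ 34 < ?E" using False flat_of_small[OF \<pi> it \<kappa>] by linarith
  let ?gap = "\<Sum>k=l..<r. z (\<pi> k) * (z (\<pi> k) - vertex \<pi> \<kappa> k)"
  let ?S = "\<Sum>k=l..<r. (vertex \<pi> \<kappa> k - z (\<pi> k))\<^sup>2" and ?t = "1 / M ^ 37"
  have "(\<Sum>k=l..<r. (z' (\<pi> k))\<^sup>2) = (\<Sum>k=l..<r. (z (\<pi> k))\<^sup>2 - 2 * ?t * (z (\<pi> k) * (z (\<pi> k) - vertex \<pi> \<kappa> k))
      + ?t\<^sup>2 * (vertex \<pi> \<kappa> k - z (\<pi> k))\<^sup>2)"
  proof (rule sum.cong[OF refl])
    fix k assume "k \<in> {l..<r}"
    then have *: "z' (\<pi> k) = z (\<pi> k) + ?t * (vertex \<pi> \<kappa> k - z (\<pi> k))" using z' by simp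
    define c where "c = ?t"
    show "(z' (\<pi> k))\<^sup>2 = (z (\<pi> k))\<^sup>2 - 2 * ?t * (z (\<pi> k) * (z (\<pi> k) - vertex \<pi> \<kappa> k))
      + ?t\<^sup>2 * (vertex \<pi> \<kappa> k - z (\<pi> k))\<^sup>2"
      unfolding * c_def[symmetric] by (simp add: power2_eq_square algebra_simps)
  qed
  also have "\<dots> = ?E - 2 * ?t * ?gap + ?t\<^sup>2 * ?S"
    by (simp only: sum.distrib sum_subtractf sum_distrib_left)
  also have "\<dots> \<le> ?E - ?\<Delta>\<^sup>2 / M ^ 74" by (rule frank_wolfe_step(2)[OF progress_facts big])
  finally have "(\<Sum>k=l..<r. (z' (\<pi> k))\<^sup>2) \<le> ?E - ?\<Delta>\<^sup>2 / M ^ 74" .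
  moreover have "?E \<le> M ^ 6 * ?\<Delta>\<^sup>2 - (t - 1) * (?\<Delta>\<^sup>2 / M ^ 74)"
    using p False by (simp add: progress_def seg_sum[OF \<pi>])
  moreover have "E' \<le> E - c \<Longrightarrow> E \<le> K - (t - 1) * c \<Longrightarrow> E' \<le> K - (t + 1 - 1) * c" for E' E K c
    by (simp add: algebra_simps)
  ultimately show ?thesis unfolding progress_def seg_sum[OF \<pi>] by blast
qed (simp add: progress_def)

end

text \<open>M^81 steps of size \<Delta>^2 / M^74 subtract about M^7 \<Delta>^2, more than the
  initial M^6 \<Delta>^2 allows.\<close>

lemma progress_final:
  assumes \<pi>: "ordering \<pi>" "l \<le> r" "r \<le> n" and it: "iterate (pre \<pi> l) (\<pi> ` {l..<r}) \<kappa> z" and \<kappa>: "0 \<le> \<kappa>"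
    and p: "progress \<pi> l r \<kappa> z t" and t: "M ^ 81 \<le> t"
  shows "flat (pre \<pi> l) (\<pi> ` {l..<r}) \<kappa>"
proof (rule ccontr)
  assume nf: "\<not> ?thesis"
  let ?\<Delta> = "spread (pre \<pi> l) (\<pi> ` {l..<r}) \<kappa>" and ?E = "\<Sum>k=l..<r. (z (\<pi> k))\<^sup>2"
  have E: "?E \<le> M ^ 6 * ?\<Delta>\<^sup>2 - (t - 1) * (?\<Delta>\<^sup>2 / M ^ 74)"
    using p nf by (simp add: progress_def seg_sum[OF \<pi>])
  have "(M ^ 81 - 1) * (?\<Delta>\<^sup>2 / M ^ 74) \<le> (t - 1) * (?\<Delta>\<^sup>2 / M ^ 74)"
    using t M2 by (intro mult_right_mono) auto
  moreover have "M ^ 81 * (?\<Delta>\<^sup>2 / M ^ 74) = M ^ 7 * ?\<Delta>\<^sup>2"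
  proof -
    have "M ^ 81 = M ^ 7 * M ^ 74" by (simp flip: power_add)
    moreover have "M ^ 74 \<noteq> 0" using M2 by simp
    ultimately show ?thesis
      by (metis mult.assoc nonzero_mult_div_cancel_left times_divide_eq_right)
  qed
  moreover have "?\<Delta>\<^sup>2 / M ^ 74 \<le> ?\<Delta>\<^sup>2"
    using M2 one_le_power[of M 74] by (simp add: divide_le_eq mult_le_cancel_left1)
  moreover have "(X - 1) * c \<le> T \<Longrightarrow> X * c = K \<Longrightarrow> c \<le> D \<Longrightarrow> K - D \<le> T" for X c T K D :: real
    by (simp add: algebra_simps)
  ultimately have "M ^ 7 * ?\<Delta>\<^sup>2 - ?\<Delta>\<^sup>2 \<le> (t - 1) * (?\<Delta>\<^sup>2 / M ^ 74)" by blast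
  then have "?E \<le> M ^ 6 * ?\<Delta>\<^sup>2 - M ^ 7 * ?\<Delta>\<^sup>2 + ?\<Delta>\<^sup>2" using E by linarith
  also have "\<dots> = - ((M ^ 6 * (M - 1) - 1) * ?\<Delta>\<^sup>2)" by (simp add: algebra_simps eval_nat_numeral)
  also have "\<dots> \<le> 0"
  proof -
    have "1 * 1 \<le> M ^ 6 * (M - 1)" using M2 one_le_power[of M 6] by (intro mult_mono) auto
    then show ?thesis by simp
  qed
  also have "0 \<le> ?\<Delta>\<^sup>2 / M ^ 34" by simp
  finally show False using nf flat_of_small[OF \<pi> it \<kappa>] by blast
qed

text \<open>Strictness makes the decomposition terminate: at the density of a segment its two ends
  have equal potential, so no cut can reach the opposite end.\<close>

definition strict_lower :: "nat set \<Rightarrow> nat set \<Rightarrow> real \<Rightarrow> bool" where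
  "strict_lower A B \<kappa> \<longleftrightarrow> (\<forall>D. A \<subseteq> D \<and> D \<subseteq> B \<and> D \<noteq> B \<longrightarrow> pot \<kappa> B < pot \<kappa> D)"

definition strict_upper :: "nat set \<Rightarrow> nat set \<Rightarrow> real \<Rightarrow> bool" where
  "strict_upper A B \<kappa> \<longleftrightarrow> (\<forall>D. A \<subseteq> D \<and> D \<subseteq> B \<and> D \<noteq> A \<longrightarrow> pot \<kappa> A < pot \<kappa> D)"

lemma strict_density:
  "strict_lower A B \<kappa> \<Longrightarrow> lower_density A B \<kappa>" "strict_upper A B \<kappa> \<Longrightarrow> upper_density A B \<kappa>"
  unfolding strict_lower_def lower_density_def strict_upper_def upper_density_def pot_def
  by (metis less_imp_le order_refl)+

lemma pot_submodular:
  assumes "0 \<le> \<kappa>" "A \<subseteq> {..<n}" "B \<subseteq> {..<n}"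
  shows "pot \<kappa> (A \<union> B) + pot \<kappa> (A \<inter> B) \<le> pot \<kappa> A + pot \<kappa> B"
  using submodular_on_combination[OF subF supG assms(1)] assms(2,3)
  unfolding submodular_on_def pot_def by blast

text \<open>Uncrossing: submodularity replaces D by its union with B, compared with C, and its
  intersection with B, compared with B. At least one of the two comparisons is strict. Successive
  cuts therefore accumulate.\<close>

lemma strict_lower_trans:
  assumes \<kappa>: "0 \<le> \<kappa>" and s: "A \<subseteq> B" "B \<subseteq> C" "C \<subseteq> {..<n}"
    and "strict_lower A B \<kappa>" "strict_lower B C \<kappa>"
  shows "strict_lower A C \<kappa>"
  unfolding strict_lower_def
proof (intro allI impI)
  fix D assume D: "A \<subseteq> D \<and> D \<subseteq> C \<and> D \<noteq> C"
  have "pot \<kappa> (D \<union> B) + pot \<kappa> (D \<inter> B) \<le> pot \<kappa> D + pot \<kappa> B"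
    using \<kappa> D s by (intro pot_submodular) auto
  moreover have "D \<union> B \<noteq> C \<Longrightarrow> pot \<kappa> C < pot \<kappa> (D \<union> B)" "D \<inter> B \<noteq> B \<Longrightarrow> pot \<kappa> B < pot \<kappa> (D \<inter> B)"
    using assms(5,6) D s unfolding strict_lower_def by auto
  moreover have "D \<union> B \<noteq> C \<or> D \<inter> B \<noteq> B" using D by blast
  ultimately show "pot \<kappa> C < pot \<kappa> D" by (cases "D \<union> B = C"; cases "D \<inter> B = B") auto
qed

lemma strict_upper_trans:
  assumes \<kappa>: "0 \<le> \<kappa>" and s: "A \<subseteq> B" "B \<subseteq> C" "C \<subseteq> {..<n}"
    and "strict_upper A B \<kappa>" "strict_upper B C \<kappa>"
  shows "strict_upper A C \<kappa>"
  unfolding strict_upper_def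
proof (intro allI impI)
  fix D assume D: "A \<subseteq> D \<and> D \<subseteq> C \<and> D \<noteq> A"
  have "pot \<kappa> (D \<union> B) + pot \<kappa> (D \<inter> B) \<le> pot \<kappa> D + pot \<kappa> B"
    using \<kappa> D s by (intro pot_submodular) auto
  moreover have "D \<union> B \<noteq> B \<Longrightarrow> pot \<kappa> B < pot \<kappa> (D \<union> B)" "D \<inter> B \<noteq> A \<Longrightarrow> pot \<kappa> A < pot \<kappa> (D \<inter> B)"
    using assms(5,6) D s unfolding strict_upper_def by auto
  moreover have "D \<union> B \<noteq> B \<or> D \<inter> B \<noteq> A" using D by blast
  ultimately show "pot \<kappa> A < pot \<kappa> D" by (cases "D \<union> B = B"; cases "D \<inter> B = A") auto
qed

text \<open>By sorting, all coordinates before position k lie below minus the defect, which is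
  nonpositive. If D lacks R from the prefix, z bounds the potential of D below by that of the prefix
  minus the defect minus z(R), and a single element of R already outweighs the defect.\<close>

lemma cut_left:
  assumes \<pi>: "ordering \<pi>" "l \<le> r" "r \<le> n" and it: "iterate (pre \<pi> l) (\<pi> ` {l..<r}) \<kappa> z" and \<kappa>: "0 \<le> \<kappa>"
    and so: "sorted_seg \<pi> l r z" and k: "l < k" "k \<le> r" and cut: "z (\<pi> (k - 1)) + defect \<pi> l \<kappa> z k < 0"
  shows "strict_lower (pre \<pi> l) (pre \<pi> k) \<kappa>"
  unfolding strict_lower_def
proof (intro allI impI)
  fix D assume D: "pre \<pi> l \<subseteq> D \<and> D \<subseteq> pre \<pi> k \<and> D \<noteq> pre \<pi> k"
  have kn: "l \<le> k" "k \<le> n" using k \<pi> by auto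
  let ?B = "\<pi> ` {l..<k}"
  note s = seg_facts[OF \<pi>(1) kn]
  have neg: "z e < - defect \<pi> l \<kappa> z k" if "e \<in> ?B" for e
  proof -
    obtain i where "e = \<pi> i" "l \<le> i" "i \<le> k - 1" "k - 1 < r" using \<open>e \<in> ?B\<close> k by auto
    then show ?thesis using so cut unfolding sorted_seg_def by fastforce
  qed
  have d0: "0 \<le> defect \<pi> l \<kappa> z k" using defect_facts(3)[OF \<pi> it \<kappa>] k by simp
  define R where "R = pre \<pi> k - D"
  have R: "R \<subseteq> ?B" "R \<noteq> {}" "finite R" using D s(1) by (auto simp: R_def)
  then obtain e where e: "e \<in> R" by blast
  have "sum z (R - {e}) \<le> 0" using neg R d0 by (intro sum_nonpos) force
  then have zR: "sum z R < - defect \<pi> l \<kappa> z k"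
  proof -
    have "z e < - defect \<pi> l \<kappa> z k" using neg e R(1) by blast
    then show ?thesis using sum.remove[OF R(3) e, of z] \<open>sum z (R - {e}) \<le> 0\<close> by linarith
  qed
  have "sum z (?B - R) \<le> pot \<kappa> (pre \<pi> l \<union> (?B - R)) - pot \<kappa> (pre \<pi> l)"
  proof -
    have "?B - R \<subseteq> \<pi> ` {l..<r}" using k by auto
    then show ?thesis using iterate_base[OF it \<kappa>] unfolding base_def by blast
  qed
  moreover have "pre \<pi> l \<union> (?B - R) = D" using D s(1,2) by (auto simp: R_def)
  moreover have "sum z (?B - R) = sum z ?B - sum z R" using R by (simp add: sum_diff)
  ultimately show "pot \<kappa> (pre \<pi> k) < pot \<kappa> D"
    using zR seg_sum[OF \<pi>(1) kn, of z] by (simp add: defect_def)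
qed

text \<open>All coordinates from position k on exceed the nonnegative defect, so adding any of them
  raises the lower bound given by z by more than the slack of the prefix.\<close>

lemma cut_right:
  assumes \<pi>: "ordering \<pi>" "l \<le> r" "r \<le> n" and it: "iterate (pre \<pi> l) (\<pi> ` {l..<r}) \<kappa> z" and \<kappa>: "0 \<le> \<kappa>"
    and so: "sorted_seg \<pi> l r z" and k: "l \<le> k" "k < r" and cut: "defect \<pi> l \<kappa> z k < z (\<pi> k)"
  shows "strict_upper (pre \<pi> k) (pre \<pi> r) \<kappa>"
  unfolding strict_upper_def
proof (intro allI impI)
  fix D assume D: "pre \<pi> k \<subseteq> D \<and> D \<subseteq> pre \<pi> r \<and> D \<noteq> pre \<pi> k"
  have kn: "k \<le> n" "k \<le> r" using k \<pi> by auto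
  note s = seg_facts[OF \<pi>(1) k(1) kn(1)] and s' = seg_facts[OF \<pi>(1) kn(2) \<pi>(3)] and s'' = seg_facts[OF \<pi>]
  let ?B = "\<pi> ` {l..<k}"
  define R where "R = D - pre \<pi> k"
  have pos: "defect \<pi> l \<kappa> z k < z e" if "e \<in> \<pi> ` {k..<r}" for e
  proof -
    obtain i where "e = \<pi> i" "k \<le> i" "i < r" using \<open>e \<in> \<pi> ` {k..<r}\<close> by auto
    then show ?thesis using so cut k unfolding sorted_seg_def by fastforce
  qed
  have d0: "0 \<le> defect \<pi> l \<kappa> z k" using defect_facts(3)[OF \<pi> it \<kappa>] k by simp
  have R: "R \<subseteq> \<pi> ` {k..<r}" "R \<noteq> {}" using D s'(1) by (auto simp: R_def)
  then have finR: "finite R" using finite_subset by blast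
  obtain e where e: "e \<in> R" using R by blast
  have "0 \<le> sum z (R - {e})" using pos R d0 by (intro sum_nonneg) force
  then have zR: "defect \<pi> l \<kappa> z k < sum z R"
  proof -
    have "defect \<pi> l \<kappa> z k < z e" using pos e R(1) by blast
    then show ?thesis using sum.remove[OF finR e, of z] \<open>0 \<le> sum z (R - {e})\<close> by linarith
  qed
  have "\<pi> ` {k..<r} \<subseteq> \<pi> ` {l..<r}" "?B \<subseteq> \<pi> ` {l..<r}" using k by auto
  then have "?B \<union> R \<subseteq> \<pi> ` {l..<r}" using R(1) by (meson Un_least subset_trans)
  then have "sum z (?B \<union> R) \<le> pot \<kappa> (pre \<pi> l \<union> (?B \<union> R)) - pot \<kappa> (pre \<pi> l)"
    using iterate_base[OF it \<kappa>, unfolded base_def, THEN conjunct1] by blast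
  moreover have "pre \<pi> l \<union> (?B \<union> R) = D" using D s(1) by (auto simp: R_def)
  moreover have "sum z (?B \<union> R) = sum z ?B + sum z R"
    using finR s(1) by (intro sum.union_disjoint) (auto simp: R_def)
  ultimately show "pot \<kappa> (pre \<pi> k) < pot \<kappa> D"
    using zR seg_sum[OF \<pi>(1) k(1) kn(1), of z] by (simp add: defect_def)
qed

end

section \<open>Running programs\<close>

text \<open>A total-correctness Hoare triple with a time bound and a single initial state.\<close>

definition runs :: "(nat set \<Rightarrow> real) \<Rightarrow> (nat set \<Rightarrow> real) \<Rightarrow> nat \<Rightarrow> com \<Rightarrow> nat memory \<Rightarrow> real memory
    \<Rightarrow> (nat memory \<Rightarrow> real memory \<Rightarrow> bool) \<Rightarrow> nat \<Rightarrow> bool" where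
  "runs F G n c N R Q k \<longleftrightarrow> (\<exists>t N' R'. exec F G n c (N, R) t (N', R') \<and> t \<le> k \<and> Q N' R')"

text \<open>Loop-free code is executed symbolically: the simplifier computes its
  \<open>effect\<close>, and \<open>max_cost\<close> bounds its time by charging both branches of
  every conditional.\<close>

fun straight :: "com \<Rightarrow> bool" where
  "straight (Seq c d) \<longleftrightarrow> straight c \<and> straight d"
| "straight (Cond b c d) \<longleftrightarrow> straight c \<and> straight d"
| "straight (While b c) \<longleftrightarrow> False"
| "straight _ \<longleftrightarrow> True"

fun effect :: "(nat set \<Rightarrow> real) \<Rightarrow> (nat set \<Rightarrow> real) \<Rightarrow> nat \<Rightarrow> com \<Rightarrow> state \<Rightarrow> state" where
  "effect F G n (NAssign x es e) s = (store (fst s) x (map (nval (fst s)) es) (nval (fst s) e), snd s)"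
| "effect F G n (RAssign x es e) s = (fst s, store (snd s) x (map (nval (fst s)) es) (rval s e))"
| "effect F G n (QueryF x es A ds) s =
     (fst s, store (snd s) x (map (nval (fst s)) es) (F (row_set n (fst s) A (map (nval (fst s)) ds))))"
| "effect F G n (QueryG x es A ds) s =
     (fst s, store (snd s) x (map (nval (fst s)) es) (G (row_set n (fst s) A (map (nval (fst s)) ds))))"
| "effect F G n (Seq c d) s = effect F G n d (effect F G n c s)"
| "effect F G n (Cond b c d) s = (if bval s b then effect F G n c s else effect F G n d s)"
| "effect F G n _ s = s"

fun max_cost :: "com \<Rightarrow> nat" where
  "max_cost (NAssign x es e) = 1 + sum_list (map ncost es) + ncost e"
| "max_cost (RAssign x es e) = 1 + sum_list (map ncost es) + rcost e"
| "max_cost (QueryF x es A ds) = 1 + sum_list (map ncost es) + sum_list (map ncost ds)"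
| "max_cost (QueryG x es A ds) = 1 + sum_list (map ncost es) + sum_list (map ncost ds)"
| "max_cost (Seq c d) = 1 + max_cost c + max_cost d"
| "max_cost (Cond b c d) = 1 + bcost b + max_cost c + max_cost d"
| "max_cost _ = 1"

lemma exec_straight:
  "straight c \<Longrightarrow> \<exists>t\<le>max_cost c. exec F G n c s t (effect F G n c s)"
proof (induction c arbitrary: s)
  case Skip
  show ?case using exec_Skip[of F G n s] by auto
next
  case (NAssign x es e)
  show ?case using exec_NAssign[of F G n x es e "fst s" "snd s"] by auto
next
  case (RAssign x es e)
  show ?case using exec_RAssign[of F G n x es e "fst s" "snd s"] by auto
next
  case (QueryF x es A ds)
  show ?case using exec_QueryF[of F G n x es A ds "fst s" "snd s"] by auto
next
  case (QueryG x es A ds)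
  show ?case using exec_QueryG[of F G n x es A ds "fst s" "snd s"] by auto
next
  case (Seq c d)
  from Seq.IH(1)[of s] Seq.prems obtain t1 where 1: "t1 \<le> max_cost c" "exec F G n c s t1 (effect F G n c s)" by auto
  from Seq.IH(2)[of "effect F G n c s"] Seq.prems obtain t2 where
    2: "t2 \<le> max_cost d" "exec F G n d (effect F G n c s) t2 (effect F G n d (effect F G n c s))" by auto
  show ?case using exec_Seq[OF 1(2) 2(2)] 1(1) 2(1) by (intro exI[of _ "1 + t1 + t2"]) auto
next
  case (Cond b c d)
  show ?case
  proof (cases "bval s b")
    case True
    from Cond.IH(1)[of s] Cond.prems obtain t where "t \<le> max_cost c" "exec F G n c s t (effect F G n c s)" by auto
    then show ?thesis using exec_CondTrue[OF True] True by (intro exI[of _ "1 + bcost b + t"]) auto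
  next
    case False
    from Cond.IH(2)[of s] Cond.prems obtain t where "t \<le> max_cost d" "exec F G n d s t (effect F G n d s)" by auto
    then show ?thesis using exec_CondFalse[OF False] False by (intro exI[of _ "1 + bcost b + t"]) auto
  qed
qed simp

lemma runs_straight:
  assumes "straight c" "Q (fst (effect F G n c (N, R))) (snd (effect F G n c (N, R)))" "max_cost c \<le> k"
  shows "runs F G n c N R Q k"
proof -
  obtain t where t: "t \<le> max_cost c" "exec F G n c (N, R) t (effect F G n c (N, R))"
    using exec_straight[OF assms(1)] by blast
  then have "exec F G n c (N, R) t (fst (effect F G n c (N, R)), snd (effect F G n c (N, R)))" by simp
  then show ?thesis unfolding runs_def using assms(2,3) t(1) le_trans by blast
qed

lemma runs_mono:
  assumes "runs F G n c N R Q k" "\<And>N' R'. Q N' R' \<Longrightarrow> Q' N' R'" "k \<le> k'"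
  shows "runs F G n c N R Q' k'"
  using assms unfolding runs_def by (meson le_trans)

lemma runs_Seq:
  assumes "runs F G n c N R P k1" "\<And>N' R'. P N' R' \<Longrightarrow> runs F G n d N' R' Q k2" "1 + k1 + k2 \<le> k"
  shows "runs F G n (Seq c d) N R Q k"
proof -
  obtain t1 N1 R1 where 1: "exec F G n c (N, R) t1 (N1, R1)" "t1 \<le> k1" "P N1 R1"
    using assms(1) unfolding runs_def by blast
  obtain t2 N2 R2 where 2: "exec F G n d (N1, R1) t2 (N2, R2)" "t2 \<le> k2" "Q N2 R2"
    using assms(2)[OF 1(3)] unfolding runs_def by blast
  have "1 + t1 + t2 \<le> k" using 1 2 assms(3) by linarith
  then show ?thesis unfolding runs_def using exec_Seq[OF 1(1) 2(1)] 2(3) by blast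
qed

lemma runs_While_step:
  assumes "bval (N, R) b" "runs F G n c N R P k1" "\<And>N' R'. P N' R' \<Longrightarrow> runs F G n (While b c) N' R' Q k2"
    "1 + bcost b + k1 + k2 \<le> k"
  shows "runs F G n (While b c) N R Q k"
proof -
  obtain t1 N1 R1 where 1: "exec F G n c (N, R) t1 (N1, R1)" "t1 \<le> k1" "P N1 R1"
    using assms(2) unfolding runs_def by blast
  obtain t2 N2 R2 where 2: "exec F G n (While b c) (N1, R1) t2 (N2, R2)" "t2 \<le> k2" "Q N2 R2"
    using assms(3)[OF 1(3)] unfolding runs_def by blast
  have "1 + bcost b + t1 + t2 \<le> k" using 1 2 assms(4) by linarith
  then show ?thesis unfolding runs_def using exec_WhileTrue[OF assms(1) 1(1) 2(1)] 2(3) by blast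
qed

lemma runs_While_end:
  assumes "\<not> bval (N, R) b" "Q N R" "1 + bcost b \<le> k"
  shows "runs F G n (While b c) N R Q k"
  unfolding runs_def using exec_WhileFalse[OF assms(1)] assms(2,3) by blast

lemma runs_While:
  assumes step: "\<And>N R. I N R \<Longrightarrow> bval (N, R) b \<Longrightarrow> runs F G n c N R (\<lambda>N' R'. I N' R' \<and> m N' R' < (m N R :: nat)) kb"
    and "I N R" and K: "m N R \<le> K"
  shows "runs F G n (While b c) N R (\<lambda>N R. I N R \<and> \<not> bval (N, R) b) ((K + 1) * (kb + bcost b + 1))"
  using assms(2,3)
proof (induction K arbitrary: N R rule: less_induct)
  case (less K)
  show ?case
  proof (cases "bval (N, R) b")
    case False
    then show ?thesis using less.prems by (intro runs_While_end) auto
  next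
    case True
    show ?thesis
    proof (rule runs_While_step[OF True step[OF less.prems(1) True]])
      fix N' R' assume p: "I N' R' \<and> m N' R' < m N R"
      then have "m N' R' \<le> K - 1" "K - 1 < K" using less.prems by auto
      then show "runs F G n (While b c) N' R' (\<lambda>N R. I N R \<and> \<not> bval (N, R) b) ((K - 1 + 1) * (kb + bcost b + 1))"
        using less.IH[of "K - 1" N' R'] p by auto
    next
      have "runs F G n c N R (\<lambda>N' R'. I N' R' \<and> m N' R' < m N R) kb" using step less.prems True by blast
      then obtain N' R' where "m N' R' < m N R" unfolding runs_def by blast
      then have "K - 1 + 1 = K" using less.prems by simp
      then show "1 + bcost b + kb + (K - 1 + 1) * (kb + bcost b + 1) \<le> (K + 1) * (kb + bcost b + 1)"
        by simp
    qed
  qed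
qed

definition For :: "name \<Rightarrow> nexp \<Rightarrow> com \<Rightarrow> com" where
  "For v e c = Seq (NAssign v [] (NConst 0))
     (While (NLess (NVar v []) e) (Seq c (NAssign v [] (NAdd (NVar v []) (NConst 1)))))"

text \<open>J k speaks about states whose counter is already k, so the body establishes
  \<open>J (Suc k)\<close> for the state after the increment. The bound e is evaluated anew in every
  round and has to keep the value m.\<close>

lemma runs_For:
  assumes init: "J 0 (store N v [] 0) R"
    and bound: "\<And>k N R. J k N R \<Longrightarrow> k \<le> m \<Longrightarrow> N v [] = k \<and> nval N e = m"
    and step: "\<And>k N R. J k N R \<Longrightarrow> k < m \<Longrightarrow>
      runs F G n c N R (\<lambda>N' R'. N' v [] = k \<and> J (Suc k) (store N' v [] (Suc k)) R') kb"
    and K: "(m + 1) * (kb + ncost e + 12) \<le> K"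
  shows "runs F G n (For v e c) N R (J m) K"
proof -
  let ?b = "NLess (NVar v []) e" and ?c = "Seq c (NAssign v [] (NAdd (NVar v []) (NConst 1)))"
  let ?I = "\<lambda>N R. \<exists>k\<le>m. J k N R"
  have "runs F G n (While ?b ?c) (store N v [] 0) R (\<lambda>N R. ?I N R \<and> \<not> bval (N, R) ?b)
      ((m + 1) * ((1 + kb + 5) + bcost ?b + 1))"
  proof (rule runs_While[where m = "\<lambda>N R. m - N v []"])
    show "?I (store N v [] 0) R" using init by blast
    fix N R assume "?I N R" and b: "bval (N, R) ?b"
    then obtain k where k: "J k N R" "k \<le> m" by blast
    then have km: "N v [] = k" "nval N e = m" "k < m" using bound[OF k] b by auto
    show "runs F G n ?c N R (\<lambda>N' R'. ?I N' R' \<and> m - N' v [] < m - N v []) (1 + kb + 5)"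
    proof (rule runs_Seq[OF step[OF k(1) km(3)]])
      fix N' R' assume 1: "N' v [] = k \<and> J (Suc k) (store N' v [] (Suc k)) R'"
      show "runs F G n (NAssign v [] (NAdd (NVar v []) (NConst 1))) N' R'
          (\<lambda>N' R'. ?I N' R' \<and> m - N' v [] < m - N v []) 5"
        by (rule runs_straight) (use 1 km in \<open>auto simp: store_def intro!: exI[of _ "Suc k"]\<close>)
    qed simp
  qed simp
  then have w: "runs F G n (While ?b ?c) (store N v [] 0) R (J m) ((m + 1) * ((1 + kb + 5) + bcost ?b + 1))"
  proof (rule runs_mono)
    fix N' R' assume "?I N' R' \<and> \<not> bval (N', R') ?b"
    then obtain k where k: "k \<le> m" "J k N' R'" "\<not> bval (N', R') ?b" by blast
    then have "k = m" using bound[OF k(2,1)] by auto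
    then show "J m N' R'" using k by simp
  qed simp
  show ?thesis unfolding For_def
  proof (rule runs_Seq)
    show "runs F G n (NAssign v [] (NConst 0)) N R (\<lambda>N' R'. N' = store N v [] 0 \<and> R' = R) 2"
      by (rule runs_straight) auto
    show "1 + 2 + (m + 1) * ((1 + kb + 5) + bcost ?b + 1) \<le> K"
      using K by (simp add: algebra_simps)
  qed (use w in auto)
qed

lemma runs_For_post:
  assumes "J 0 (store N v [] 0) R"
    and "\<And>k N R. J k N R \<Longrightarrow> k \<le> m \<Longrightarrow> N v [] = k \<and> nval N e = m"
    and "\<And>k N R. J k N R \<Longrightarrow> k < m \<Longrightarrow>
      runs F G n c N R (\<lambda>N' R'. N' v [] = k \<and> J (Suc k) (store N' v [] (Suc k)) R') kb"
    and "(m + 1) * (kb + ncost e + 12) \<le> K"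
    and Q: "\<And>N' R'. J m N' R' \<Longrightarrow> Q N' R'"
  shows "runs F G n (For v e c) N R Q K"
  using runs_mono[OF runs_For[of J, OF assms(1-4)] Q] by simp

section \<open>Frame conditions and the text of the program\<close>

definition agree :: "name set \<Rightarrow> 'v memory \<Rightarrow> 'v memory \<Rightarrow> bool" where
  "agree X m m' \<longleftrightarrow> (\<forall>x. x \<notin> X \<longrightarrow> m' x = m x)"

lemma agreeD: "agree X m m' \<Longrightarrow> x \<notin> X \<Longrightarrow> m' x = m x"
  by (simp add: agree_def)

lemma agree_refl: "agree X m m"
  by (simp add: agree_def)

lemma agree_chain: "agree Y m m' \<Longrightarrow> agree Y m' m'' \<Longrightarrow> agree Y m m''"
  by (simp add: agree_def)

lemma agree_store: "agree X m m' \<Longrightarrow> x \<in> X \<Longrightarrow> agree X m (store m' x is v)"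
  by (auto simp: agree_def store_def)

lemma agree_mono: "agree X m m' \<Longrightarrow> X \<subseteq> Y \<Longrightarrow> agree Y m m'"
  by (auto simp: agree_def)

abbreviation nv :: "name \<Rightarrow> nexp" where "nv x \<equiv> NVar x []"
abbreviation rv :: "name \<Rightarrow> rexp" where "rv x \<equiv> RVar x []"
abbreviation out :: "nat memory \<Rightarrow> nat \<Rightarrow> nat" where "out N \<equiv> \<lambda>i. N ''out'' [i]"

text \<open>Queries use the row \<open>A\<close>. The arrays \<open>fp\<close> and \<open>gp\<close> hold the values on the prefixes of the current
  order \<open>out\<close>, and \<open>z\<close> the current Frank--Wolfe iterate on the window \<open>{l..<r}\<close> of positions.
  The stack \<open>(lo, hi)\<close> holds the segments that still have to be decomposed.\<close>

definition fill_row :: "nat \<Rightarrow> com" where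
  "fill_row v = For ''j'' (nv ''n'') (NAssign ''A'' [nv ''j''] (NConst v))"

definition prefixes :: com where
  "prefixes = Seq (fill_row 0) (Seq (QueryF ''fp'' [NConst 0] ''A'' []) (Seq (QueryG ''gp'' [NConst 0] ''A'' [])
     (For ''i'' (nv ''n'') (Seq (NAssign ''A'' [NVar ''out'' [nv ''i'']] (NConst 1))
       (Seq (QueryF ''fp'' [NAdd (nv ''i'') (NConst 1)] ''A'' []) (QueryG ''gp'' [NAdd (nv ''i'') (NConst 1)] ''A'' []))))))"

text \<open>The direction leads to the greedy vertex of the current order, read off from the stored
  prefix values. Entries outside the window move as well; the next restart overwrites them.\<close>

definition move :: com where
  "move = For ''i'' (nv ''n'') (RAssign ''z'' [NVar ''out'' [nv ''i'']]
     (RAdd (RVar ''z'' [NVar ''out'' [nv ''i'']]) (RMul (rv ''c'') (RSub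
       (RSub (RMul (rv ''lam'') (RSub (RVar ''fp'' [NAdd (nv ''i'') (NConst 1)]) (RVar ''fp'' [nv ''i''])))
         (RSub (RVar ''gp'' [NAdd (nv ''i'') (NConst 1)]) (RVar ''gp'' [nv ''i''])))
       (RVar ''z'' [NVar ''out'' [nv ''i'']])))))"

text \<open>An exchange sort with the window in its guard. Once \<open>load_keys\<close> has put the
  keys into z, the same code sorts a finished block by key.\<close>

definition sort_seg :: com where
  "sort_seg = For ''i'' (nv ''n'') (For ''j'' (nv ''n'')
     (Cond (BAnd (BAnd (NLess (nv ''i'') (nv ''j'')) (BNot (NLess (nv ''i'') (nv ''l''))))
         (BAnd (NLess (nv ''j'') (nv ''r'')) (RLess (RVar ''z'' [NVar ''out'' [nv ''j'']]) (RVar ''z'' [NVar ''out'' [nv ''i'']]))))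
       (Seq (NAssign ''h'' [] (NVar ''out'' [nv ''i'']))
         (Seq (NAssign ''out'' [nv ''i''] (NVar ''out'' [nv ''j''])) (NAssign ''out'' [nv ''j''] (nv ''h''))))
       Skip))"

text \<open>When \<open>d\<close> is computed, \<open>s\<close> does not yet contain coordinate k,
  so \<open>d\<close> is the defect of the prefix of length k. Positions run up to n inclusive
  because a left cut may occur at r. Any cut is good enough; the last one of each kind is
  kept.\<close>

definition scan :: com where
  "scan = Seq (RAssign ''s'' [] RZero) (Seq (NAssign ''nl'' [] (nv ''l'')) (Seq (NAssign ''nr'' [] (nv ''r''))
     (For ''k'' (NAdd (nv ''n'') (NConst 1))
       (Seq (RAssign ''d'' [] (RSub (RSub
             (RMul (rv ''lam'') (RSub (RVar ''fp'' [nv ''k'']) (RVar ''fp'' [nv ''l''])))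
             (RSub (RVar ''gp'' [nv ''k'']) (RVar ''gp'' [nv ''l'']))) (rv ''s'')))
       (Seq (Cond (BAnd (BAnd (NLess (nv ''l'') (nv ''k'')) (BNot (NLess (nv ''r'') (nv ''k''))))
               (RLess (RAdd (RVar ''z'' [NVar ''out'' [NSub (nv ''k'') (NConst 1)]]) (rv ''d'')) RZero))
             (NAssign ''nl'' [] (nv ''k'')) Skip)
       (Seq (Cond (BAnd (BAnd (BNot (NLess (nv ''k'') (nv ''l''))) (NLess (nv ''k'') (nv ''r'')))
               (RLess (rv ''d'') (RVar ''z'' [NVar ''out'' [nv ''k'']])))
             (NAssign ''nr'' [] (nv ''k'')) Skip)
         (Cond (BAnd (BNot (NLess (nv ''k'') (nv ''l''))) (NLess (nv ''k'') (nv ''r'')))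
             (RAssign ''s'' [] (RAdd (rv ''s'') (RVar ''z'' [NVar ''out'' [nv ''k'']]))) Skip)))))))"

text \<open>\<open>t\<close> counts the Frank--Wolfe steps since the last cut; the first step, of length 1, discards the
  old contents of \<open>z\<close>.\<close>

definition improve :: com where
  "improve = Seq (Cond (RLess RZero (rv ''t'')) (RAssign ''c'' [] (rv ''tau'')) (RAssign ''c'' [] ROne))
     (Seq move (Seq sort_seg (Seq prefixes (Seq scan
       (Cond (BAnd (BNot (NLess (nv ''l'') (nv ''nl''))) (BNot (NLess (nv ''nr'') (nv ''r''))))
         (RAssign ''t'' [] (RAdd (rv ''t'') ROne))
         (Seq (NAssign ''l'' [] (nv ''nl'')) (Seq (NAssign ''r'' [] (nv ''nr'')) (RAssign ''t'' [] RZero))))))))"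

definition refine :: com where
  "refine = While (BAnd (NLess (nv ''l'') (nv ''r'')) (RLess (rv ''t'') (rv ''T''))) improve"

definition push :: "name \<Rightarrow> name \<Rightarrow> com" where
  "push x y = Cond (NLess (nv x) (nv y)) (Seq (NAssign ''lo'' [nv ''sp''] (nv x))
     (Seq (NAssign ''hi'' [nv ''sp''] (nv y)) (NAssign ''sp'' [] (NAdd (nv ''sp'') (NConst 1))))) Skip"

definition pop :: com where
  "pop = Seq (NAssign ''sp'' [] (NSub (nv ''sp'') (NConst 1)))
     (Seq (NAssign ''p'' [] (NVar ''lo'' [nv ''sp''])) (Seq (NAssign ''q'' [] (NVar ''hi'' [nv ''sp'']))
     (Seq (NAssign ''l'' [] (nv ''p'')) (NAssign ''r'' [] (nv ''q'')))))"

definition start :: com where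
  "start = Seq (RAssign ''lam'' [] (RDiv (RSub (RVar ''gp'' [nv ''q'']) (RVar ''gp'' [nv ''p'']))
       (RSub (RVar ''fp'' [nv ''q'']) (RVar ''fp'' [nv ''p''])))) (RAssign ''t'' [] RZero)"

definition load_keys :: com where
  "load_keys = For ''i'' (nv ''n'') (RAssign ''z'' [nv ''i''] (RVar ''key'' [nv ''i'']))"

definition split_node :: com where
  "split_node = Seq pop (Seq prefixes (Seq start (Seq refine (Seq load_keys (Seq sort_seg
     (Seq (push ''p'' ''l'') (push ''r'' ''q'')))))))"

abbreviation main_loop :: com where
  "main_loop \<equiv> While (NLess (NConst 0) (nv ''sp'')) split_node"

text \<open>Written out as products: 0 and 1 are the only real literals, and M itself is obtained by
  counting in \<open>init_order\<close>.\<close>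

fun power_of_M :: "nat \<Rightarrow> rexp" where
  "power_of_M 0 = ROne"
| "power_of_M (Suc k) = RMul (rv ''M'') (power_of_M k)"

definition keys :: com where
  "keys = For ''k'' (nv ''n'') (Seq (fill_row 0)
     (Seq (Seq (NAssign ''A'' [nv ''k''] (NConst 1)) (QueryF ''key'' [nv ''k''] ''A'' []))
     (Seq (fill_row 1)
       (Seq (NAssign ''A'' [nv ''k''] (NConst 0)) (Seq (QueryG ''g'' [] ''A'' [])
         (RAssign ''key'' [nv ''k''] (RDiv (RVar ''key'' [nv ''k'']) (RSub (RVar ''gp'' [nv ''n'']) (rv ''g'')))))))))"

definition init_order :: com where
  "init_order = For ''i'' (nv ''n'') (Seq (NAssign ''out'' [nv ''i''] (nv ''i'')) (RAssign ''M'' [] (RAdd (rv ''M'') ROne)))"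

definition init_rest :: com where
  "init_rest = Seq (RAssign ''T'' [] (power_of_M 81)) (Seq (RAssign ''tau'' [] (RDiv ROne (power_of_M 37)))
     (Seq (NAssign ''sp'' [] (NConst 1)) (Seq (NAssign ''lo'' [NConst 0] (NConst 0)) (NAssign ''hi'' [NConst 0] (nv ''n'')))))"

definition program :: com where
  "program = Seq (RAssign ''M'' [] ROne) (Seq init_order (Seq prefixes (Seq keys (Seq init_rest
     main_loop))))"

section \<open>Behaviour of the subroutines\<close>

lemma runs_fill_row:
  assumes n: "N ''n'' [] = n"
  shows "runs F G n (fill_row v) N R
    (\<lambda>N' R'. R' = R \<and> agree {''A'', ''j''} N N' \<and> (\<forall>i<n. N' ''A'' [i] = v)) (30 * (n + 1))"
  unfolding fill_row_def
proof (rule runs_For_post[where m = n and kb = 4 and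
      J = "\<lambda>k N' R'. N' ''j'' [] = k \<and> R' = R \<and> agree {''A'', ''j''} N N' \<and> (\<forall>i<k. N' ''A'' [i] = v)"], goal_cases)
  case 1
  show ?case by (auto simp: store_def agree_def)
next
  case (2 k N' R')
  then show ?case using n by (auto simp: agree_def)
next
  case (3 k N' R')
  then show ?case by (intro runs_straight) (auto simp: store_def agree_def less_Suc_eq)
qed auto

lemma runs_prefixes:
  assumes n: "N ''n'' [] = n" and out: "\<forall>i<n. out N i < n"
  shows "runs F G n prefixes N R
    (\<lambda>N' R'. agree {''A'', ''i'', ''j''} N N' \<and> agree {''fp'', ''gp''} R R'
      \<and> (\<forall>k\<le>n. R' ''fp'' [k] = F (pre (out N) k) \<and> R' ''gp'' [k] = G (pre (out N) k))) (100 * (n + 1))"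
  unfolding prefixes_def
proof (rule runs_Seq[where ?k2.0 = "60 * (n + 1)", OF runs_fill_row[where N = N and n = n, OF n]], goal_cases)
  case (1 N1 R1)
  have row: "row_set n N1 ''A'' [] = {}" using 1 by (auto simp: row_set_def)
  have n1: "N1 ''n'' [] = n" "out N1 = out N" using n 1 by (auto simp: agree_def)
  show ?case
  proof (rule runs_Seq[where ?k1.0 = 10 and ?k2.0 = "48 * (n + 1)" and P = "\<lambda>N' R'. N' = N1 \<and> R' = store R ''fp'' [0] (F {})"], goal_cases)
    case 1
    show ?case using row \<open>R1 = R \<and> _\<close> by (intro runs_straight) auto
  next
    case (2 N2 R2)
    show ?case
    proof (rule runs_Seq[where ?k1.0 = 10 and ?k2.0 = "35 * (n + 1)" and P = "\<lambda>N' R'. N' = N1 \<and> R' = store R2 ''gp'' [0] (G {})"], goal_cases)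
      case 1
      show ?case using row 2 by (intro runs_straight) auto
    next
      case (2 N3 R3)
      define J where "J = (\<lambda>k N' R'. N' ''i'' [] = k \<and> agree {''A'', ''i'', ''j''} N N' \<and> agree {''fp'', ''gp''} R R'
        \<and> (\<forall>e<n. N' ''A'' [e] \<noteq> 0 \<longleftrightarrow> e \<in> pre (out N) k)
        \<and> (\<forall>m\<le>k. R' ''fp'' [m] = F (pre (out N) m) \<and> R' ''gp'' [m] = G (pre (out N) m)))"
      show ?case
      proof (rule runs_For_post[where m = n and kb = 20 and J = J], goal_cases)
        case 1
        show ?case using \<open>R1 = R \<and> _\<close> \<open>N2 = N1 \<and> _\<close> 2 by (auto simp: J_def store_def agree_def)
      next
        case (2 k N' R')
        then show ?case using n by (auto simp: agree_def J_def)
      next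
        case (3 k N' R')
        let ?N = "store N' ''A'' [out N k] 1"
        have o: "out N' = out N" using 3 by (auto simp: J_def agree_def)
        have rs: "row_set n ?N ''A'' [] = pre (out N) (Suc k)"
          using 3 out by (auto simp: row_set_def J_def store_def pre_Suc less_Suc_eq)
        have o': "N' ''out'' [k] = out N k" using o by meson
        have i: "N' ''i'' [] = k" using 3 by (simp add: J_def)
        show ?case
        proof (rule runs_straight, goal_cases)
          case 2
          have "J (Suc k) (store ?N ''i'' [] (Suc k))
            (store (store R' ''fp'' [Suc k] (F (pre (out N) (Suc k)))) ''gp'' [Suc k] (G (pre (out N) (Suc k))))"
            using 3 by (auto simp: J_def store_def agree_def pre_Suc le_Suc_eq)
          then show ?case using rs i o' by (simp add: store_def)
        qed auto
      qed (auto simp: J_def)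
    qed auto
  qed auto
qed auto

text \<open>z is indexed by elements rather than positions, so that it survives sorting; injectivity
  of \<open>out\<close> keeps the updates apart.\<close>

lemma runs_move:
  assumes n: "N ''n'' [] = n" and inj: "inj_on (out N) {..<n}"
  shows "runs F G n move N R (\<lambda>N' R'. agree {''i''} N N' \<and> agree {''z''} R R'
      \<and> (\<forall>k<n. R' ''z'' [out N k] = R ''z'' [out N k] + R ''c'' [] *
          (R ''lam'' [] * (R ''fp'' [Suc k] - R ''fp'' [k]) - (R ''gp'' [Suc k] - R ''gp'' [k]) - R ''z'' [out N k])))
      (100 * (n + 1))"
  unfolding move_def
proof (rule runs_For_post[where m = n and kb = 50 and
      J = "\<lambda>k N' R'. N' ''i'' [] = k \<and> agree {''i''} N N' \<and> agree {''z''} R R'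
      \<and> (\<forall>m<n. R' ''z'' [out N m] = (if m < k then R ''z'' [out N m] + R ''c'' [] *
          (R ''lam'' [] * (R ''fp'' [Suc m] - R ''fp'' [m]) - (R ''gp'' [Suc m] - R ''gp'' [m]) - R ''z'' [out N m])
        else R ''z'' [out N m]))"], goal_cases)
  case 1
  show ?case by (auto simp: store_def agree_def)
next
  case (2 k N' R')
  then show ?case using n by (auto simp: agree_def)
next
  case (3 k N' R')
  then have R': "R' ''c'' = R ''c''" "R' ''lam'' = R ''lam''" "R' ''fp'' = R ''fp''" "R' ''gp'' = R ''gp''"
    and N': "N' ''out'' = N ''out''" "N' ''i'' [] = k" by (auto simp: agree_def)
  have ne: "out N m = out N k \<longleftrightarrow> m = k" if "m < n" for m using inj_onD[OF inj, of m k] 3 that by auto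
  show ?case
    by (rule runs_straight)
       (use 3 R' N' ne in \<open>auto simp: less_Suc_eq store_def agree_def\<close>)
qed auto

text \<open>Prefixes that do not end strictly inside the segment keep their sets, so statements
  about earlier cut points survive.\<close>

definition reorder :: "nat \<Rightarrow> nat \<Rightarrow> (nat \<Rightarrow> nat) \<Rightarrow> (nat \<Rightarrow> nat) \<Rightarrow> bool" where
  "reorder p q \<pi> \<pi>' \<longleftrightarrow> (\<forall>i. i < p \<or> q \<le> i \<longrightarrow> \<pi>' i = \<pi> i) \<and> \<pi>' ` {p..<q} = \<pi> ` {p..<q}"

lemma reorder_refl: "reorder p q \<pi> \<pi>"
  by (simp add: reorder_def)

lemma reorder_trans: "reorder p q \<pi> \<pi>' \<Longrightarrow> reorder p q \<pi>' \<pi>'' \<Longrightarrow> reorder p q \<pi> \<pi>''"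
  by (auto simp: reorder_def)

lemma reorder_mono:
  assumes "reorder l r \<pi> \<pi>'" "p \<le> l" "l \<le> r" "r \<le> q"
  shows "reorder p q \<pi> \<pi>'"
proof -
  have "{p..<q} = {p..<l} \<union> {l..<r} \<union> {r..<q}" using assms by auto
  then have "\<rho> ` {p..<q} = \<rho> ` {p..<l} \<union> \<rho> ` {l..<r} \<union> \<rho> ` {r..<q}" for \<rho> :: "nat \<Rightarrow> nat"
    by (simp add: image_Un)
  moreover have "\<pi>' ` {p..<l} = \<pi> ` {p..<l}" "\<pi>' ` {r..<q} = \<pi> ` {r..<q}"
    using assms by (auto simp: reorder_def intro!: image_cong)
  ultimately show ?thesis using assms by (simp add: reorder_def)
qed

lemma reorder_swap:
  assumes "p \<le> i" "i < q" "p \<le> j" "j < q"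
  shows "reorder p q \<pi> (\<pi>(i := \<pi> j, j := \<pi> i))"
proof -
  have "x \<in> (\<pi>(i := \<pi> j, j := \<pi> i)) ` {p..<q}" if "x \<in> \<pi> ` {p..<q}" for x
  proof -
    obtain k where "k \<in> {p..<q}" "x = \<pi> k" using \<open>x \<in> \<pi> ` {p..<q}\<close> by auto
    then show ?thesis using assms
      by (intro image_eqI[of _ _ "if k = i then j else if k = j then i else k"]) auto
  qed
  then show ?thesis using assms unfolding reorder_def by auto
qed

lemma reorder_pre:
  assumes "reorder p q \<pi> \<pi>'" "k \<le> p \<or> q \<le> k" "p \<le> q"
  shows "pre \<pi>' k = pre \<pi> k"
proof (cases "k \<le> p")
  case True
  then show ?thesis using assms by (auto simp: reorder_def intro!: image_cong)
next
  case False
  then have "q \<le> k" "p \<le> k" using assms by auto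
  then have "{..<k} = {..<p} \<union> {p..<q} \<union> {q..<k}" using assms(3) by auto
  then have "\<rho> ` {..<k} = \<rho> ` {..<p} \<union> \<rho> ` {p..<q} \<union> \<rho> ` {q..<k}" for \<rho> :: "nat \<Rightarrow> nat"
    by (simp add: image_Un)
  moreover have "\<pi>' ` {..<p} = \<pi> ` {..<p}" "\<pi>' ` {q..<k} = \<pi> ` {q..<k}"
    using assms by (auto simp: reorder_def intro!: image_cong)
  ultimately show ?thesis using assms by (simp add: reorder_def)
qed

lemma reorder_inj:
  assumes "reorder p q \<pi> \<pi>'" "q \<le> n" "p \<le> q" "inj_on \<pi> {..<n}"
  shows "inj_on \<pi>' {..<n}" "\<pi>' ` {..<n} = \<pi> ` {..<n}"
proof -
  show im: "\<pi>' ` {..<n} = \<pi> ` {..<n}" using reorder_pre[OF assms(1) _ assms(3), of n] assms(2) by simp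
  show "inj_on \<pi>' {..<n}" using card_image[OF assms(4)] im by (intro eq_card_imp_inj_on) auto
qed

lemma runs_sort_seg:
  assumes n: "N ''n'' [] = n" and lr: "N ''l'' [] = l" "N ''r'' [] = r" "l \<le> r" "r \<le> n"
  shows "runs F G n sort_seg N R
    (\<lambda>N' R'. R' = R \<and> agree {''i'', ''j'', ''h'', ''out''} N N' \<and> reorder l r (out N) (out N')
      \<and> (\<forall>i j. l \<le> i \<and> i \<le> j \<and> j < r \<longrightarrow> R ''z'' [out N' i] \<le> R ''z'' [out N' j])) (100 * (n + 1)\<^sup>2)"
proof -
  define z where "z = (\<lambda>e. R ''z'' [e])"
  \<comment> \<open>Outer invariant: in the window, positions before k precede everything behind
    them. Inner invariant J: position k also holds the minimum over the positions between k and
    m.\<close>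
  define I where "I = (\<lambda>k N' R'. R' = R \<and> agree {''i'', ''j'', ''h'', ''out''} N N'
    \<and> reorder l r (out N) (out N')
    \<and> (\<forall>i j. l \<le> i \<and> i < k \<and> i \<le> j \<and> j < r \<longrightarrow> z (out N' i) \<le> z (out N' j)))"
  define J where "J = (\<lambda>k m N' R'. I k N' R' \<and> N' ''i'' [] = k \<and> N' ''j'' [] = m
    \<and> (l \<le> k \<longrightarrow> (\<forall>j. k < j \<and> j < m \<and> j < r \<longrightarrow> z (out N' k) \<le> z (out N' j))))"
  have vars: "N' ''n'' [] = n" "N' ''l'' [] = l" "N' ''r'' [] = r" if "I k N' R'" for k N' R'
    using that n lr by (auto simp: I_def agree_def)
  show ?thesis unfolding sort_seg_def
  proof (rule runs_For_post[where m = n and kb = "70 * (n + 1)" and J = "\<lambda>k N' R'. I k N' R' \<and> N' ''i'' [] = k"], goal_cases)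
    case 1
    show ?case by (auto simp: I_def store_def agree_def reorder_refl)
  next
    case (2 k N' R')
    then show ?case using vars by auto
  next
    case (3 k N1 R1)
    show ?case
    proof (rule runs_For_post[where m = n and kb = 50 and J = "J k"], goal_cases)
      case 1
      show ?case using 3 by (auto simp: J_def I_def store_def agree_def)
    next
      case (2 m N' R')
      then show ?case using vars by (auto simp: J_def)
    next
      case (3 m N' R')
      then have N': "N' ''i'' [] = k" "N' ''j'' [] = m" "N' ''l'' [] = l" "N' ''r'' [] = r" and R': "R' = R"
        using vars[of k N' R'] by (auto simp: J_def I_def)
      let ?c = "k < m \<and> l \<le> k \<and> m < r \<and> z (out N' m) < z (out N' k)"
      show ?case
      proof (rule runs_straight, goal_cases)
        case 2
        show ?case
        proof (cases ?c)
          case True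
          let ?N = "store (store (store N' ''h'' [] (out N' k)) ''out'' [k] (out N' m)) ''out'' [m] (out N' k)"
          have o: "out (store ?N ''j'' [] (Suc m)) = (out N')(k := out N' m, m := out N' k)"
            by (auto simp: store_def fun_eq_iff)
          have o': "store ?N ''j'' [] (Suc m) ''out'' [i] = ((out N')(k := out N' m, m := out N' k)) i" for i
            by (rule fun_cong[OF o])
          have sw: "reorder l r (out N') ((out N')(k := out N' m, m := out N' k))"
            using True by (intro reorder_swap) auto
          have I: "reorder l r (out N) (out N')" "agree {''i'', ''j'', ''h'', ''out''} N N'"
            and so: "\<And>i j. l \<le> i \<Longrightarrow> i < k \<Longrightarrow> i \<le> j \<Longrightarrow> j < r \<Longrightarrow> z (out N' i) \<le> z (out N' j)"
            and mn: "\<And>j. k < j \<Longrightarrow> j < m \<Longrightarrow> j < r \<Longrightarrow> z (out N' k) \<le> z (out N' j)"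
            using 3 True by (auto simp: J_def I_def)
          have "I k (store ?N ''j'' [] (Suc m)) R" unfolding I_def o o'
          proof (intro conjI allI impI)
            show "agree {''i'', ''j'', ''h'', ''out''} N (store ?N ''j'' [] (Suc m))"
              using I(2) by (intro agree_store) auto
            show "reorder l r (out N) ((out N')(k := out N' m, m := out N' k))"
              using reorder_trans[OF I(1) sw] .
            fix i j assume "l \<le> i \<and> i < k \<and> i \<le> j \<and> j < r"
            then show "z (((out N')(k := out N' m, m := out N' k)) i) \<le> z (((out N')(k := out N' m, m := out N' k)) j)"
              using so[of i j] so[of i k] so[of i m] True by auto
          qed simp
          moreover have "z (out (store ?N ''j'' [] (Suc m)) k) \<le> z (out (store ?N ''j'' [] (Suc m)) j)"
            if "k < j" "j < Suc m" "j < r" for j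
            unfolding o' using mn[of j] that True by (auto simp: less_Suc_eq)
          ultimately have "J k (Suc m) (store ?N ''j'' [] (Suc m)) R"
            using N' by (simp add: J_def) (simp add: store_def)
          then show ?thesis using N' R' True by (simp add: store_def z_def)
        next
          case False
          have oo: "store N' ''j'' [] (Suc m) ''out'' [i] = out N' i" "store N' ''j'' [] (Suc m) ''i'' [] = N' ''i'' []"
            "store N' ''j'' [] (Suc m) ''j'' [] = Suc m" for i
            by (simp_all add: store_def)
          have "I k N' R'" using 3 by (simp add: J_def)
          then have "I k (store N' ''j'' [] (Suc m)) R'" by (simp add: I_def oo agree_store)
          moreover have "z (out N' k) \<le> z (out N' j)" if "l \<le> k" "k < j" "j < Suc m" "j < r" for j
          proof (cases "j = m")
            case True
            then show ?thesis using False that by auto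
          next
            case jm: False
            then show ?thesis using 3 that by (simp add: J_def)
          qed
          ultimately have "J k (Suc m) (store N' ''j'' [] (Suc m)) R'"
            unfolding J_def oo using N' by blast
          then show ?thesis using N' R' False by (auto simp: z_def)
        qed
      qed auto
    next
      case (5 N' R')
      then have I: "I k N' R'" "N' ''i'' [] = k" by (auto simp: J_def)
      have "z (out N' i) \<le> z (out N' j)" if "l \<le> i" "i < Suc k" "i \<le> j" "j < r" for i j
      proof (cases "i = j \<or> i < k")
        case True
        then show ?thesis using I(1) that by (auto simp: I_def)
      next
        case False
        then have "i = k" "k < j" "j < n" using that lr by auto
        then show ?thesis using 5 that unfolding J_def by blast
      qed
      then show ?case using I by (auto simp: I_def agree_store) (auto simp: store_def)
    qed auto
  next
    case 4
    show ?case by (simp add: power2_eq_square algebra_simps)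
  next
    case (5 N' R')
    then show ?case using lr by (auto simp: I_def z_def)
  qed
qed

text \<open>The cut criterion in terms of the memory; \<open>cut_defect\<close> identifies it with
  the one in \<open>cut_left\<close>.\<close>

definition left_cut :: "real memory \<Rightarrow> (nat \<Rightarrow> nat) \<Rightarrow> nat \<Rightarrow> nat \<Rightarrow> bool" where
  "left_cut R \<pi> l k \<longleftrightarrow> R ''z'' [\<pi> (k - 1)] + (R ''lam'' [] * (R ''fp'' [k] - R ''fp'' [l])
     - (R ''gp'' [k] - R ''gp'' [l]) - (\<Sum>i=l..<k. R ''z'' [\<pi> i])) < 0"

definition right_cut :: "real memory \<Rightarrow> (nat \<Rightarrow> nat) \<Rightarrow> nat \<Rightarrow> nat \<Rightarrow> bool" where
  "right_cut R \<pi> l k \<longleftrightarrow> R ''lam'' [] * (R ''fp'' [k] - R ''fp'' [l])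
     - (R ''gp'' [k] - R ''gp'' [l]) - (\<Sum>i=l..<k. R ''z'' [\<pi> i]) < R ''z'' [\<pi> k]"

lemma runs_scan:
  assumes n: "N ''n'' [] = n" and lr: "N ''l'' [] = l" "N ''r'' [] = r" "l \<le> r" "r \<le> n"
  shows "runs F G n scan N R
    (\<lambda>N' R'. agree {''s'', ''d''} R R' \<and> agree {''k'', ''nl'', ''nr''} N N'
      \<and> (N' ''nl'' [] = l \<and> (\<forall>k. l < k \<and> k \<le> r \<longrightarrow> \<not> left_cut R (out N) l k)
         \<or> l < N' ''nl'' [] \<and> N' ''nl'' [] \<le> r \<and> left_cut R (out N) l (N' ''nl'' []))
      \<and> (N' ''nr'' [] = r \<and> (\<forall>k. l \<le> k \<and> k < r \<longrightarrow> \<not> right_cut R (out N) l k)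
         \<or> l \<le> N' ''nr'' [] \<and> N' ''nr'' [] < r \<and> right_cut R (out N) l (N' ''nr'' []))) (300 * (n + 1))"
proof -
  let ?z = "\<lambda>i. R ''z'' [out N i]"
  define J where "J = (\<lambda>k N' R'. agree {''s'', ''d''} R R' \<and> agree {''k'', ''nl'', ''nr''} N N'
      \<and> N' ''k'' [] = k \<and> R' ''s'' [] = (\<Sum>i=l..<min k r. ?z i)
      \<and> (N' ''nl'' [] = l \<and> (\<forall>m<k. l < m \<and> m \<le> r \<longrightarrow> \<not> left_cut R (out N) l m)
         \<or> l < N' ''nl'' [] \<and> N' ''nl'' [] \<le> r \<and> left_cut R (out N) l (N' ''nl'' []))
      \<and> (N' ''nr'' [] = r \<and> (\<forall>m<k. l \<le> m \<and> m < r \<longrightarrow> \<not> right_cut R (out N) l m)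
         \<or> l \<le> N' ''nr'' [] \<and> N' ''nr'' [] < r \<and> right_cut R (out N) l (N' ''nr'' [])))"
  show ?thesis unfolding scan_def
  proof (rule runs_Seq[where ?k1.0 = 2 and ?k2.0 = "290 * (n + 1)" and P = "\<lambda>N' R'. N' = N \<and> R' = store R ''s'' [] 0"], goal_cases)
    case 1
    show ?case by (rule runs_straight) auto
  next
    case (2 N1 R1)
    show ?case
    proof (rule runs_Seq[where ?k1.0 = 2 and ?k2.0 = "280 * (n + 1)" and P = "\<lambda>N' R'. N' = store N ''nl'' [] l \<and> R' = R1"], goal_cases)
      case 1
      show ?case using 2 lr by (intro runs_straight) auto
    next
      case (2 N2 R2)
      show ?case
      proof (rule runs_Seq[where ?k1.0 = 2 and ?k2.0 = "270 * (n + 1)" and P = "\<lambda>N' R'. N' = store N2 ''nr'' [] r \<and> R' = R1"], goal_cases)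
        case 1
        show ?case using 2 lr by (intro runs_straight) (auto simp: store_def)
      next
        case (2 N3 R3)
        show ?case
        proof (rule runs_For_post[where m = "n + 1" and kb = 110 and J = J], goal_cases)
          case 1
          show ?case using \<open>N1 = N \<and> _\<close> \<open>N2 = _ \<and> _\<close> \<open>N3 = _ \<and> _\<close> by (auto simp: J_def store_def agree_def)
        next
          case (2 k N' R')
          then show ?case using n by (auto simp: J_def agree_def)
        next
          case (3 k N' R')
          have R': "R' ''z'' = R ''z''" "R' ''fp'' = R ''fp''" "R' ''gp'' = R ''gp''" "R' ''lam'' = R ''lam''"
            and N': "N' ''out'' = N ''out''" "N' ''l'' [] = l" "N' ''r'' [] = r" "N' ''k'' [] = k"
            using 3 lr by (auto simp: J_def agree_def)
          have J: "J k N' R'" by (fact 3)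
          have sum_step: "(\<Sum>i=l..<min (Suc k) r. ?z i)
            = (if l \<le> k \<and> k < r then (\<Sum>i=l..<min k r. ?z i) + ?z k else (\<Sum>i=l..<min k r. ?z i))"
            using lr(3) by (auto simp: min_def not_less_eq_eq)
          define d where "d = R ''lam'' [] * (R ''fp'' [k] - R ''fp'' [l]) - (R ''gp'' [k] - R ''gp'' [l])
            - (\<Sum>i=l..<min k r. ?z i)"
          have lc: "left_cut R (out N) l k \<longleftrightarrow> R ''z'' [N ''out'' [k - 1]] + d < 0" if "k \<le> r"
            using that by (simp add: left_cut_def d_def)
          have rc: "right_cut R (out N) l k \<longleftrightarrow> d < ?z k" if "k < r"
            using that by (simp add: right_cut_def d_def)
          let ?nl = "if l < k \<and> k \<le> r \<and> R ''z'' [N ''out'' [k - 1]] + d < 0 then k else N' ''nl'' []"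
          let ?nr = "if l \<le> k \<and> k < r \<and> d < ?z k then k else N' ''nr'' []"
          let ?s = "if l \<le> k \<and> k < r then R' ''s'' [] + ?z k else R' ''s'' []"
          show ?case
          proof (rule runs_mono)
            show "runs F G n (Seq (RAssign ''d'' [] (RSub (RSub
                  (RMul (rv ''lam'') (RSub (RVar ''fp'' [nv ''k'']) (RVar ''fp'' [nv ''l''])))
                  (RSub (RVar ''gp'' [nv ''k'']) (RVar ''gp'' [nv ''l'']))) (rv ''s'')))
              (Seq (Cond (BAnd (BAnd (NLess (nv ''l'') (nv ''k'')) (BNot (NLess (nv ''r'') (nv ''k''))))
                    (RLess (RAdd (RVar ''z'' [NVar ''out'' [NSub (nv ''k'') (NConst 1)]]) (rv ''d'')) RZero))
                  (NAssign ''nl'' [] (nv ''k'')) Skip)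
              (Seq (Cond (BAnd (BAnd (BNot (NLess (nv ''k'') (nv ''l''))) (NLess (nv ''k'') (nv ''r'')))
                    (RLess (rv ''d'') (RVar ''z'' [NVar ''out'' [nv ''k'']])))
                  (NAssign ''nr'' [] (nv ''k'')) Skip)
                (Cond (BAnd (BNot (NLess (nv ''k'') (nv ''l''))) (NLess (nv ''k'') (nv ''r'')))
                  (RAssign ''s'' [] (RAdd (rv ''s'') (RVar ''z'' [NVar ''out'' [nv ''k'']]))) Skip)))) N' R'
              (\<lambda>N'' R''. agree {''s'', ''d''} R' R'' \<and> agree {''nl'', ''nr''} N' N''
                \<and> N'' ''nl'' [] = ?nl \<and> N'' ''nr'' [] = ?nr \<and> R'' ''s'' [] = ?s) 110"
            proof (rule runs_Seq[where ?k1.0 = 20 and ?k2.0 = 85 and P = "\<lambda>N1 R1. N1 = N' \<and> agree {''d''} R' R1 \<and> R1 ''d'' [] = d"], goal_cases)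
              case 1
              have "R' ''s'' [] = (\<Sum>i=l..<min k r. ?z i)" using J by (simp add: J_def)
              then show ?case
                using N' R' by (intro runs_straight) (auto simp: d_def store_def agree_def)
            next
              case (2 N1 R1)
              show ?case
              proof (rule runs_Seq[where ?k1.0 = 30 and ?k2.0 = 54 and P = "\<lambda>N2 R2. agree {''nl''} N' N2 \<and> agree {''d''} R' R2
                  \<and> R2 ''d'' [] = d \<and> N2 ''nl'' [] = ?nl"], goal_cases)
                case 1
                have "R1 ''z'' = R ''z''" using 2 R' by (auto simp: agree_def)
                then show ?case
                  using N' 2 by (intro runs_straight) (auto simp: store_def agree_def)
              next
                case (2 N2 R2)
                have N2: "N2 ''out'' = N ''out''" "N2 ''l'' [] = l" "N2 ''r'' [] = r" "N2 ''k'' [] = k"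
                  "N2 ''nr'' [] = N' ''nr'' []" "R2 ''z'' = R ''z''" "R2 ''d'' [] = d"
                  using 2 N' R' by (auto simp: agree_def)
                show ?case
                proof (rule runs_Seq[where ?k1.0 = 28 and ?k2.0 = 25 and P = "\<lambda>N3 R3. agree {''nl'', ''nr''} N' N3 \<and> agree {''d''} R' R3
                    \<and> N3 ''nl'' [] = ?nl \<and> N3 ''nr'' [] = ?nr"], goal_cases)
                  case 1
                  show ?case
                    using N2 2 by (intro runs_straight) (auto simp: store_def agree_def)
                next
                  case (2 N3 R3)
                  have N3: "N3 ''out'' = N ''out''" "N3 ''l'' [] = l" "N3 ''r'' [] = r" "N3 ''k'' [] = k"
                    "R3 ''z'' = R ''z''" "R3 ''s'' = R' ''s''"
                    using 2 N' R' by (auto simp: agree_def)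
                  show ?case
                    using N3 2 by (intro runs_straight) (auto simp: store_def agree_def)
                qed simp
              qed simp
            qed simp
          next
            fix N'' R'' assume *: "agree {''s'', ''d''} R' R'' \<and> agree {''nl'', ''nr''} N' N''
                \<and> N'' ''nl'' [] = ?nl \<and> N'' ''nr'' [] = ?nr \<and> R'' ''s'' [] = ?s"
            have k: "N'' ''k'' [] = k" using * N' by (auto simp: agree_def)
            have "R'' ''s'' [] = (\<Sum>i=l..<min (Suc k) r. ?z i)"
              unfolding sum_step using * J by (simp add: J_def)
            moreover have "agree {''s'', ''d''} R R''" "agree {''k'', ''nl'', ''nr''} N (store N'' ''k'' [] (Suc k))"
              using * J by (auto simp: J_def agree_def store_def)
            moreover have "N'' ''nl'' [] = l \<and> (\<forall>m<Suc k. l < m \<and> m \<le> r \<longrightarrow> \<not> left_cut R (out N) l m)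
               \<or> l < N'' ''nl'' [] \<and> N'' ''nl'' [] \<le> r \<and> left_cut R (out N) l (N'' ''nl'' [])"
              using J lc * unfolding J_def less_Suc_eq by (cases "l < k \<and> k \<le> r \<and> left_cut R (out N) l k") auto
            moreover have "N'' ''nr'' [] = r \<and> (\<forall>m<Suc k. l \<le> m \<and> m < r \<longrightarrow> \<not> right_cut R (out N) l m)
               \<or> l \<le> N'' ''nr'' [] \<and> N'' ''nr'' [] < r \<and> right_cut R (out N) l (N'' ''nr'' [])"
              using J rc * unfolding J_def less_Suc_eq by (cases "l \<le> k \<and> k < r \<and> right_cut R (out N) l k") auto
            ultimately show "N'' ''k'' [] = k \<and> J (Suc k) (store N'' ''k'' [] (Suc k)) R''"
              using k by (simp add: J_def) (simp add: store_def)
          qed simp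
        next
          case (5 N' R')
          have "m < n + 1" if "m \<le> r" for m using lr that by simp
          then show ?case using 5 unfolding J_def by (meson less_imp_le)
        qed auto
      qed auto
    qed auto
  qed auto
qed

section \<open>Correctness of the program\<close>

lemma rval_power_of_M: "rval s (power_of_M k) = snd s ''M'' [] ^ k"
  by (induction k) auto

lemma rcost_power_of_M: "rcost (power_of_M k) = 2 * k + 1"
  by (induction k) auto

context search_instance begin


lemma reorder_ordering: "ordering \<pi> \<Longrightarrow> reorder p q \<pi> \<pi>' \<Longrightarrow> p \<le> q \<Longrightarrow> q \<le> n \<Longrightarrow> ordering \<pi>'"
  unfolding ordering_def bij_betw_def using reorder_inj by metis

text \<open>At t = 0 the array z contains leftovers, so nothing is claimed about it.\<close>

definition window :: "(nat \<Rightarrow> nat) \<Rightarrow> nat \<Rightarrow> nat \<Rightarrow> nat \<Rightarrow> nat \<Rightarrow> real \<Rightarrow> (nat \<Rightarrow> real) \<Rightarrow> nat \<Rightarrow> bool" where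
  "window \<pi> p q l r \<kappa> z t \<longleftrightarrow> p \<le> l \<and> l \<le> r \<and> r \<le> q
     \<and> strict_lower (pre \<pi> p) (pre \<pi> l) \<kappa> \<and> strict_upper (pre \<pi> r) (pre \<pi> q) \<kappa>
     \<and> (0 < t \<longrightarrow> iterate (pre \<pi> l) (\<pi> ` {l..<r}) \<kappa> z \<and> sorted_seg \<pi> l r z \<and> no_cut \<pi> l r \<kappa> z
          \<and> progress \<pi> l r \<kappa> z (real t))"

lemma window_init: "p \<le> q \<Longrightarrow> window \<pi> p q p q \<kappa> z 0"
  by (auto simp: window_def strict_lower_def strict_upper_def)

lemma window_final:
  assumes "window \<pi> p q l r \<kappa> z t" "ordering \<pi>" "q \<le> n" "0 \<le> \<kappa>" "l < r" "M ^ 81 \<le> real t"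
  shows "flat (pre \<pi> l) (\<pi> ` {l..<r}) \<kappa>"
proof -
  have "0 < M ^ 81" using M2 by simp
  then have "0 < real t" using assms(6) by linarith
  then show ?thesis
    using progress_final[of \<pi> l r \<kappa> z "real t"] assms unfolding window_def by auto
qed

text \<open>At t = 0 the step of length 1 turns z into a greedy vertex, later steps are convex
  combinations. Without a cut the progress is recorded; otherwise both cuts are made at once and the
  shorter window starts afresh.\<close>

lemma window_step:
  assumes w: "window \<pi> p q l r \<kappa> z t" and \<pi>: "ordering \<pi>" "q \<le> n" and \<kappa>: "0 \<le> \<kappa>" and lr: "l < r"
    and z': "\<And>k. k < n \<Longrightarrow> z' (\<pi> k) = z (\<pi> k) + (if 0 < t then 1 / M ^ 37 else 1) * (vertex \<pi> \<kappa> k - z (\<pi> k))"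
    and re: "reorder l r \<pi> \<pi>'" and so: "sorted_seg \<pi>' l r z'"
    and nl: "nl = l \<and> (\<forall>k. l < k \<and> k \<le> r \<longrightarrow> 0 \<le> z' (\<pi>' (k - 1)) + defect \<pi>' l \<kappa> z' k)
      \<or> l < nl \<and> nl \<le> r \<and> z' (\<pi>' (nl - 1)) + defect \<pi>' l \<kappa> z' nl < 0"
    and nr: "nr = r \<and> (\<forall>k. l \<le> k \<and> k < r \<longrightarrow> z' (\<pi>' k) \<le> defect \<pi>' l \<kappa> z' k)
      \<or> l \<le> nr \<and> nr < r \<and> defect \<pi>' l \<kappa> z' nr < z' (\<pi>' nr)"
  shows "nl = l \<Longrightarrow> nr = r \<Longrightarrow> window \<pi>' p q l r \<kappa> z' (Suc t)"
    "nl \<noteq> l \<or> nr \<noteq> r \<Longrightarrow> window \<pi>' p q nl nr \<kappa> z' 0 \<and> nr - nl < r - l"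
proof -
  have b: "p \<le> l" "l \<le> r" "r \<le> q" "r \<le> n" using w \<pi> by (auto simp: window_def)
  have \<pi>': "ordering \<pi>'" using reorder_ordering[OF \<pi>(1) re b(2,4)] .
  have pre: "pre \<pi>' p = pre \<pi> p" "pre \<pi>' l = pre \<pi> l" "pre \<pi>' r = pre \<pi> r" "pre \<pi>' q = pre \<pi> q"
    using reorder_pre[OF re _ b(2)] b by auto
  have seg: "\<pi>' ` {l..<r} = \<pi> ` {l..<r}" using re by (simp add: reorder_def)
  \<comment> \<open>Being an iterate depends only on the set in the window, so the old order can be
    used, whose greedy vertex determined the step.\<close>
  have it: "iterate (pre \<pi>' l) (\<pi>' ` {l..<r}) \<kappa> z'"
  proof (cases "0 < t")
    case True
    have i: "iterate (pre \<pi> l) (\<pi> ` {l..<r}) \<kappa> z" using True w by (simp add: window_def)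
    have c: "0 \<le> 1 / M ^ 37" "1 / M ^ 37 \<le> 1" using one_le_power[of M 37] by simp_all
    show ?thesis unfolding pre seg
    proof (rule iterate_step[OF \<pi>(1) b(2,4) i c])
      fix k assume "l \<le> k" "k < r"
      then show "z' (\<pi> k) = z (\<pi> k) + 1 / M ^ 37 * (vertex \<pi> \<kappa> k - z (\<pi> k))"
        using z'[of k] True b by simp
    qed
  next
    case False
    then show ?thesis unfolding pre seg
      using z' b by (intro iterate_init[OF \<pi>(1) b(2,4)]) auto
  qed
  note w' = w[unfolded window_def]
  show "window \<pi>' p q l r \<kappa> z' (Suc t)" if "nl = l" "nr = r"
  proof -
    have nc: "no_cut \<pi>' l r \<kappa> z'" unfolding no_cut_def
    proof (intro allI impI)
      fix k assume k: "l \<le> k \<and> k < r"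
      have "0 \<le> z' (\<pi>' (Suc k - 1)) + defect \<pi>' l \<kappa> z' (Suc k)" using nl that k by (auto dest: spec[of _ "Suc k"])
      moreover have "z' (\<pi>' k) \<le> defect \<pi>' l \<kappa> z' k" using nr that k by auto
      ultimately show "- defect \<pi>' l \<kappa> z' (Suc k) \<le> z' (\<pi>' k) \<and> z' (\<pi>' k) \<le> defect \<pi>' l \<kappa> z' k" by simp
    qed
    have "progress \<pi>' l r \<kappa> z' (real (Suc t))"
    proof (cases "0 < t")
      case True
      have "progress \<pi> l r \<kappa> z' (real t + 1)"
        by (rule progress_step[of \<pi> l r \<kappa> z]) (use True w' \<pi> b \<kappa> z' in auto)
      then show ?thesis unfolding progress_def pre seg by (simp add: add.commute)
    next
      case False
      then show ?thesis using progress_init[OF \<pi>' b(2,4) it \<kappa> so nc] by simp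
    qed
    then show ?thesis using w' it so nc unfolding window_def pre by simp
  qed
  assume cut: "nl \<noteq> l \<or> nr \<noteq> r"
  \<comment> \<open>The cuts cannot cross: z is negative before a left cut and positive from a right
    cut on.\<close>
  have le: "nl \<le> nr"
  proof (rule ccontr)
    assume "\<not> nl \<le> nr"
    then have lt: "nr < nl" by simp
    then have 1: "l < nl" "nl \<le> r" "z' (\<pi>' (nl - 1)) + defect \<pi>' l \<kappa> z' nl < 0"
      and 2: "l \<le> nr" "nr < r" "defect \<pi>' l \<kappa> z' nr < z' (\<pi>' nr)" using nl nr b lr lt by auto
    have "0 \<le> defect \<pi>' l \<kappa> z' nl" "0 \<le> defect \<pi>' l \<kappa> z' nr"
      using defect_facts(3)[OF \<pi>' b(2,4) it \<kappa>] 1 2 by auto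
    moreover have "z' (\<pi>' nr) \<le> z' (\<pi>' (nl - 1))"
      using so 1 2 lt unfolding sorted_seg_def by (elim allE[of _ nr] allE[of _ "nl - 1"]) auto
    ultimately show False using 1 2 by linarith
  qed
  have lo: "strict_lower (pre \<pi>' p) (pre \<pi>' nl) \<kappa>"
  proof (cases "nl = l")
    case False
    then have 1: "l < nl" "nl \<le> r" "z' (\<pi>' (nl - 1)) + defect \<pi>' l \<kappa> z' nl < 0" using nl by auto
    have s: "pre \<pi>' p \<subseteq> pre \<pi>' l" "pre \<pi>' l \<subseteq> pre \<pi>' nl" "pre \<pi>' nl \<subseteq> {..<n}"
      using b 1 pre_subset[OF \<pi>', of nl] by auto
    show ?thesis
      by (rule strict_lower_trans[OF \<kappa> s _ cut_left[OF \<pi>' b(2,4) it \<kappa> so 1]]) (use w' pre in simp)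
  qed (use w' pre in simp)
  have up: "strict_upper (pre \<pi>' nr) (pre \<pi>' q) \<kappa>"
  proof (cases "nr = r")
    case False
    then have 1: "l \<le> nr" "nr < r" "defect \<pi>' l \<kappa> z' nr < z' (\<pi>' nr)" using nr by auto
    have s: "pre \<pi>' nr \<subseteq> pre \<pi>' r" "pre \<pi>' r \<subseteq> pre \<pi>' q" "pre \<pi>' q \<subseteq> {..<n}"
      using b 1 pre_subset[OF \<pi>' \<pi>(2)] by auto
    show ?thesis
      by (rule strict_upper_trans[OF \<kappa> s cut_right[OF \<pi>' b(2,4) it \<kappa> so 1]]) (use w' pre in simp)
  qed (use w' pre in simp)
  have "l \<le> nl" "nr \<le> r" using nl nr by auto
  then show "window \<pi>' p q nl nr \<kappa> z' 0 \<and> nr - nl < r - l"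
    using lo up le cut lr b unfolding window_def by auto
qed

abbreviation T0 :: nat where "T0 \<equiv> (n + 1) ^ 81"

lemma M_T0: "M ^ 81 = real T0"
  by (simp add: add.commute)

definition env :: "nat memory \<Rightarrow> real memory \<Rightarrow> bool" where
  "env N R \<longleftrightarrow> N ''n'' [] = n \<and> R ''T'' [] = M ^ 81 \<and> R ''tau'' [] = 1 / M ^ 37
     \<and> (\<forall>e<n. R ''key'' [e] = F {e} / gain e)"

lemma env_agree:
  "env N R \<Longrightarrow> agree Y N N' \<Longrightarrow> agree Z R R' \<Longrightarrow> ''n'' \<notin> Y \<Longrightarrow> {''T'', ''tau'', ''key''} \<inter> Z = {} \<Longrightarrow> env N' R'"
  by (auto simp: env_def agree_def)

definition prefix_values :: "nat memory \<Rightarrow> real memory \<Rightarrow> bool" where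
  "prefix_values N R \<longleftrightarrow> (\<forall>k\<le>n. R ''fp'' [k] = F (pre (out N) k) \<and> R ''gp'' [k] = G (pre (out N) k))"

abbreviation zmem :: "real memory \<Rightarrow> nat \<Rightarrow> real" where "zmem R \<equiv> \<lambda>e. R ''z'' [e]"

lemma cut_defect:
  assumes "prefix_values N R" "R ''lam'' [] = \<kappa>" "l \<le> n" "k \<le> n"
  shows "left_cut R (out N) l k \<longleftrightarrow> zmem R (out N (k - 1)) + defect (out N) l \<kappa> (zmem R) k < 0"
    "right_cut R (out N) l k \<longleftrightarrow> defect (out N) l \<kappa> (zmem R) k < zmem R (out N k)"
  using assms by (auto simp: left_cut_def right_cut_def prefix_values_def defect_def pot_def algebra_simps)

abbreviation loop_nvars :: "name set" where
  "loop_nvars \<equiv> {''A'', ''i'', ''j'', ''h'', ''out'', ''k'', ''nl'', ''nr'', ''l'', ''r''}"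
abbreviation loop_rvars :: "name set" where
  "loop_rvars \<equiv> {''fp'', ''gp'', ''z'', ''s'', ''d'', ''c'', ''t''}"

definition loop_inv :: "nat memory \<Rightarrow> real memory \<Rightarrow> nat \<Rightarrow> nat \<Rightarrow> real \<Rightarrow> nat memory \<Rightarrow> real memory \<Rightarrow> bool" where
  "loop_inv N0 R0 p q \<kappa> N R \<longleftrightarrow> env N R \<and> prefix_values N R \<and> ordering (out N) \<and> reorder p q (out N0) (out N)
     \<and> R ''lam'' [] = \<kappa> \<and> agree loop_nvars N0 N \<and> agree loop_rvars R0 R
     \<and> (\<exists>t. R ''t'' [] = real t \<and> window (out N) p q (N ''l'' []) (N ''r'' []) \<kappa> (zmem R) t)"

text \<open>Lexicographic: a cut shortens the window and resets t, and every other step increases t,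
  which is below T0 whenever the body runs. The counter is a real variable, like the bound T, which
  needs multiplication.\<close>

definition loop_measure :: "nat memory \<Rightarrow> real memory \<Rightarrow> nat" where
  "loop_measure N R = (N ''r'' [] - N ''l'' []) * (T0 + 1) + (T0 - nat \<lfloor>R ''t'' []\<rfloor>)"

lemma runs_improve:
  assumes inv: "loop_inv N0 R0 p q \<kappa> N R" and q: "q \<le> n" and \<kappa>: "0 \<le> \<kappa>"
    and lr: "N ''l'' [] < N ''r'' []" and tT: "R ''t'' [] < M ^ 81"
  shows "runs F G n improve N R (\<lambda>N' R'. loop_inv N0 R0 p q \<kappa> N' R' \<and> loop_measure N' R' < loop_measure N R)
    (800 * (n + 1)\<^sup>2)"
proof -
  define l r where lr_def: "l = N ''l'' []" "r = N ''r'' []"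
  obtain t where t: "R ''t'' [] = real t" and w: "window (out N) p q l r \<kappa> (zmem R) t"
    using inv by (auto simp: loop_inv_def lr_def)
  have "real t < real T0" using tT unfolding M_T0 t .
  then have tT0: "t < T0" by (simp only: of_nat_less_iff)
  have b: "p \<le> l" "l < r" "l \<le> r" "r \<le> q" "r \<le> n" "l \<le> n" using w q lr by (auto simp: window_def lr_def)
  have e: "env N R" "prefix_values N R" "ordering (out N)" "R ''lam'' [] = \<kappa>" using inv by (auto simp: loop_inv_def)
  have nn: "N ''n'' [] = n" using e by (simp add: env_def)
  let ?c = "if 0 < t then 1 / M ^ 37 else 1"
  have n2: "n + 1 \<le> (n + 1)\<^sup>2" "1 \<le> n + 1" by (auto simp: power2_eq_square)
  have n3: "(Suc n)\<^sup>2 = Suc (n * n + 2 * n)" by (simp add: power2_eq_square)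
  show ?thesis unfolding improve_def
  proof (rule runs_Seq[where ?k1.0 = 10 and ?k2.0 = "750 * (n + 1)\<^sup>2" and
        P = "\<lambda>N' R'. N' = N \<and> R' = store R ''c'' [] ?c"], goal_cases)
    case 1
    show ?case using t e by (intro runs_straight) (auto simp: env_def)
  next
    case (2 N1 R1)
    have R1: "R1 ''c'' [] = ?c" "agree {''c''} R R1" using 2 by (auto simp: store_def agree_def)
    show ?case
    proof (rule runs_Seq[where ?k1.0 = "100 * (n + 1)" and ?k2.0 = "640 * (n + 1)\<^sup>2" and
          P = "\<lambda>N' R'. agree {''i''} N N' \<and> agree {''z'', ''c''} R R'
            \<and> (\<forall>k<n. zmem R' (out N k) = zmem R (out N k) + ?c * (vertex (out N) \<kappa> k - zmem R (out N k)))"], goal_cases)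
      case 1
      have "N1 = N" using 2 by simp
      show ?case unfolding \<open>N1 = N\<close>
      proof (rule runs_mono[OF runs_move[where N = N and n = n, OF nn orderingD(1)[OF e(3)]]], goal_cases)
        case (1 N' R')
        have "R1 ''lam'' = R ''lam''" "R1 ''fp'' = R ''fp''" "R1 ''gp'' = R ''gp''" "R1 ''z'' = R ''z''"
          using R1 by (auto simp: agree_def)
        moreover have "vertex (out N) \<kappa> k = \<kappa> * (R ''fp'' [Suc k] - R ''fp'' [k]) - (R ''gp'' [Suc k] - R ''gp'' [k])"
          if "k < n" for k using e(2) that by (simp add: prefix_values_def vertex_def incF_def incG_def)
        moreover have "agree {''z'', ''c''} R R'" using 1 R1 by (auto simp: agree_def)
        ultimately show ?case using 1 R1(1) e(4) by simp
      qed simp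
    next
      case (2 N2 R2)
      have N2: "N2 ''n'' [] = n" "N2 ''l'' [] = l" "N2 ''r'' [] = r" "N2 ''out'' = N ''out''"
        using 2 nn by (auto simp: agree_def lr_def)
      show ?case
      proof (rule runs_Seq[where ?k2.0 = "530 * (n + 1)\<^sup>2", OF runs_sort_seg[where N = N2 and n = n and l = l and r = r, OF N2(1,2,3) b(3,5)]], goal_cases)
        case (1 N3 R3)
        have N3: "N3 ''n'' [] = n" "N3 ''l'' [] = l" "N3 ''r'' [] = r" "R3 = R2" using 1 N2 by (auto simp: agree_def)
        have re: "reorder l r (out N) (out N3)" using 1 N2(4) by simp
        have so: "sorted_seg (out N3) l r (zmem R2)" using 1 by (simp add: sorted_seg_def)
        have o3: "ordering (out N3)" by (rule reorder_ordering[OF e(3) re b(3,5)])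
        have lt3: "\<forall>i<n. out N3 i < n" using orderingD(3)[OF o3] by simp
        show ?case
        proof (rule runs_Seq[where ?k2.0 = "420 * (n + 1)\<^sup>2", OF runs_prefixes[where N = N3 and n = n, OF N3(1) lt3]], goal_cases)
          case (1 N4 R4)
          have N4: "N4 ''n'' [] = n" "N4 ''l'' [] = l" "N4 ''r'' [] = r" "N4 ''out'' = N3 ''out''" "R4 ''z'' = R2 ''z''"
            using 1 N3 by (auto simp: agree_def)
          have pv: "prefix_values N4 R4" using 1 unfolding prefix_values_def N4(4) by blast
          have lam: "R4 ''lam'' [] = \<kappa>" using 1 2 N3(4) e(4) by (auto simp: agree_def)
          show ?case
          proof (rule runs_Seq[where ?k2.0 = "100 * (n + 1)\<^sup>2", OF runs_scan[where N = N4 and n = n and l = l and r = r, OF N4(1,2,3) b(3,5)]], goal_cases)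
            case (1 N5 R5)
            define nl nr where "nl = N5 ''nl'' []" and "nr = N5 ''nr'' []"
            have N5: "N5 ''l'' [] = l" "N5 ''r'' [] = r" "N5 ''out'' = N3 ''out''" "R5 ''z'' = R2 ''z''" "R5 ''t'' [] = real t"
              using 1 \<open>agree _ N3 N4 \<and> _\<close> N4 2 N3(4) t by (auto simp: agree_def)
            have R5: "R5 ''fp'' = R4 ''fp''" "R5 ''gp'' = R4 ''gp''" "R5 ''lam'' = R4 ''lam''"
              using 1 by (simp_all add: agree_def)
            have aN: "agree loop_nvars N N5" and aR: "agree loop_rvars R R5"
              using 1 2 \<open>R3 = R2 \<and> _\<close> \<open>agree _ N3 N4 \<and> _\<close> by (auto simp: agree_def)
            have z': "zmem R2 (out N k) = zmem R (out N k) + ?c * (vertex (out N) \<kappa> k - zmem R (out N k))"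
              if "k < n" for k using 2 that by blast
            have kn: "k \<le> n" if "k \<le> r" for k using that b by simp
            have cd: "left_cut R4 (out N4) l k \<longleftrightarrow> zmem R2 (out N3 (k - 1)) + defect (out N3) l \<kappa> (zmem R2) k < 0"
              "right_cut R4 (out N4) l k \<longleftrightarrow> defect (out N3) l \<kappa> (zmem R2) k < zmem R2 (out N3 k)"
              if "k \<le> r" for k
              using cut_defect[OF pv lam b(6) kn[OF that]] N4(4,5) by simp_all
            have nl: "nl = l \<and> (\<forall>k. l < k \<and> k \<le> r \<longrightarrow> 0 \<le> zmem R2 (out N3 (k - 1)) + defect (out N3) l \<kappa> (zmem R2) k)
              \<or> l < nl \<and> nl \<le> r \<and> zmem R2 (out N3 (nl - 1)) + defect (out N3) l \<kappa> (zmem R2) nl < 0"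
              using 1 cd(1) unfolding nl_def by (meson linorder_not_less)
            have nr: "nr = r \<and> (\<forall>k. l \<le> k \<and> k < r \<longrightarrow> zmem R2 (out N3 k) \<le> defect (out N3) l \<kappa> (zmem R2) k)
              \<or> l \<le> nr \<and> nr < r \<and> defect (out N3) l \<kappa> (zmem R2) nr < zmem R2 (out N3 nr)"
              using 1 cd(2) unfolding nr_def by (meson less_imp_le linorder_not_less)
            note ws = window_step[OF w e(3) q \<kappa> b(2) z' re so nl nr]
            have common: "env N' R' \<and> prefix_values N' R' \<and> ordering (out N') \<and> reorder p q (out N0) (out N')
                \<and> R' ''lam'' [] = \<kappa> \<and> agree loop_nvars N0 N' \<and> agree loop_rvars R0 R'"
              if "agree {''l'', ''r''} N5 N'" "agree {''t''} R5 R'" for N' R'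
            proof -
              have o: "N' ''out'' = N3 ''out''" "R' ''fp'' = R4 ''fp''" "R' ''gp'' = R4 ''gp''" "R' ''lam'' = R4 ''lam''"
                using agreeD[OF that(1)] agreeD[OF that(2)] N5 R5 by auto
              have aN': "agree loop_nvars N N'"
                by (rule agree_chain[OF aN agree_mono[OF that(1)]]) simp
              have aR': "agree loop_rvars R R'"
                by (rule agree_chain[OF aR agree_mono[OF that(2)]]) simp
              have "agree loop_nvars N0 N'" "agree loop_rvars R0 R'"
                using inv agree_chain[OF _ aN'] agree_chain[OF _ aR'] unfolding loop_inv_def by blast+
              moreover have "env N' R'" by (rule env_agree[OF e(1) aN' aR']) simp_all
              moreover have "reorder p q (out N0) (out N')"
                unfolding o using inv reorder_trans reorder_mono[OF re b(1,3,4)] by (auto simp: loop_inv_def)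
              moreover have "prefix_values N' R'"
                using pv unfolding prefix_values_def o N4(4) .
              ultimately show ?thesis using o o3 lam by simp
            qed
            show ?case
            proof (cases "nl = l \<and> nr = r")
              case True
              let ?R = "store R5 ''t'' [] (real t + 1)"
              have "window (out N5) p q l r \<kappa> (zmem ?R) (Suc t)" using ws(1) True N5 by (simp add: store_def)
              then have "loop_inv N0 R0 p q \<kappa> N5 ?R"
                unfolding loop_inv_def using common[of N5 ?R] N5
                by (auto simp: agree_refl agree_store intro!: exI[of _ "Suc t"]) (simp_all add: store_def)
              moreover have "loop_measure N5 ?R < loop_measure N R"
              proof -
                have "nat \<lfloor>real t + 1\<rfloor> = Suc t" by linarith
                then show ?thesis using tT0 N5 t unfolding loop_measure_def
                  by (simp add: store_def lr_def)
              qed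
              ultimately show ?thesis
                using True N5 n3 unfolding nl_def nr_def by (intro runs_straight) auto
            next
              case False
              let ?N = "store (store N5 ''l'' [] nl) ''r'' [] nr" and ?R = "store R5 ''t'' [] 0"
              have ws': "window (out N3) p q nl nr \<kappa> (zmem R2) 0 \<and> nr - nl < r - l" using ws(2) False by blast
              have "loop_inv N0 R0 p q \<kappa> ?N ?R"
                unfolding loop_inv_def using common[of ?N ?R] ws' N5
                by (auto simp: agree_refl agree_store intro!: exI[of _ 0]) (simp_all add: store_def)
              moreover have "loop_measure ?N ?R < loop_measure N R"
              proof -
                have "Suc (nr - nl) * (T0 + 1) \<le> (r - l) * (T0 + 1)" using ws' by (intro mult_right_mono) auto
                moreover have "loop_measure ?N ?R = (nr - nl) * (T0 + 1) + T0"
                  by (simp add: loop_measure_def store_def)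
                moreover have "(r - l) * (T0 + 1) \<le> loop_measure N R" by (simp add: loop_measure_def lr_def)
                moreover have "(nr - nl) * (T0 + 1) + T0 < Suc (nr - nl) * (T0 + 1)" by simp
                ultimately show ?thesis by linarith
              qed
              moreover have "l < nl \<or> nr < r" using False nl nr by auto
              ultimately show ?thesis
                using N5 n3 unfolding nl_def nr_def
                by (intro runs_straight) (auto simp: store_def[of N5 "''l''"])
            qed
          qed (use n2 in auto)
        qed (use n2 in auto)
      qed (use n2 in auto)
    qed (use n2 in auto)
  qed (use n2 in auto)
qed

text \<open>Only the set before p and the order between p and q matter, so rearranging other
  segments later does no harm.\<close>

lemma solved_cong:
  assumes s: "solved \<pi> p q" and eq: "\<And>i. p \<le> i \<Longrightarrow> i < q \<Longrightarrow> \<pi>' i = \<pi> i" and pre: "pre \<pi>' p = pre \<pi> p" and "p \<le> q"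
  shows "solved \<pi>' p q"
proof -
  have prek: "pre \<pi>' k = pre \<pi> k" if "p \<le> k" "k \<le> q" for k
  proof -
    have "\<pi>' ` {p..<k} = \<pi> ` {p..<k}" using eq that by (intro image_cong) auto
    then show ?thesis using pre pre_split[OF that(1), of \<pi>] pre_split[OF that(1), of \<pi>'] by simp
  qed
  have img: "\<pi>' ` {p..<q} = \<pi> ` {p..<q}" using eq by (intro image_cong) auto
  have inc: "incF \<pi>' i = incF \<pi> i" "incG \<pi>' i = incG \<pi> i" if "i \<in> {p..<q}" for i
    using that prek[of i] prek[of "Suc i"] by (auto simp: incF_def incG_def)
  have C: "cert \<pi>' p q x y w lab" if c: "cert \<pi> p q x y w lab" for x y w lab
  proof -
    have t: "trid {p..<q} (incF \<pi>') (incG \<pi>') = trid {p..<q} (incF \<pi>) (incG \<pi>)"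
      "trid {p..<q} (\<lambda>i. w (\<pi>' i)) (\<lambda>i. lab (\<pi>' i) * w (\<pi>' i)) = trid {p..<q} (\<lambda>i. w (\<pi> i)) (\<lambda>i. lab (\<pi> i) * w (\<pi> i))"
      using inc eq by (auto intro!: trid_cong)
    have u: "(\<Sum>i=p..<q. incF \<pi>' i) = (\<Sum>i=p..<q. incF \<pi> i)" "(\<Sum>i=p..<q. incG \<pi>' i) = (\<Sum>i=p..<q. incG \<pi> i)"
      "(\<Sum>i=p..<q. w (\<pi>' i)) = (\<Sum>i=p..<q. w (\<pi> i))"
      "(\<Sum>i=p..<q. lab (\<pi>' i) * w (\<pi>' i)) = (\<Sum>i=p..<q. lab (\<pi> i) * w (\<pi> i))"
      using inc eq by (auto intro!: sum.cong)
    have lab: "lab (\<pi>' j) \<le> lab (\<pi>' i)" if "p \<le> i \<and> i \<le> j \<and> j < q" for i j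
      using c that eq[of i] eq[of j] unfolding cert_def by auto
    show ?thesis
      unfolding cert_def pre img t u
      by (insert c[unfolded cert_def], elim conjE, intro conjI; (assumption | (intro allI impI, rule lab, assumption)))
  qed
  show ?thesis
    unfolding solved_def pre img prek[OF assms(4) order_refl]
    by (insert s[unfolded solved_def], elim exE conjE, intro exI conjI, rule C; assumption)
qed

lemma runs_refine:
  assumes inv: "loop_inv N0 R0 p q \<kappa> N R" and q: "q \<le> n" and \<kappa>: "0 \<le> \<kappa>"
  shows "runs F G n refine N R (\<lambda>N' R'. loop_inv N0 R0 p q \<kappa> N' R'
    \<and> \<not> (N' ''l'' [] < N' ''r'' [] \<and> R' ''t'' [] < M ^ 81)) (1700 * (n + 1) ^ 84)"
proof (rule runs_mono)
  let ?b = "BAnd (NLess (nv ''l'') (nv ''r'')) (RLess (rv ''t'') (rv ''T''))"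
  have T: "bval (N, R) ?b \<longleftrightarrow> N ''l'' [] < N ''r'' [] \<and> R ''t'' [] < M ^ 81" if "loop_inv N0 R0 p q \<kappa> N R" for N R
    using that by (simp add: loop_inv_def env_def)
  \<comment> \<open>The window has length at most n, and at most T0 steps separate consecutive
    cuts.\<close>
  let ?K = "n * (T0 + 1) + T0"
  have K: "loop_measure N R \<le> ?K"
  proof -
    have "N ''r'' [] - N ''l'' [] \<le> n" using inv q by (auto simp: loop_inv_def window_def)
    then show ?thesis unfolding loop_measure_def by (intro add_mono mult_right_mono) auto
  qed
  show "runs F G n refine N R (\<lambda>N R. loop_inv N0 R0 p q \<kappa> N R \<and> \<not> bval (N, R) ?b)
      ((?K + 1) * (800 * (n + 1)\<^sup>2 + bcost ?b + 1))"
    unfolding refine_def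
  proof (rule runs_While[where m = loop_measure and I = "loop_inv N0 R0 p q \<kappa>" and N = N and R = R and K = ?K, OF _ inv K])
    fix N R assume i: "loop_inv N0 R0 p q \<kappa> N R" and "bval (N, R) ?b"
    then have lt: "N ''l'' [] < N ''r'' []" "R ''t'' [] < M ^ 81" using T by blast+
    show "runs F G n improve N R (\<lambda>N' R'. loop_inv N0 R0 p q \<kappa> N' R' \<and> loop_measure N' R' < loop_measure N R) (800 * (n + 1)\<^sup>2)"
      by (rule runs_improve[OF i q \<kappa> lt])
  qed
  show "(?K + 1) * (800 * (n + 1)\<^sup>2 + bcost ?b + 1) \<le> 1700 * (n + 1) ^ 84"
  proof -
    have 1: "1 \<le> (n + 1) ^ k" for k by simp
    have "?K + 1 = (n + 1) * (T0 + 1)" by (simp add: algebra_simps)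
    also have "\<dots> \<le> (n + 1) * (2 * T0)" using 1[of 81] by (intro mult_left_mono) auto
    also have "\<dots> = 2 * (n + 1) ^ 82"
    proof -
      have "x * x ^ 81 = x ^ 82" for x :: nat using power_add[of x 1 81] by simp
      then show ?thesis by (simp only: mult.left_commute[of _ 2])
    qed
    finally have 2: "?K + 1 \<le> 2 * (n + 1) ^ 82" .
    have "800 * (n + 1)\<^sup>2 + bcost ?b + 1 \<le> 850 * (n + 1)\<^sup>2"
    proof -
      have "bcost ?b = 7" by simp
      then show ?thesis using 1[of 2] by linarith
    qed
    then have "(?K + 1) * (800 * (n + 1)\<^sup>2 + bcost ?b + 1) \<le> (2 * (n + 1) ^ 82) * (850 * (n + 1)\<^sup>2)"
      using 2 by (intro mult_mono) auto
    also have "\<dots> = 1700 * ((n + 1) ^ 82 * (n + 1)\<^sup>2)" by simp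
    also have "\<dots> = 1700 * (n + 1) ^ 84" by (simp flip: power_add)
    finally show ?thesis .
  qed
  fix N R assume i: "loop_inv N0 R0 p q \<kappa> N R \<and> \<not> bval (N, R) ?b"
  then show "loop_inv N0 R0 p q \<kappa> N R \<and> \<not> (N ''l'' [] < N ''r'' [] \<and> R ''t'' [] < M ^ 81)"
    using T by blast
qed

lemma runs_load_keys:
  assumes n: "N ''n'' [] = n"
  shows "runs F G n load_keys N R (\<lambda>N' R'. agree {''i''} N N' \<and> agree {''z''} R R'
    \<and> (\<forall>e<n. R' ''z'' [e] = R ''key'' [e])) (30 * (n + 1))"
  unfolding load_keys_def
proof (rule runs_For_post[where m = n and kb = 6 and J = "\<lambda>k N' R'. N' ''i'' [] = k \<and> agree {''i''} N N'
    \<and> agree {''z''} R R' \<and> (\<forall>e<k. R' ''z'' [e] = R ''key'' [e])"], goal_cases)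
  case 1
  show ?case by (auto simp: store_def agree_def)
next
  case (2 k N' R')
  then show ?case using n by (auto simp: agree_def)
next
  case (3 k N' R')
  then have "R' ''key'' = R ''key''" by (auto simp: agree_def)
  then show ?case using 3 by (intro runs_straight) (auto simp: store_def agree_def less_Suc_eq)
qed auto

lemma runs_push:
  assumes "{x, y} \<inter> {''lo'', ''hi'', ''sp''} = {}"
  shows "runs F G n (push x y) N R (\<lambda>N' R'. R' = R \<and> agree {''lo'', ''hi'', ''sp''} N N'
    \<and> N' ''sp'' [] = N ''sp'' [] + (if N x [] < N y [] then 1 else 0)
    \<and> (\<forall>i. i \<noteq> N ''sp'' [] \<longrightarrow> N' ''lo'' [i] = N ''lo'' [i] \<and> N' ''hi'' [i] = N ''hi'' [i])
    \<and> (N x [] < N y [] \<longrightarrow> N' ''lo'' [N ''sp'' []] = N x [] \<and> N' ''hi'' [N ''sp'' []] = N y [])) 30"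
  unfolding push_def using assms by (intro runs_straight) (auto simp: store_def agree_def)

text \<open>The outer parts are still untreated here, so \<open>solved\<close> cannot be claimed
  yet. What is recorded survives their later rearrangement, by \<open>node_done_reorder\<close>, and
  both of them are shorter than the segment.\<close>

definition node_done :: "(nat \<Rightarrow> nat) \<Rightarrow> nat \<Rightarrow> nat \<Rightarrow> nat \<Rightarrow> nat \<Rightarrow> bool" where
  "node_done \<pi> p l r q \<longleftrightarrow> p \<le> l \<and> l \<le> r \<and> r \<le> q \<and> l < q \<and> p < r
     \<and> (\<exists>\<kappa>. \<kappa> * (F (pre \<pi> q) - F (pre \<pi> p)) = G (pre \<pi> q) - G (pre \<pi> p)
          \<and> strict_lower (pre \<pi> p) (pre \<pi> l) \<kappa> \<and> strict_upper (pre \<pi> r) (pre \<pi> q) \<kappa>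
          \<and> (l < r \<longrightarrow> flat (pre \<pi> l) (\<pi> ` {l..<r}) \<kappa> \<and> key_sorted \<pi> l r))"

lemma node_doneI:
  assumes \<pi>: "ordering \<pi>" "p < q" "q \<le> n" and w: "window \<pi> p q l r \<kappa> z t"
    and \<kappa>: "\<kappa> * (F (pre \<pi> q) - F (pre \<pi> p)) = G (pre \<pi> q) - G (pre \<pi> p)" "0 \<le> \<kappa>"
    and exit: "\<not> (l < r \<and> real t < M ^ 81)"
    and re: "reorder l r \<pi> \<pi>'" and key: "key_sorted \<pi>' l r"
  shows "node_done \<pi>' p l r q"
proof -
  have b: "p \<le> l" "l \<le> r" "r \<le> q" using w by (auto simp: window_def)
  have pre: "pre \<pi>' p = pre \<pi> p" "pre \<pi>' l = pre \<pi> l" "pre \<pi>' r = pre \<pi> r" "pre \<pi>' q = pre \<pi> q"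
    using reorder_pre[OF re _ b(2)] b by auto
  have seg: "\<pi>' ` {l..<r} = \<pi> ` {l..<r}" using re by (simp add: reorder_def)
  have fl: "flat (pre \<pi> l) (\<pi> ` {l..<r}) \<kappa>" if "l < r"
    using window_final[OF w \<pi>(1,3) \<kappa>(2) that] exit that by simp
  \<comment> \<open>At its own density the segment has equal potential at both ends, so strictness
    excludes l = q and r = p.\<close>
  have eq: "pot \<kappa> (pre \<pi> p) = pot \<kappa> (pre \<pi> q)" using \<kappa> by (simp add: pot_def algebra_simps)
  have ne: "pre \<pi> p \<noteq> pre \<pi> q" using mass_pos(1)[OF \<pi>] by auto
  have sub: "pre \<pi> p \<subseteq> pre \<pi> q" using \<pi> by auto
  have "l < q"
  proof (rule ccontr)
    assume "\<not> l < q"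
    then have "l = q" using b by simp
    then have "pot \<kappa> (pre \<pi> q) < pot \<kappa> (pre \<pi> p)"
      using w ne sub unfolding window_def strict_lower_def by blast
    then show False using eq by simp
  qed
  moreover have "p < r"
  proof (rule ccontr)
    assume "\<not> p < r"
    then have "r = p" using b by simp
    then have "pot \<kappa> (pre \<pi> p) < pot \<kappa> (pre \<pi> q)"
      using w ne sub unfolding window_def strict_upper_def by blast
    then show False using eq by simp
  qed
  ultimately show ?thesis
    unfolding node_done_def pre seg using b \<kappa> w fl key unfolding window_def by blast
qed

abbreviation node_cost :: nat where "node_cost \<equiv> 2200 * (n + 1) ^ 84"

lemma runs_split_node:
  assumes e: "env N R" "ordering (out N)" and pq: "p < q" "q \<le> n"
    and st: "N ''sp'' [] = Suc s" "N ''lo'' [s] = p" "N ''hi'' [s] = q"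
  shows "runs F G n split_node N R (\<lambda>N' R'. \<exists>l r. env N' R' \<and> ordering (out N') \<and> reorder p q (out N) (out N')
      \<and> node_done (out N') p l r q
      \<and> N' ''sp'' [] = s + (if p < l then 1 else 0) + (if r < q then 1 else 0)
      \<and> (\<forall>i<s. N' ''lo'' [i] = N ''lo'' [i] \<and> N' ''hi'' [i] = N ''hi'' [i])
      \<and> (p < l \<longrightarrow> N' ''lo'' [s] = p \<and> N' ''hi'' [s] = l)
      \<and> (r < q \<longrightarrow> N' ''lo'' [s + (if p < l then 1 else 0)] = r \<and> N' ''hi'' [s + (if p < l then 1 else 0)] = q)) node_cost"
proof -
  have n1: "1 \<le> (n + 1) ^ k" for k by simp
  have n2: "(n + 1) \<le> (n + 1) ^ 84" "(n + 1)\<^sup>2 \<le> (n + 1) ^ 84" "1 \<le> (n + 1) ^ 84"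
    using power_increasing[of 1 84 "n + 1"] power_increasing[of 2 84 "n + 1"] n1 by auto
  define B where "B = (n + 1) ^ 84"
  note n2 = n2[folded B_def]
  have nn: "N ''n'' [] = n" using e by (simp add: env_def)
  have lt: "\<forall>i<n. out N i < n" using orderingD(3)[OF e(2)] by simp
  show ?thesis unfolding split_node_def B_def[symmetric]
  proof (rule runs_Seq[where ?k1.0 = 30 and ?k2.0 = "2100 * B" and P = "\<lambda>N' R'. R' = R \<and> agree {''sp'', ''p'', ''q'', ''l'', ''r''} N N'
      \<and> N' ''sp'' [] = s \<and> N' ''p'' [] = p \<and> N' ''q'' [] = q \<and> N' ''l'' [] = p \<and> N' ''r'' [] = q"], goal_cases)
    case 1
    show ?case unfolding pop_def using st by (intro runs_straight) (auto simp: store_def agree_def)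
  next
    case (2 N1 R1)
    have N1: "N1 ''n'' [] = n" "N1 ''out'' = N ''out''" using 2 nn by (auto simp: agree_def)
    have lt1: "\<forall>i<n. out N1 i < n" using lt N1 by simp
    show ?case
    proof (rule runs_Seq[where ?k2.0 = "1999 * B", OF runs_prefixes[where N = N1 and n = n, OF N1(1) lt1]], goal_cases)
      case (1 N2 R2)
      have N2: "N2 ''n'' [] = n" "N2 ''out'' = N ''out''" "N2 ''sp'' [] = s" "N2 ''p'' [] = p" "N2 ''q'' [] = q"
        "N2 ''l'' [] = p" "N2 ''r'' [] = q" "N2 ''lo'' = N ''lo''" "N2 ''hi'' = N ''hi''"
        using 1 2 N1 by (auto simp: agree_def)
      have pv: "prefix_values N2 R2" using 1 N2 N1 unfolding prefix_values_def by simp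
      have aR2: "agree {''fp'', ''gp''} R R2" using 1 2 by simp
      define \<kappa> where "\<kappa> = (G (pre (out N) q) - G (pre (out N) p)) / (F (pre (out N) q) - F (pre (out N) p))"
      note mp = mass_pos[OF e(2) pq]
      have \<kappa>: "\<kappa> * (F (pre (out N) q) - F (pre (out N) p)) = G (pre (out N) q) - G (pre (out N) p)" "0 \<le> \<kappa>"
        using mp by (auto simp: \<kappa>_def)
      show ?case
      proof (rule runs_Seq[where ?k1.0 = 30 and ?k2.0 = "1960 * B" and P = "\<lambda>N' R'. N' = N2 \<and> agree {''lam'', ''t''} R2 R'
          \<and> R' ''lam'' [] = \<kappa> \<and> R' ''t'' [] = 0"], goal_cases)
        case 1
        have "R2 ''gp'' [q] = G (pre (out N) q)" "R2 ''gp'' [p] = G (pre (out N) p)"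
          "R2 ''fp'' [q] = F (pre (out N) q)" "R2 ''fp'' [p] = F (pre (out N) p)"
          using pv pq N2 by (auto simp: prefix_values_def)
        then show ?case unfolding start_def using N2
          by (intro runs_straight) (auto simp: store_def agree_def \<kappa>_def)
      next
        case (2 N3 R3)
        have "loop_inv N2 R3 p q \<kappa> N3 R3"
        proof -
          have N3: "N3 = N2" using 2 by simp
          have "env N2 R3" using e(1) N2 2 aR2 by (auto simp: env_def agree_def)
          moreover have "prefix_values N2 R3" using pv 2 by (auto simp: prefix_values_def agree_def)
          moreover have "window (out N2) p q p q \<kappa> (zmem R3) 0" using window_init pq by simp
          ultimately show ?thesis unfolding loop_inv_def N3 using 2 N2 e(2)
            by (auto simp: reorder_refl agree_refl intro!: exI[of _ "0::nat"])
        qed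
        note rr = runs_refine[OF this pq(2) \<kappa>(2), folded B_def]
        show ?case
        proof (rule runs_Seq[where ?k2.0 = "250 * B", OF rr], goal_cases)
          case (1 N4 R4)
          define l r where "l = N4 ''l'' []" and "r = N4 ''r'' []"
          obtain t where t: "R4 ''t'' [] = real t" and w: "window (out N4) p q l r \<kappa> (zmem R4) t"
            and aN4: "agree loop_nvars N2 N4" and e4: "env N4 R4" "ordering (out N4)" "reorder p q (out N) (out N4)"
            using 1 N2(2) unfolding loop_inv_def l_def r_def by auto
          have b: "p \<le> l" "l \<le> r" "r \<le> q" "r \<le> n" using w pq by (auto simp: window_def)
          have N4: "N4 ''n'' [] = n" "N4 ''sp'' [] = s" "N4 ''p'' [] = p" "N4 ''q'' [] = q"
            "N4 ''lo'' = N ''lo''" "N4 ''hi'' = N ''hi''" using aN4 N2 by (simp_all add: agree_def)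
          show ?case
          proof (rule runs_Seq[where ?k2.0 = "200 * B", OF runs_load_keys[where N = N4, OF N4(1)]], goal_cases)
            case (1 N5 R5)
            have N5: "N5 ''n'' [] = n" "N5 ''l'' [] = l" "N5 ''r'' [] = r" "N5 ''out'' = N4 ''out''"
              and aN5: "agree {''i''} N4 N5" and aR5: "agree {''z''} R4 R5"
              using 1 N4(1) by (auto simp: agree_def l_def r_def)
            have key: "R5 ''z'' [e] = F {e} / gain e" if "e < n" for e
              using 1 e4(1) that by (simp add: env_def)
            show ?case
            proof (rule runs_Seq[where ?k2.0 = 64,
                  OF runs_sort_seg[where N = N5 and n = n and l = l and r = r, OF N5(1,2,3) b(2,4)]], goal_cases)
              case (1 N6 R6)
              have aN6: "agree {''i'', ''j'', ''h'', ''out''} N5 N6" and R6: "R6 = R5" using 1 by auto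
              have N6: "N6 ''sp'' [] = s" "N6 ''p'' [] = p" "N6 ''q'' [] = q" "N6 ''l'' [] = l" "N6 ''r'' [] = r"
                "N6 ''lo'' = N ''lo''" "N6 ''hi'' = N ''hi''"
                using agreeD[OF aN6] agreeD[OF aN5] N4 N5 by auto
              have re: "reorder l r (out N4) (out N6)" using 1 N5(4) by simp
              have o6: "ordering (out N6)" by (rule reorder_ordering[OF e4(2) re b(2,4)])
              have re6: "reorder p q (out N) (out N6)"
                by (rule reorder_trans[OF e4(3) reorder_mono[OF re b(1,2,3)]])
              have ks: "key_sorted (out N6) l r" unfolding key_sorted_def
              proof (intro allI impI)
                fix i j assume ij: "l \<le> i \<and> i < j \<and> j < r"
                then have "out N6 i < n" "out N6 j < n" using orderingD(3)[OF o6] b by auto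
                moreover have "R5 ''z'' [out N6 i] \<le> R5 ''z'' [out N6 j]" using 1 ij by auto
                ultimately show "F {out N6 i} / gain (out N6 i) \<le> F {out N6 j} / gain (out N6 j)"
                  using key by simp
              qed
              have pre4: "pre (out N4) q = pre (out N) q" "pre (out N4) p = pre (out N) p"
                using reorder_pre[OF e4(3)] pq by auto
              have exit: "\<not> (l < r \<and> real t < M ^ 81)"
                using \<open>loop_inv N2 R3 p q \<kappa> N4 R4 \<and> _\<close> t unfolding l_def r_def by auto
              have nd: "node_done (out N6) p l r q"
                by (rule node_doneI[OF e4(2) pq w _ \<kappa>(2) exit re ks]) (use \<kappa>(1) pre4 in simp)
              have e5: "env N5 R5" by (rule env_agree[OF e4(1) aN5 aR5]) simp_all
              have e6: "env N6 R6" unfolding R6 by (rule env_agree[OF e5 aN6 agree_refl[of "{}"]]) simp_all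
              show ?case
              proof (rule runs_Seq[where ?k2.0 = 30, OF runs_push], goal_cases)
                case (2 N7 R7)
                have aN7: "agree {''lo'', ''hi'', ''sp''} N6 N7" and R7: "R7 = R6" using 2 by auto
                have N7: "N7 ''r'' [] = r" "N7 ''q'' [] = q" "N7 ''sp'' [] = s + (if p < l then 1 else 0)"
                  "\<And>i. i \<noteq> s \<Longrightarrow> N7 ''lo'' [i] = N ''lo'' [i] \<and> N7 ''hi'' [i] = N ''hi'' [i]"
                  "p < l \<Longrightarrow> N7 ''lo'' [s] = p \<and> N7 ''hi'' [s] = l"
                  using 2 N6 agreeD[OF aN7] by auto
                show ?case
                proof (rule runs_mono[OF runs_push], goal_cases)
                  case (2 N8 R8)
                  have aN8: "agree {''lo'', ''hi'', ''sp''} N7 N8" and R8: "R8 = R7" using 2 by auto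
                  have o8: "N8 ''out'' = N6 ''out''" using agreeD[OF aN8] agreeD[OF aN7] by simp
                  have e7: "env N7 R7" unfolding R7 by (rule env_agree[OF e6 aN7 agree_refl[of "{}"]]) simp_all
                  have "env N8 R8" unfolding R8 by (rule env_agree[OF e7 aN8 agree_refl[of "{}"]]) simp_all
                  moreover have "N8 ''lo'' [i] = N ''lo'' [i] \<and> N8 ''hi'' [i] = N ''hi'' [i]" if "i < s" for i
                    using 2 N7(3) N7(4)[of i] that by auto
                  moreover have "p < l \<longrightarrow> N8 ''lo'' [s] = p \<and> N8 ''hi'' [s] = l"
                    using 2 N7(3,5) by auto
                  moreover have "N8 ''sp'' [] = s + (if p < l then 1 else 0) + (if r < q then 1 else 0)"
                    using 2 N7(1,2,3) by simp
                  moreover have "r < q \<longrightarrow> N8 ''lo'' [s + (if p < l then 1 else 0)] = r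
                      \<and> N8 ''hi'' [s + (if p < l then 1 else 0)] = q"
                    using 2 N7(1,2,3) by simp
                  ultimately show ?case using o6 re6 nd unfolding o8 by blast
                qed auto
              qed auto
            qed (use n2 in auto)
          qed (use n2 in auto)
        qed (use n2 in auto)
      qed (use n2 in auto)
    qed (use n2 in auto)
  qed (use n2 in auto)
qed

abbreviation step_cost :: nat where "step_cost \<equiv> node_cost + 4"

lemma solved_of_node_done:
  assumes \<pi>: "ordering \<pi>" "p < q" "q \<le> n" and nd: "node_done \<pi> p l r q"
    and "solved \<pi> p l" "solved \<pi> r q"
  shows "solved \<pi> p q"
proof -
  obtain \<kappa> where "\<kappa> * (F (pre \<pi> q) - F (pre \<pi> p)) = G (pre \<pi> q) - G (pre \<pi> p)"
    "strict_lower (pre \<pi> p) (pre \<pi> l) \<kappa>" "strict_upper (pre \<pi> r) (pre \<pi> q) \<kappa>"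
    "l < r \<longrightarrow> flat (pre \<pi> l) (\<pi> ` {l..<r}) \<kappa> \<and> key_sorted \<pi> l r"
    and b: "p \<le> l" "l \<le> r" "r \<le> q"
    using nd unfolding node_done_def by blast
  then show ?thesis
    using solved_node[OF \<pi>(1) b \<pi>(3,2) assms(5) _ assms(6)] strict_density by blast
qed

lemma node_done_reorder:
  assumes nd: "node_done \<pi> p l r q" and re: "reorder p l \<pi> \<pi>' \<or> reorder r q \<pi> \<pi>'"
  shows "node_done \<pi>' p l r q"
proof -
  have b: "p \<le> l" "l \<le> r" "r \<le> q" using nd by (auto simp: node_done_def)
  have pre: "pre \<pi>' p = pre \<pi> p" "pre \<pi>' l = pre \<pi> l" "pre \<pi>' r = pre \<pi> r" "pre \<pi>' q = pre \<pi> q"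
  proof -
    have "pre \<pi>' k = pre \<pi> k" if "k \<le> p \<or> l \<le> k \<and> k \<le> r \<or> q \<le> k" for k
      using re
    proof
      assume "reorder p l \<pi> \<pi>'"
      then show ?thesis by (rule reorder_pre) (use that b in auto)
    next
      assume "reorder r q \<pi> \<pi>'"
      then show ?thesis by (rule reorder_pre) (use that b in auto)
    qed
    then show "pre \<pi>' p = pre \<pi> p" "pre \<pi>' l = pre \<pi> l" "pre \<pi>' r = pre \<pi> r" "pre \<pi>' q = pre \<pi> q"
      using b by blast+
  qed
  have eq: "\<pi>' i = \<pi> i" if "l \<le> i" "i < r" for i using re that by (auto simp: reorder_def)
  then have seg: "\<pi>' ` {l..<r} = \<pi> ` {l..<r}" by (intro image_cong) auto
  have "key_sorted \<pi>' l r = key_sorted \<pi> l r" unfolding key_sorted_def using eq by auto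
  then show ?thesis using nd unfolding node_done_def pre seg by simp
qed

text \<open>Depth-first processing of the topmost segment, in continuation-passing style: what is left to do
  afterwards is the assumption about the states in which the segment has been popped.\<close>

lemma runs_dfs:
  assumes "p < q" "q \<le> n" "env N R" "ordering (out N)" "N ''sp'' [] = Suc s" "N ''lo'' [s] = p" "N ''hi'' [s] = q"
    and "\<And>N' R'. env N' R' \<Longrightarrow> ordering (out N') \<Longrightarrow> reorder p q (out N) (out N') \<Longrightarrow> solved (out N') p q \<Longrightarrow>
      N' ''sp'' [] = s \<Longrightarrow> (\<forall>i<s. N' ''lo'' [i] = N ''lo'' [i] \<and> N' ''hi'' [i] = N ''hi'' [i]) \<Longrightarrow>
      runs F G n main_loop N' R' Q K"
  shows "runs F G n main_loop N R Q (K + (2 * (q - p) - 1) * step_cost)"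
  using assms
proof (induction "q - p" arbitrary: p q N R s K rule: less_induct)
  case less
  note cont = less.prems(8)
  show ?case
  proof (rule runs_While_step[OF _ runs_split_node[OF less.prems(3,4,1,2,5,6,7)], where ?k2.0 = "K + (2 * (q - p) - 2) * step_cost"])
    show "bval (N, R) (NLess (NConst 0) (nv ''sp''))" using less.prems(5) by simp
    show "1 + bcost (NLess (NConst 0) (nv ''sp'')) + node_cost + (K + (2 * (q - p) - 2) * step_cost)
        \<le> K + (2 * (q - p) - 1) * step_cost"
    proof -
      have "2 * (q - p) - 1 = Suc (2 * (q - p) - 2)" using less.prems(1) by simp
      then show ?thesis by simp
    qed
    fix N1 R1
    assume "\<exists>l r. env N1 R1 \<and> ordering (out N1) \<and> reorder p q (out N) (out N1)
      \<and> node_done (out N1) p l r q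
      \<and> N1 ''sp'' [] = s + (if p < l then 1 else 0) + (if r < q then 1 else 0)
      \<and> (\<forall>i<s. N1 ''lo'' [i] = N ''lo'' [i] \<and> N1 ''hi'' [i] = N ''hi'' [i])
      \<and> (p < l \<longrightarrow> N1 ''lo'' [s] = p \<and> N1 ''hi'' [s] = l)
      \<and> (r < q \<longrightarrow> N1 ''lo'' [s + (if p < l then 1 else 0)] = r \<and> N1 ''hi'' [s + (if p < l then 1 else 0)] = q)"
    then obtain l r where e1: "env N1 R1" "ordering (out N1)" and re1: "reorder p q (out N) (out N1)"
      and nd: "node_done (out N1) p l r q"
      and sp1: "N1 ''sp'' [] = s + (if p < l then 1 else 0) + (if r < q then 1 else 0)"
      and st1: "\<forall>i<s. N1 ''lo'' [i] = N ''lo'' [i] \<and> N1 ''hi'' [i] = N ''hi'' [i]"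
      and pl1: "p < l \<longrightarrow> N1 ''lo'' [s] = p \<and> N1 ''hi'' [s] = l"
      and rq1: "r < q \<longrightarrow> N1 ''lo'' [s + (if p < l then 1 else 0)] = r \<and> N1 ''hi'' [s + (if p < l then 1 else 0)] = q"
      by blast
    have b: "p \<le> l" "l \<le> r" "r \<le> q" "l < q" "p < r" "l \<le> n" using nd less.prems(2) by (auto simp: node_done_def)
    let ?s = "s + (if p < l then 1 else 0)"
    let ?K = "K + (if p < l then (2 * (l - p) - 1) * step_cost else 0)"
    \<comment> \<open>The right part is on top of the stack, so the left part is treated in its
      continuation.\<close>
    have left: "runs F G n main_loop N2 R2 Q ?K"
      if e2: "env N2 R2" "ordering (out N2)" and re2: "reorder r q (out N1) (out N2)" and sol: "solved (out N2) r q"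
        and sp2: "N2 ''sp'' [] = ?s"
        and st2: "\<forall>i<?s. N2 ''lo'' [i] = N1 ''lo'' [i] \<and> N2 ''hi'' [i] = N1 ''hi'' [i]" for N2 R2
    proof -
      have nd2: "node_done (out N2) p l r q" using node_done_reorder[OF nd] re2 by blast
      have re2': "reorder p q (out N) (out N2)"
        using reorder_trans[OF re1 reorder_mono[OF re2]] b by simp
      show ?thesis
      proof (cases "p < l")
        case True
        have top: "N2 ''sp'' [] = Suc s" "N2 ''lo'' [s] = p" "N2 ''hi'' [s] = l"
          using sp2 st2 pl1 True by auto
        have "runs F G n main_loop N2 R2 Q (K + (2 * (l - p) - 1) * step_cost)"
        proof (rule less.hyps[OF _ True b(6) e2 top])
          show "l - p < q - p" using b by simp
          fix N3 R3
          assume e3: "env N3 R3" "ordering (out N3)" and re3: "reorder p l (out N2) (out N3)"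
            and sol3: "solved (out N3) p l" and sp3: "N3 ''sp'' [] = s"
            and st3: "\<forall>i<s. N3 ''lo'' [i] = N2 ''lo'' [i] \<and> N3 ''hi'' [i] = N2 ''hi'' [i]"
          have nd3: "node_done (out N3) p l r q" using node_done_reorder[OF nd2] re3 by blast
          have "solved (out N3) r q"
          proof (rule solved_cong[OF sol])
            show "pre (out N3) r = pre (out N2) r" using reorder_pre[OF re3] b by simp
          qed (use re3 b in \<open>auto simp: reorder_def\<close>)
          then have "solved (out N3) p q"
            by (rule solved_of_node_done[OF e3(2) less.prems(1,2) nd3 sol3])
          moreover have "reorder p q (out N) (out N3)"
            using reorder_trans[OF re2' reorder_mono[OF re3]] b by simp
          moreover have "\<forall>i<s. N3 ''lo'' [i] = N ''lo'' [i] \<and> N3 ''hi'' [i] = N ''hi'' [i]"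
            using st1 st2 st3 by simp
          ultimately show "runs F G n main_loop N3 R3 Q K" using cont e3 sp3 by blast
        qed
        then show ?thesis using True by simp
      next
        case False
        then have pl: "l = p" using b by simp
        have "solved (out N2) p q"
          by (rule solved_of_node_done[OF e2(2) less.prems(1,2) nd2 _ sol]) (simp add: pl solved_empty)
        moreover have "\<forall>i<s. N2 ''lo'' [i] = N ''lo'' [i] \<and> N2 ''hi'' [i] = N ''hi'' [i]"
          using st1 st2 by simp
        ultimately have "runs F G n main_loop N2 R2 Q K" using cont e2 re2' sp2 False by simp
        then show ?thesis using False by simp
      qed
    qed
    have "runs F G n main_loop N1 R1 Q (?K + (if r < q then (2 * (q - r) - 1) * step_cost else 0))"
    proof (cases "r < q")
      case True
      have top: "N1 ''sp'' [] = Suc ?s" "N1 ''lo'' [?s] = r" "N1 ''hi'' [?s] = q"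
        using sp1 rq1 True by auto
      have "runs F G n main_loop N1 R1 Q (?K + (2 * (q - r) - 1) * step_cost)"
      proof (rule less.hyps[OF _ True less.prems(2) e1 top])
        show "q - r < q - p" using b by simp
      qed (rule left)
      then show ?thesis using True by simp
    next
      case False
      then have "r = q" using b by simp
      then have "runs F G n main_loop N1 R1 Q ?K"
        using e1 sp1 by (intro left) (auto simp: reorder_refl solved_empty)
      then show ?thesis using False by simp
    qed
    then show "runs F G n main_loop N1 R1 Q (K + (2 * (q - p) - 2) * step_cost)"
    proof (rule runs_mono)
      \<comment> \<open>The outer parts are disjoint and each is shorter than the segment; this
        yields at most 2 (q - p) - 1 nodes in the recursion tree.\<close>
      have "(if p < l then 2 * (l - p) - 1 else 0) + (if r < q then 2 * (q - r) - 1 else 0) \<le> 2 * (q - p) - 2"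
        using b by auto
      then have "((if p < l then 2 * (l - p) - 1 else 0) + (if r < q then 2 * (q - r) - 1 else 0)) * step_cost
          \<le> (2 * (q - p) - 2) * step_cost" by (rule mult_right_mono) simp
      then show "?K + (if r < q then (2 * (q - r) - 1) * step_cost else 0) \<le> K + (2 * (q - p) - 2) * step_cost"
        by (auto simp: distrib_right split: if_splits)
    qed
  qed
qed

lemma runs_keys:
  assumes n: "N ''n'' [] = n" and gn: "R ''gp'' [n] = G {..<n}"
  shows "runs F G n keys N R (\<lambda>N' R'. agree {''A'', ''j'', ''k''} N N' \<and> agree {''key'', ''g''} R R'
    \<and> (\<forall>e<n. R' ''key'' [e] = F {e} / gain e)) (200 * (n + 1)\<^sup>2)"
  unfolding keys_def
proof (rule runs_For_post[where m = n and kb = "100 * (n + 1)" and J = "\<lambda>k N' R'. N' ''k'' [] = k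
    \<and> agree {''A'', ''j'', ''k''} N N' \<and> agree {''key'', ''g''} R R' \<and> (\<forall>e<k. R' ''key'' [e] = F {e} / gain e)"], goal_cases)
  case 1
  show ?case by (auto simp: store_def agree_def)
next
  case (2 k N' R')
  then show ?case using n by (auto simp: agree_def)
next
  case (3 k N1 R1)
  then have aN1: "agree {''A'', ''j'', ''k''} N N1" and aR1: "agree {''key'', ''g''} R R1" and k1: "N1 ''k'' [] = k"
    and old: "\<forall>e<k. R1 ''key'' [e] = F {e} / gain e" by auto
  have n1: "N1 ''n'' [] = n" using agreeD[OF aN1] n by simp
  show ?case
  proof (rule runs_Seq[where ?k2.0 = "60 * (n + 1)", OF runs_fill_row[where N = N1 and n = n, OF n1]], goal_cases)
    case (1 N2 R2)
    then have aN2: "agree {''A'', ''j''} N1 N2" and R2: "R2 = R1" and A2: "\<forall>i<n. N2 ''A'' [i] = 0" by auto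
    have k2: "N2 ''k'' [] = k" "N2 ''n'' [] = n" using agreeD[OF aN2] k1 n1 by auto
    have row: "row_set n (store N2 ''A'' [k] 1) ''A'' [] = {k}"
      using A2 \<open>k < n\<close> by (auto simp: row_set_def store_def)
    show ?case
    proof (rule runs_Seq[where ?k1.0 = 10 and ?k2.0 = "49 * (n + 1)" and P = "\<lambda>N' R'. agree {''A''} N2 N'
        \<and> agree {''key''} R2 R' \<and> (\<forall>e. R' ''key'' [e] = (if e = k then F {k} else R2 ''key'' [e]))"], goal_cases)
      case 1
      show ?case using row k2 by (intro runs_straight) (auto simp: store_def agree_def)
    next
      case (2 N3 R3)
      then have aN3: "agree {''A''} N2 N3" and aR3: "agree {''key''} R2 R3"
        and key3: "\<forall>e. R3 ''key'' [e] = (if e = k then F {k} else R2 ''key'' [e])" by auto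
      have n3: "N3 ''n'' [] = n" "N3 ''k'' [] = k" using agreeD[OF aN3] k2 by auto
      show ?case
      proof (rule runs_Seq[where ?k2.0 = "18", OF runs_fill_row[where N = N3 and n = n, OF n3(1)]], goal_cases)
        case (1 N4 R4)
        then have aN4: "agree {''A'', ''j''} N3 N4" and R4: "R4 = R3" and A4: "\<forall>i<n. N4 ''A'' [i] = 1" by auto
        have k4: "N4 ''k'' [] = k" "N4 ''n'' [] = n" using agreeD[OF aN4] n3 by auto
        have row: "row_set n (store N4 ''A'' [k] 0) ''A'' [] = {..<n} - {k}"
          using A4 by (auto simp: row_set_def store_def)
        have gp4: "R4 ''gp'' [n] = G {..<n}"
          using gn agreeD[OF aR1] agreeD[OF aR3] unfolding R4 R2 by simp
        have key4: "R4 ''key'' [k] = F {k}" using key3 R4 by simp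
        let ?N = "store N4 ''A'' [k] 0"
        let ?R = "store (store R4 ''g'' [] (G ({..<n} - {k}))) ''key'' [k] (F {k} / gain k)"
        have aN: "agree {''A'', ''j'', ''k''} N (store ?N ''k'' [] (Suc k))"
        proof -
          have "agree {''A'', ''j'', ''k''} N1 N4"
            using aN2 aN3 aN4 by (auto simp: agree_def)
          then have "agree {''A'', ''j'', ''k''} N N4" using agree_chain[OF aN1] by blast
          then show ?thesis by (intro agree_store) auto
        qed
        have aR: "agree {''key'', ''g''} R ?R"
        proof -
          have "agree {''key'', ''g''} R1 R4" using aR3 R4 R2 by (auto simp: agree_def)
          then have "agree {''key'', ''g''} R R4" using agree_chain[OF aR1] by blast
          then show ?thesis by (intro agree_store) auto
        qed
        have new: "\<forall>e<Suc k. ?R ''key'' [e] = F {e} / gain e"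
          using old key3 R4 R2 by (auto simp: store_def less_Suc_eq)
        have eff: "effect F G n (Seq (NAssign ''A'' [nv ''k''] (NConst 0)) (Seq (QueryG ''g'' [] ''A'' [])
         (RAssign ''key'' [nv ''k''] (RDiv (RVar ''key'' [nv ''k'']) (RSub (RVar ''gp'' [nv ''n'']) (rv ''g''))))))
          (N4, R4) = (?N, ?R)"
          using k4 row gp4 key4 by (simp add: gain_def) (simp add: store_def)
        show ?case
        proof (rule runs_straight, goal_cases)
          case 2
          have "?N ''k'' [] = k" using k4 by (simp add: store_def)
          then show ?case unfolding eff fst_conv snd_conv using aN aR new by (simp add: store_def)
        qed auto
      qed auto
    qed auto
  qed auto
next
  case 4
  show ?case by (simp add: power2_eq_square algebra_simps)
qed auto

lemma runs_init_order:
  assumes n: "N ''n'' [] = n" and M: "R ''M'' [] = 1"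
  shows "runs F G n init_order N R (\<lambda>N' R'. agree {''i'', ''out''} N N' \<and> (\<forall>i<n. out N' i = i) \<and> R' ''M'' [] = M) (50 * (n + 1))"
  unfolding init_order_def
proof (rule runs_For_post[where m = n and kb = 20 and J = "\<lambda>k N' R'. N' ''i'' [] = k
    \<and> agree {''i'', ''out''} N N' \<and> (\<forall>i<k. out N' i = i) \<and> R' ''M'' [] = real k + 1"], goal_cases)
  case 1
  show ?case using M by (auto simp: store_def agree_def)
next
  case (2 k N' R')
  then show ?case using n by (auto simp: agree_def)
next
  case (3 k N' R')
  then show ?case by (intro runs_straight) (auto simp: store_def agree_def less_Suc_eq)
qed auto

lemma runs_init_rest:
  assumes "N ''n'' [] = n" "R ''M'' [] = M"
  shows "runs F G n init_rest N R (\<lambda>N' R'. agree {''sp'', ''lo'', ''hi''} N N' \<and> agree {''T'', ''tau''} R R'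
    \<and> R' ''T'' [] = M ^ 81 \<and> R' ''tau'' [] = 1 / M ^ 37
    \<and> N' ''sp'' [] = 1 \<and> N' ''lo'' [0] = 0 \<and> N' ''hi'' [0] = n) 300"
  unfolding init_rest_def using assms
  by (intro runs_straight) (simp_all add: rval_power_of_M rcost_power_of_M store_def agree_def)

lemma runs_program:
  assumes n_eq: "N ''n'' [] = n"
  shows "runs F G n program N R (\<lambda>N' R'. ordering (out N') \<and> solved (out N') 0 n) (6000 * (n + 1) ^ 85)"
proof -
  define B C where "B = (n + 1) ^ 84" and "C = (n + 1) ^ 85"
  have C: "C = (n + 1) * B" using power_add[of "n + 1" 1 84] by (simp add: B_def C_def)
  have n2: "(n + 1) \<le> C" "(n + 1)\<^sup>2 \<le> C" "1 \<le> C" "B \<le> C"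
    unfolding B_def C_def
    using power_increasing[of 1 85 "n + 1"] power_increasing[of 2 85 "n + 1"]
      power_increasing[of 84 85 "n + 1"] by auto
  have loopC: "(2 * (n - 0) - 1) * (2200 * B + 4) \<le> 4408 * C"
  proof -
    have "1 \<le> B" unfolding B_def by simp
    then have "(2 * (n - 0) - 1) * (2200 * B + 4) \<le> (2 * (n + 1)) * (2204 * B)" by (intro mult_mono) auto
    then show ?thesis unfolding C by simp
  qed
  show ?thesis unfolding program_def C_def[symmetric]
  proof (rule runs_Seq[where ?k1.0 = 2 and ?k2.0 = "5900 * C" and P = "\<lambda>N' R'. N' = N \<and> R' ''M'' [] = 1"], goal_cases)
    case 1
    show ?case by (rule runs_straight) (auto simp: store_def)
  next
    case (2 N1 R1)
    then have N1: "N1 ''n'' [] = n" and M1: "R1 ''M'' [] = 1" using n_eq by auto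
    show ?case
    proof (rule runs_Seq[where ?k2.0 = "5800 * C", OF runs_init_order[where N = N1 and R = R1, OF N1 M1]], goal_cases)
      case (1 N2 R2)
      then have aN2: "agree {''i'', ''out''} N1 N2" and o2: "\<forall>i<n. out N2 i = i" and M2': "R2 ''M'' [] = M" by auto
      have n2': "N2 ''n'' [] = n" using agreeD[OF aN2] N1 by simp
      have lt2: "\<forall>i<n. out N2 i < n" using o2 by simp
      have im2: "pre (out N2) n = {..<n}" using o2 by force
      show ?case
      proof (rule runs_Seq[where ?k2.0 = "5600 * C", OF runs_prefixes[where N = N2 and n = n and R = R2, OF n2' lt2]], goal_cases)
        case (1 N3 R3)
        then have aN3: "agree {''A'', ''i'', ''j''} N2 N3" and aR3: "agree {''fp'', ''gp''} R2 R3"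
          and "R3 ''gp'' [n] = G (pre (out N2) n)" by auto
        then have gn: "R3 ''gp'' [n] = G {..<n}" unfolding im2 by simp
        have n3: "N3 ''n'' [] = n" "N3 ''out'' = N2 ''out''" using agreeD[OF aN3] n2' by auto
        have M3: "R3 ''M'' [] = M" using agreeD[OF aR3] M2' by simp
        show ?case
        proof (rule runs_Seq[where ?k2.0 = "5000 * C", OF runs_keys[where N = N3 and R = R3, OF n3(1) gn]], goal_cases)
          case (1 N4 R4)
          then have aN4: "agree {''A'', ''j'', ''k''} N3 N4" and aR4: "agree {''key'', ''g''} R3 R4"
            and key4: "\<forall>e<n. R4 ''key'' [e] = F {e} / gain e" by auto
          have n4: "N4 ''n'' [] = n" "N4 ''out'' = N2 ''out''" using agreeD[OF aN4] n3 by auto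
          have M4: "R4 ''M'' [] = M" using agreeD[OF aR4] M3 by simp
          show ?case
          proof (rule runs_Seq[where ?k2.0 = "4500 * C", OF runs_init_rest[where N = N4 and R = R4, OF n4(1) M4]], goal_cases)
            case (1 N5 R5)
            then have aN5: "agree {''sp'', ''lo'', ''hi''} N4 N5" and aR5: "agree {''T'', ''tau''} R4 R5"
              and T5: "R5 ''T'' [] = M ^ 81" "R5 ''tau'' [] = 1 / M ^ 37"
              and st5: "N5 ''sp'' [] = Suc 0" "N5 ''lo'' [0] = 0" "N5 ''hi'' [0] = n" by auto
            have n5: "N5 ''n'' [] = n" "N5 ''out'' = N2 ''out''" using agreeD[OF aN5] n4 by auto
            have "R5 ''key'' = R4 ''key''" using agreeD[OF aR5] by simp
            then have e5: "env N5 R5" using n5 T5 key4 by (simp add: env_def)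
            have o5: "ordering (out N5)"
              unfolding ordering_def using bij_betw_cong[of "{..<n}" "\<lambda>i. i" "out N5"] o2 n5 bij_betw_id[of "{..<n}"]
              by (auto simp: id_def)
            have "runs F G n main_loop N5 R5 (\<lambda>N' R'. ordering (out N') \<and> solved (out N') 0 n)
                (10 + (2 * (n - 0) - 1) * step_cost)"
              by (rule runs_dfs[OF n order_refl e5 o5 st5]) (auto intro!: runs_While_end)
            then show ?case
            proof (rule runs_mono)
              show "10 + (2 * (n - 0) - 1) * step_cost \<le> 4500 * C"
                using loopC n2 unfolding B_def by linarith
            qed auto
          qed (use n2 in auto)
        qed (use n2 in auto)
      qed (use n2 in auto)
    qed (use n2 in auto)
  qed (use n2 in auto)
qed

end

section \<open>Transfer to arbitrary ground sets\<close>

lemma takeWhile_nth: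
  assumes "distinct \<pi>" "k < length \<pi>"
  shows "takeWhile (\<lambda>i. i \<noteq> \<pi> ! k) \<pi> = take k \<pi>"
proof -
  define e where "e = \<pi> ! k"
  have eq: "take k \<pi> @ e # drop (Suc k) \<pi> = \<pi>"
    unfolding e_def using assms(2) by (rule id_take_nth_drop[symmetric])
  have "e \<notin> set (take k \<pi>)"
    unfolding e_def using assms by (auto simp: in_set_conv_nth nth_eq_iff_index_eq)
  then have "takeWhile (\<lambda>i. i \<noteq> e) (take k \<pi> @ e # drop (Suc k) \<pi>) = take k \<pi>"
    by (subst takeWhile_append2) auto
  then show ?thesis unfolding eq by (simp add: e_def)
qed

lemma search_cost_sequence:
  assumes \<pi>: "\<pi> \<in> permutations_of_set S"
  shows "search_cost S f g \<pi> = (\<Sum>k<length \<pi>. (g (set (take (Suc k) \<pi>)) - g (set (take k \<pi>))) * f (set (take (Suc k) \<pi>)))"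
proof -
  have d: "distinct \<pi>" "set \<pi> = S" using \<pi> by (auto simp: permutations_of_set_def)
  have up: "searched_upto \<pi> (\<pi> ! k) = set (take (Suc k) \<pi>)" "set (take (Suc k) \<pi>) - {\<pi> ! k} = set (take k \<pi>)"
    if "k < length \<pi>" for k
  proof -
    have "\<pi> ! k \<notin> set (take k \<pi>)" using d that by (auto simp: in_set_conv_nth nth_eq_iff_index_eq)
    then show "searched_upto \<pi> (\<pi> ! k) = set (take (Suc k) \<pi>)" "set (take (Suc k) \<pi>) - {\<pi> ! k} = set (take k \<pi>)"
      using takeWhile_nth[OF d(1) that] that by (auto simp: searched_upto_def take_Suc_conv_app_nth)
  qed
  have "search_cost S f g \<pi> = (\<Sum>k<length \<pi>. (g (searched_upto \<pi> (\<pi> ! k)) - g (searched_upto \<pi> (\<pi> ! k) - {\<pi> ! k}))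
      * f (searched_upto \<pi> (\<pi> ! k)))"
    unfolding search_cost_def
    by (rule sum.reindex_bij_betw[symmetric]) (use bij_betw_nth[OF d(1)] d(2) in auto)
  then show ?thesis using up by simp
qed

lemma curvature_facts:
  assumes S: "finite S" "S \<noteq> {}" and u0: "u {} = 0" and sub: "submodular_on S u"
    and pos: "\<forall>s\<in>S. 0 < u {s}"
  shows "1 - total_curvature S u \<le> 1"
    "s \<in> S \<Longrightarrow> (1 - total_curvature S u) * u {s} \<le> u S - u (S - {s})"
proof -
  let ?h = "\<lambda>s. (u S - u (S - {s})) / u {s}"
  have eq: "1 - total_curvature S u = Min (?h ` S)" by (simp add: total_curvature_def)
  have le: "1 - total_curvature S u \<le> ?h s" if "s \<in> S" for s
    unfolding eq using S that by (intro Min_le) auto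
  show "(1 - total_curvature S u) * u {s} \<le> u S - u (S - {s})" if "s \<in> S"
    using le[OF that] pos that by (simp add: le_divide_eq)
  obtain s where s: "s \<in> S" using S by blast
  have "u ((S - {s}) \<union> {s}) + u ((S - {s}) \<inter> {s}) \<le> u (S - {s}) + u {s}"
    using sub s unfolding submodular_on_def by blast
  moreover have "(S - {s}) \<union> {s} = S" "(S - {s}) \<inter> {s} = {}" using s by auto
  ultimately have "?h s \<le> 1" using pos s u0 by (simp add: divide_le_eq_1)
  then show "1 - total_curvature S u \<le> 1" using le[OF s] by linarith
qed

lemma submodular_on_image:
  assumes "submodular_on (h ` U) u" "inj_on h U"
  shows "submodular_on U (\<lambda>I. u (h ` I))"
  unfolding submodular_on_def
proof (intro allI impI)
  fix A B assume AB: "A \<subseteq> U" "B \<subseteq> U"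
  have "h ` (A \<inter> B) = h ` A \<inter> h ` B" using assms(2) AB by (rule inj_on_image_Int)
  moreover have "h ` A \<subseteq> h ` U" "h ` B \<subseteq> h ` U" using AB by auto
  ultimately show "u (h ` (A \<union> B)) + u (h ` (A \<inter> B)) \<le> u (h ` A) + u (h ` B)"
    using assms(1) by (simp add: submodular_on_def image_Un)
qed

lemma search_instance_index:
  fixes S :: "'a set" and xs :: "'a list"
  assumes S: "finite S" "S \<noteq> {}" and xs: "xs \<in> permutations_of_set S"
    and f: "submodular_on S f" "f {} = 0" "\<forall>A. A \<subseteq> S \<and> A \<noteq> {} \<longrightarrow> 0 < f A" "total_curvature S f < 1"
    and g: "supermodular_on S g" "g {} = 0" "\<forall>A. A \<subseteq> S \<and> A \<noteq> S \<longrightarrow> g A < g S"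
      "total_curvature S (dual S g) < 1"
  shows "search_instance (length xs) (\<lambda>I. f ((!) xs ` I)) (\<lambda>I. g ((!) xs ` I))
    (1 - total_curvature S f) (1 - total_curvature S (dual S g))"
proof -
  let ?n = "length xs"
  have d: "distinct xs" "set xs = S" using xs by (auto simp: permutations_of_set_def)
  have im: "(!) xs ` {..<?n} = S" and inj: "inj_on ((!) xs) {..<?n}"
    using bij_betw_nth[OF d(1), of "{..<?n}" "set xs"] d(2) by (auto simp: bij_betw_def)
  have rem: "(!) xs ` ({..<?n} - {e}) = S - {xs ! e}" if "e < ?n" for e
    using inj_on_image_set_diff[OF inj, of "{..<?n}" "{e}"] im that by simp
  have mem: "xs ! e \<in> S" if "e < ?n" for e using that d(2) by auto
  \<comment> \<open>Under duality, singleton values and last marginals change places.\<close>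
  have du: "dual S g {} = 0" "submodular_on S (dual S g)"
    "\<And>s. s \<in> S \<Longrightarrow> dual S g {s} = g S - g (S - {s})"
    "\<And>s. s \<in> S \<Longrightarrow> dual S g S - dual S g (S - {s}) = g {s}"
  proof -
    show "submodular_on S (dual S g)" unfolding submodular_on_def
    proof (intro allI impI)
      fix A B assume "A \<subseteq> S" "B \<subseteq> S"
      have "g (S - A) + g (S - B) \<le> g ((S - A) \<union> (S - B)) + g ((S - A) \<inter> (S - B))"
        using g(1) unfolding supermodular_on_def by blast
      moreover have "(S - A) \<union> (S - B) = S - A \<inter> B" "(S - A) \<inter> (S - B) = S - (A \<union> B)" by auto
      ultimately show "dual S g (A \<union> B) + dual S g (A \<inter> B) \<le> dual S g A + dual S g B"
        by (simp add: dual_def)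
    qed
    fix s assume s: "s \<in> S"
    then have "S - (S - {s}) = {s}" by auto
    then show "dual S g S - dual S g (S - {s}) = g {s}" using g(2) by (simp add: dual_def)
  qed (auto simp: dual_def)
  have fpos: "\<forall>s\<in>S. 0 < f {s}" using f(3) by auto
  have gpos: "0 < g S - g (S - {s})" if "s \<in> S" for s
  proof -
    have "S - {s} \<subseteq> S \<and> S - {s} \<noteq> S" using that by auto
    then have "g (S - {s}) < g S" using g(3) by blast
    then show ?thesis by simp
  qed
  have dpos: "\<forall>s\<in>S. 0 < dual S g {s}" using gpos du(3) by simp
  note cf = curvature_facts[OF S f(2,1) fpos] and cg = curvature_facts[OF S du(1,2) dpos]
  show ?thesis
  proof
    show "0 < ?n" using S d by auto
    show "submodular_on {..<?n} (\<lambda>I. f ((!) xs ` I))"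
      using submodular_on_image[of "(!) xs" "{..<?n}" f] f(1) inj unfolding im by blast
    have "submodular_on {..<?n} (\<lambda>I. - g ((!) xs ` I))"
      using submodular_on_image[of "(!) xs" "{..<?n}" "\<lambda>X. - g X"] supermodular_on_uminus[OF g(1)] inj unfolding im by blast
    then show "supermodular_on {..<?n} (\<lambda>I. g ((!) xs ` I))"
      unfolding submodular_on_def supermodular_on_def by (simp add: algebra_simps)
    fix e assume e: "e < ?n"
    show "0 < f ((!) xs ` {e})" using fpos mem[OF e] by simp
    show "(1 - total_curvature S f) * f ((!) xs ` {e}) \<le> f ((!) xs ` {..<?n}) - f ((!) xs ` ({..<?n} - {e}))"
      unfolding im rem[OF e] using cf(2)[OF mem[OF e]] by simp
    show "0 < g ((!) xs ` {..<?n}) - g ((!) xs ` ({..<?n} - {e}))"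
      unfolding im rem[OF e] using gpos[OF mem[OF e]] .
    show "(1 - total_curvature S (dual S g)) * (g ((!) xs ` {..<?n}) - g ((!) xs ` ({..<?n} - {e}))) \<le> g ((!) xs ` {e})"
      unfolding im rem[OF e] using cg(2)[OF mem[OF e]] du(3,4)[OF mem[OF e]] by simp
  qed (use f g cf(1) cg(1) in auto)
qed

theorem theorem3:
  shows "\<exists>(c :: com) (p :: nat poly).
    \<forall>(S :: 'a set) (xs :: 'a list) (f :: 'a set \<Rightarrow> real) (g :: 'a set \<Rightarrow> real).
      finite S \<and> S \<noteq> {} \<and> xs \<in> permutations_of_set S
      \<and> (\<forall>A. A \<subseteq> S \<longrightarrow> 0 \<le> f A) \<and> mono_on (Pow S) f \<and> submodular_on S f
      \<and> f {} = 0 \<and> (\<forall>A. A \<subseteq> S \<and> A \<noteq> {} \<longrightarrow> 0 < f A)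
      \<and> (\<forall>A. A \<subseteq> S \<longrightarrow> 0 \<le> g A) \<and> mono_on (Pow S) g \<and> supermodular_on S g
      \<and> g {} = 0 \<and> (\<forall>A. A \<subseteq> S \<and> A \<noteq> S \<longrightarrow> g A < g S)
      \<and> total_curvature S f < 1 \<and> total_curvature S (dual S g) < 1
      \<longrightarrow>
      (\<exists>t \<pi>. computes_list c xs f g t \<pi> \<and> t \<le> poly p (card S)
        \<and> \<pi> \<in> permutations_of_set S
        \<and> (let \<kappa>f = total_curvature S f;
               \<kappa>g = total_curvature S (dual S g);
               \<theta> = (1 - \<kappa>f) * (1 - \<kappa>g);
               \<delta> = min \<theta> (2 * \<theta> * max (1 - \<kappa>f) (1 - \<kappa>g) / (1 + \<theta>))
           in has_approx_ratio S f g \<pi> (2 / (1 + \<delta>))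
              \<and> (modular_on S f \<or> modular_on S g \<longrightarrow> has_approx_ratio S f g \<pi> (2 / (1 + \<theta>)))))"
proof (rule exI[of _ program], rule exI[of _ "[:6000:] * [:1, 1:] ^ 85"], intro allI impI, elim conjE)
  fix S :: "'a set" and xs :: "'a list" and f g :: "'a set \<Rightarrow> real"
  assume S: "finite S" "S \<noteq> {}" and xs: "xs \<in> permutations_of_set S"
    and f0: "\<forall>A. A \<subseteq> S \<longrightarrow> 0 \<le> f A"
    and f: "submodular_on S f" "f {} = 0" "\<forall>A. A \<subseteq> S \<and> A \<noteq> {} \<longrightarrow> 0 < f A"
    and mono: "mono_on (Pow S) g"
    and g: "supermodular_on S g" "g {} = 0" "\<forall>A. A \<subseteq> S \<and> A \<noteq> S \<longrightarrow> g A < g S"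
    and \<kappa>: "total_curvature S f < 1" "total_curvature S (dual S g) < 1"
  define n a b where "n = length xs" and "a = 1 - total_curvature S f" and "b = 1 - total_curvature S (dual S g)"
  let ?F = "\<lambda>I. f ((!) xs ` I)" and ?G = "\<lambda>I. g ((!) xs ` I)"
  interpret search_instance n ?F ?G a b
    unfolding n_def a_def b_def by (rule search_instance_index[OF S xs f \<kappa>(1) g \<kappa>(2)])
  have d: "distinct xs" "set xs = S" using xs by (auto simp: permutations_of_set_def)
  have card: "card S = n" using d distinct_card n_def by metis
  have bij: "bij_betw ((!) xs) {..<n} S" using bij_betw_nth[OF d(1), of "{..<n}" "set xs"] d(2) n_def by auto
  let ?list = "\<lambda>\<pi>. map (\<lambda>i. xs ! \<pi> i) [0..<n]"
  have perm: "?list \<pi> \<in> permutations_of_set S" if "ordering \<pi>" for \<pi>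
  proof -
    have b: "bij_betw (\<lambda>i. xs ! \<pi> i) {..<n} S"
      using bij_betw_trans[OF that[unfolded ordering_def] bij] by (simp add: o_def)
    then show ?thesis
      by (auto simp: permutations_of_set_def distinct_map bij_betw_def lessThan_atLeast0)
  qed
  have cost_list: "search_cost S f g (?list \<pi>) = cost \<pi>" if "ordering \<pi>" for \<pi>
  proof -
    have "set (take k (?list \<pi>)) = (!) xs ` pre \<pi> k" if "k \<le> n" for k
      using that by (simp add: take_map image_image lessThan_atLeast0)
    then show ?thesis
      unfolding search_cost_sequence[OF perm[OF that]] cost_def incG_def by (intro sum.cong) auto
  qed
  obtain t N R where ex: "exec ?F ?G n program (init_state n) t (N, R)" and t: "t \<le> 6000 * (n + 1) ^ 85"
    and o: "ordering (out N)" and sol: "solved (out N) 0 n"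
  proof -
    have "runs ?F ?G n program (fst (init_state n)) (snd (init_state n))
        (\<lambda>N' R'. ordering (out N') \<and> solved (out N') 0 n) (6000 * (n + 1) ^ 85)"
      by (rule runs_program) (simp add: init_state_def store_def)
    then show ?thesis unfolding runs_def using that by auto
  qed
  let ?\<pi> = "?list (out N)"
  have best: "search_cost S f g ?\<pi> \<le> ratio * search_cost S f g \<sigma>" if \<sigma>: "\<sigma> \<in> permutations_of_set S" for \<sigma>
  proof -
    have ds: "distinct \<sigma>" "set \<sigma> = S" using \<sigma> by (auto simp: permutations_of_set_def)
    then have len: "length \<sigma> = n" using card distinct_card by metis
    define \<rho> where "\<rho> = (\<lambda>k. inv_into {..<n} ((!) xs) (\<sigma> ! k))"
    have bs: "bij_betw ((!) \<sigma>) {..<n} S" using bij_betw_nth[OF ds(1), of "{..<n}" "set \<sigma>"] ds(2) len by auto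
    have \<rho>: "ordering \<rho>"
      using bij_betw_trans[OF bs bij_betw_inv_into[OF bij]] by (simp add: ordering_def \<rho>_def o_def)
    have "?list \<rho> = \<sigma>"
    proof (rule nth_equalityI)
      fix k assume "k < length (?list \<rho>)"
      then have k: "k < n" by simp
      then have "\<sigma> ! k \<in> S" using ds(2) len by auto
      then show "?list \<rho> ! k = \<sigma> ! k" using k bij_betw_inv_into_right[OF bij] by (simp add: \<rho>_def)
    qed (simp add: len)
    then show ?thesis using solved_ratio[OF o sol \<rho>] cost_list[OF o] cost_list[OF \<rho>] by simp
  qed
  have fin: "finite (permutations_of_set S)" "permutations_of_set S \<noteq> {}" using S xs by auto
  define opt where "opt = Min (search_cost S f g ` permutations_of_set S)"
  have "opt \<in> search_cost S f g ` permutations_of_set S" unfolding opt_def using fin by (intro Min_in) auto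
  then obtain \<sigma> where \<sigma>: "\<sigma> \<in> permutations_of_set S" "opt = search_cost S f g \<sigma>" by auto
  have main: "search_cost S f g ?\<pi> \<le> 2 / (1 + a * b) * opt"
    using best[OF \<sigma>(1)] \<sigma>(2) by (simp add: ratio_def)
  \<comment> \<open>Relaxing the ratio to \<open>2 / (1 + \<delta>)\<close> requires a nonnegative
    optimum.\<close>
  have opt0: "0 \<le> opt"
  proof -
    have sub: "searched_upto \<sigma> j \<subseteq> S" if "j \<in> S" for j
      using \<sigma>(1) that set_takeWhileD[of _ "\<lambda>i. i \<noteq> j" \<sigma>] by (auto simp: searched_upto_def permutations_of_set_def)
    have "0 \<le> (g (searched_upto \<sigma> j) - g (searched_upto \<sigma> j - {j})) * f (searched_upto \<sigma> j)" if "j \<in> S" for j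
    proof (rule mult_nonneg_nonneg)
      have "searched_upto \<sigma> j - {j} \<in> Pow S" "searched_upto \<sigma> j \<in> Pow S" using sub[OF that] by auto
      then show "0 \<le> g (searched_upto \<sigma> j) - g (searched_upto \<sigma> j - {j})"
        using mono_onD[OF mono, of "searched_upto \<sigma> j - {j}" "searched_upto \<sigma> j"] by auto
      show "0 \<le> f (searched_upto \<sigma> j)" using f0 sub[OF that] by blast
    qed
    then show ?thesis unfolding \<sigma>(2) search_cost_def by (rule sum_nonneg)
  qed
  define \<delta> where "\<delta> = min (a * b) (2 * (a * b) * max a b / (1 + a * b))"
  have \<delta>: "0 \<le> \<delta>" "\<delta> \<le> a * b" using ab theta by (auto simp: \<delta>_def)
  then have "2 / (1 + a * b) \<le> 2 / (1 + \<delta>)" by (intro divide_left_mono) auto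
  then have "search_cost S f g ?\<pi> \<le> 2 / (1 + \<delta>) * opt"
    using main opt0 mult_right_mono order_trans by blast
  moreover have "computes_list program xs f g t ?\<pi>"
    unfolding computes_list_def n_def[symmetric] using ex orderingD(3)[OF o] by blast
  moreover have "t \<le> poly ([:6000:] * [:1, 1:] ^ 85) (card S)"
    using t unfolding card by (simp add: poly_power add.commute)
  ultimately show "\<exists>t \<pi>. computes_list program xs f g t \<pi> \<and> t \<le> poly ([:6000:] * [:1, 1:] ^ 85) (card S)
        \<and> \<pi> \<in> permutations_of_set S
        \<and> (let \<kappa>f = total_curvature S f;
               \<kappa>g = total_curvature S (dual S g);
               \<theta> = (1 - \<kappa>f) * (1 - \<kappa>g);
               \<delta> = min \<theta> (2 * \<theta> * max (1 - \<kappa>f) (1 - \<kappa>g) / (1 + \<theta>))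
           in has_approx_ratio S f g \<pi> (2 / (1 + \<delta>))
              \<and> (modular_on S f \<or> modular_on S g \<longrightarrow> has_approx_ratio S f g \<pi> (2 / (1 + \<theta>))))"
    using perm[OF o] main
    by (intro exI[of _ t] exI[of _ ?\<pi>])
       (simp add: Let_def has_approx_ratio_def opt_def \<delta>_def a_def b_def)
qed

end
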